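(* Assume the discrete Slater condition: there is $\tilde U\in\mathbb U_{h\tau}$ with $G_{h\tau}(\tilde U)<0$. Let $(X_{h\tau},U_{h\tau})\in K_{h\tau}\times\mathbb U_{h\tau}$ be a solution of the fully discrete problem (P$_{h\tau}$). Then there exist a constant $\mu_{h\tau}\ge0$ and a pair $(Y_{h\tau},Z_{h\tau})\in(\mathbb U_{h\tau})^2$ such that for $n=0,1,\dots,N-1$ $$\begin{cases}X_{h\tau}(t_{n+1})-X_{h\tau}(t_n)=\tau[\Delta_hX_{h\tau}(t_{n+1})+U_{h\tau}(t_n)]+\Pi^1_h\sigma(t_n)\Delta W_{n+1},\quad X_{h\tau}(0)=\Pi^1_hX_0,\\ Z_{h\tau}(t_n)=\mathbb E\big[(\tau^{-1}Y_{h\tau}(t_{n+1})+\Pi^1_h(X_{h\tau}(t_{n+1})-X_d(t_{n+1})))\Delta W_{n+1}\,\big|\,\mathcal F_{t_n}\big],\\ Y_{h\tau}(t_n)=\mathbb E\big[Y_{h\tau}(t_{n+1})+\tau\Delta_hY_{h\tau}(t_n)+\tau\Pi^1_h(X_{h\tau}(t_{n+1})-X_d(t_{n+1})+\mu_{h\tau})\,\big|\,\mathcal F_{t_n}\big],\quad Y_{h\tau}(T)=0,\\ \mathbb E\big[[\mu_{h\tau},W_{h\tau}-X_{h\tau}]\big]\le0\quad\forall W_{h\tau}\in K_{h\tau},\\ Y_{h\tau}(t)+\alpha U_{h\tau}(t)=0,\end{cases}$$ and $\mu_{h\tau}=0$ whenever $\mathbb E[[1,X_{h\tau}]]<\delta$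 (i.e. $\mu_{h\tau}G_{h\tau}(U_{h\tau})=0$).
   Context: Setting: $T>0$; complete probability space $(\Omega,\mathcal F,\mathbb F,P)$ with $\mathbb F=\{\mathcal F_t\}$ the natural filtration of a one-dimensional standard Brownian motion $W_t$; $\mathcal D\subset\mathbb R^d$ ($d=1,2,3$) bounded with smooth boundary; $\|\cdot\|,(\cdot,\cdot)$ the $L^2(\mathcal D)$ norm/inner product; $[U,V]=\int_0^T\int_{\mathcal D}UV\,dx\,dt$. Data $\alpha>0$, $\delta\in\mathbb R$, $X_0\in L^2(\mathcal D)$, $X_d,\sigma$ $\mathbb F$-adapted $L^2(\mathcal D)$-valued, square integrable. Finite elements: $\mathcal T_h$ regular triangulation of $\mathcal D$ with mesh size $h$; $\mathbb V^1_h$ continuous piecewise linear functions vanishing on $\partial\mathcal D$; $\Pi^1_h$ the $L^2$-projection onto $\mathbb V^1_h$; $\Delta_h$ the discrete Laplacian $(-\Delta_h\xi_h,\phi_h)=(\nabla\xi_h,\nabla\phi_h)$ on $\mathbb V^1_h$. Time grid: $t_n=n\tau$, $\tau=T/N\le1$, $\Delta W_{n+1}=W_{t_{n+1}}-W_{t_n}$. Spaces: $\mathbb X_{h\tau}$ = $\mathbb F$-adapted square-integrable $\mathbb V^1_h$-valued processes with $X(t)=\mathbb E[X(t_{n+1})|\mathcal F_{t_n}]$ for $t\in(t_n,t_{n+1})$; $\mathbb U_{h\tau}$ = $\mathbb F$-adapted square-integrable $\mathbb V^1_h$-valued processes with $U(t)=U(t_n)$ for $t\in[t_n,t_{n+1})$.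 $\tilde X_d(t_n)=X_d(t_n)$ and $\tilde X_d(t)=\mathbb E[X_d(t_{n+1})|\mathcal F_{t_n}]$ for $t\in(t_n,t_{n+1})$. $K=\{X:\int_0^T\int_{\mathcal D}\mathbb E[X]dxdt\le\delta\}$, $K_{h\tau}=K\cap\mathbb X_{h\tau}$. For $U_{h\tau}\in\mathbb U_{h\tau}$, $X_{h\tau}(U_{h\tau})\in\mathbb X_{h\tau}$ is given by the implicit scheme $X(t_{n+1})-X(t_n)=\tau[\Delta_hX(t_{n+1})+U_{h\tau}(t_n)]+\Pi^1_h\sigma(t_n)\Delta W_{n+1}$, $X(0)=\Pi^1_hX_0$. $G_{h\tau}(U_{h\tau})=\int_0^T\int_{\mathcal D}\mathbb E[X_{h\tau}(U_{h\tau})]dxdt-\delta$. Problem (P$_{h\tau}$): minimize $\frac12\int_0^T\mathbb E[\|X_{h\tau}-\tilde X_d\|^2+\alpha\|U_{h\tau}\|^2]dt$ over $U_{h\tau}\in\mathbb U_{h\tau}$ with $X_{h\tau}=X_{h\tau}(U_{h\tau})$ and $G_{h\tau}(U_{h\tau})\le0$.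
   Formalization: As a smooth domain has no exact simplicial triangulation for d=2,3, the mesh triangulates a polyhedral region inside the closure of D, with finite element functions extended by zero; Y+αU=0 is asserted for t in [0,T), since U(T) is unconstrained while Y(T)=0. *)

theory Defs
  imports "HOL-Probability.Probability"
begin

definition sqint :: "'x::euclidean_space set \<Rightarrow> ('x \<Rightarrow> real) \<Rightarrow> bool" where
  "sqint D f \<longleftrightarrow> f \<in> borel_measurable (lebesgue_on D) \<and> integrable (lebesgue_on D) (\<lambda>x. (f x)\<^sup>2)"

definition l2ip :: "'x::euclidean_space set \<Rightarrow> ('x \<Rightarrow> real) \<Rightarrow> ('x \<Rightarrow> real) \<Rightarrow> real" where
  "l2ip D f g = (\<integral>x. f x * g x \<partial>lebesgue_on D)"

definition normsq :: "'x::euclidean_space set \<Rightarrow> ('x \<Rightarrow> real) \<Rightarrow> real" where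
  "normsq D f = l2ip D f f"

primrec Ck :: "nat \<Rightarrow> 'x::euclidean_space set \<Rightarrow> ('x \<Rightarrow> real) set" where
  "Ck 0 S = {f. continuous_on S f}"
| "Ck (Suc k) S = {f. (\<forall>x\<in>S. f differentiable (at x)) \<and>
        (\<forall>v. (\<lambda>x. frechet_derivative f (at x) v) \<in> Ck k S)}"

definition smooth_on_set :: "'x::euclidean_space set \<Rightarrow> ('x \<Rightarrow> real) \<Rightarrow> bool" where
  "smooth_on_set S f \<longleftrightarrow> (\<forall>k. f \<in> Ck k S)"

definition smooth_boundary :: "'x::euclidean_space set \<Rightarrow> bool" where
  "smooth_boundary D \<longleftrightarrow> (\<forall>p\<in>frontier D. \<exists>r>0. \<exists>\<psi>. smooth_on_set (ball p r) \<psi> \<and>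
      frechet_derivative \<psi> (at p) \<noteq> (\<lambda>v. 0) \<and>
      D \<inter> ball p r = {x\<in>ball p r. \<psi> x < 0})"

definition dsimplex :: "'x::euclidean_space set \<Rightarrow> bool" where
  "dsimplex K \<longleftrightarrow> (\<exists>S. finite S \<and> card S = DIM('x) + 1 \<and> \<not> affine_dependent S \<and> K = convex hull S)"

definition vertices :: "'x::euclidean_space set \<Rightarrow> 'x set" where
  "vertices K = {v. v extreme_point_of K}"

definition regular_triangulation :: "'x::euclidean_space set set \<Rightarrow> bool" where
  "regular_triangulation Th \<longleftrightarrow> finite Th \<and> Th \<noteq> {} \<and> (\<forall>K\<in>Th. dsimplex K) \<and>
     (\<forall>K1\<in>Th. \<forall>K2\<in>Th. K1 \<noteq> K2 \<longrightarrow> K1 \<inter> K2 = convex hull (vertices K1 \<inter> vertices K2))"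

text \<open>V_h^1: continuous, affine on every simplex, vanishing outside (hence on the
  boundary of) the triangulated region\<close>
definition Vh :: "'x::euclidean_space set set \<Rightarrow> ('x \<Rightarrow> real) set" where
  "Vh Th = {v. continuous_on UNIV v \<and> (\<forall>x. x \<notin> \<Union>Th \<longrightarrow> v x = 0) \<and>
      (\<forall>K\<in>Th. \<exists>a b. \<forall>x\<in>K. v x = inner a x + b)}"

definition grad :: "('x::euclidean_space \<Rightarrow> real) \<Rightarrow> 'x \<Rightarrow> 'x" where
  "grad f x = (SOME g. GDERIV f x :> g)"

definition dform :: "'x::euclidean_space set \<Rightarrow> ('x \<Rightarrow> real) \<Rightarrow> ('x \<Rightarrow> real) \<Rightarrow> real" where
  "dform D f g = (\<integral>x. inner (grad f x) (grad g x) \<partial>lebesgue_on D)"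

definition Pih :: "'x::euclidean_space set \<Rightarrow> 'x set set \<Rightarrow> ('x \<Rightarrow> real) \<Rightarrow> ('x \<Rightarrow> real)" where
  "Pih D Th f = (THE v. v \<in> Vh Th \<and> (\<forall>\<phi>\<in>Vh Th. l2ip D (\<lambda>x. f x - v x) \<phi> = 0))"

definition Laph :: "'x::euclidean_space set \<Rightarrow> 'x set set \<Rightarrow> ('x \<Rightarrow> real) \<Rightarrow> ('x \<Rightarrow> real)" where
  "Laph D Th \<xi> = (THE v. v \<in> Vh Th \<and> (\<forall>\<phi>\<in>Vh Th. - l2ip D v \<phi> = dform D \<xi> \<phi>))"

definition std_BM :: "'w measure \<Rightarrow> (real \<Rightarrow> 'w \<Rightarrow> real) \<Rightarrow> bool" where
  "std_BM M W \<longleftrightarrow> prob_space M \<and>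
     (\<forall>t\<ge>0. W t \<in> borel_measurable M) \<and>
     (AE \<omega> in M. W 0 \<omega> = 0 \<and> continuous_on {0..} (\<lambda>t. W t \<omega>)) \<and>
     (\<forall>s t. 0 \<le> s \<and> s < t \<longrightarrow>
        distributed M lborel (\<lambda>\<omega>. W t \<omega> - W s \<omega>) (\<lambda>x. ennreal (normal_density 0 (sqrt (t - s)) x))) \<and>
     (\<forall>(ts::nat \<Rightarrow> real) k. 0 \<le> ts 0 \<and> (\<forall>i<k. ts i < ts (Suc i)) \<longrightarrow>
        prob_space.indep_vars M (\<lambda>_. borel) (\<lambda>i \<omega>. W (ts (Suc i)) \<omega> - W (ts i) \<omega>) {..<k})"

definition natfilt :: "'w measure \<Rightarrow> (real \<Rightarrow> 'w \<Rightarrow> real) \<Rightarrow> real \<Rightarrow> 'w measure" where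
  "natfilt M W t = sigma (space M)
     ({W s -` B \<inter> space M | s B. 0 \<le> s \<and> s \<le> t \<and> B \<in> sets borel} \<union> null_sets M)"

text \<open>G-measurability of an L2(D)-valued random variable (weak measurability; equivalent
  to strong measurability by Pettis' theorem, L2(D) being separable)\<close>
definition wmeas :: "'x::euclidean_space set \<Rightarrow> 'w measure \<Rightarrow> ('w \<Rightarrow> 'x \<Rightarrow> real) \<Rightarrow> bool" where
  "wmeas D G \<xi> \<longleftrightarrow> (\<forall>\<phi>. sqint D \<phi> \<longrightarrow> (\<lambda>\<omega>. l2ip D (\<xi> \<omega>) \<phi>) \<in> borel_measurable G)"

definition cexpVh :: "'w measure \<Rightarrow> 'x::euclidean_space set \<Rightarrow> 'x set set \<Rightarrow> 'w measure
    \<Rightarrow> ('w \<Rightarrow> 'x \<Rightarrow> real) \<Rightarrow> ('w \<Rightarrow> 'x \<Rightarrow> real) \<Rightarrow> bool" where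
  "cexpVh M D Th G \<xi> \<eta> \<longleftrightarrow> (\<forall>\<phi>\<in>Vh Th. AE \<omega> in M.
      l2ip D (\<eta> \<omega>) \<phi> = real_cond_exp M G (\<lambda>\<omega>'. l2ip D (\<xi> \<omega>') \<phi>) \<omega>)"

definition cexpL2 :: "'w measure \<Rightarrow> 'x::euclidean_space set \<Rightarrow> 'w measure
    \<Rightarrow> ('w \<Rightarrow> 'x \<Rightarrow> real) \<Rightarrow> ('w \<Rightarrow> 'x \<Rightarrow> real) \<Rightarrow> bool" where
  "cexpL2 M D G \<xi> \<eta> \<longleftrightarrow> (\<forall>\<omega>\<in>space M. sqint D (\<eta> \<omega>)) \<and> wmeas D G \<eta> \<and>
     (\<forall>\<phi>. sqint D \<phi> \<longrightarrow> (AE \<omega> in M.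
        l2ip D (\<eta> \<omega>) \<phi> = real_cond_exp M G (\<lambda>\<omega>'. l2ip D (\<xi> \<omega>') \<phi>) \<omega>))"

definition tn :: "real \<Rightarrow> nat \<Rightarrow> nat \<Rightarrow> real" where
  "tn T N n = real n * (T / real N)"

definition adapted_L2 :: "'w measure \<Rightarrow> (real \<Rightarrow> 'w \<Rightarrow> real) \<Rightarrow> 'x::euclidean_space set \<Rightarrow> real
    \<Rightarrow> (real \<Rightarrow> 'w \<Rightarrow> 'x \<Rightarrow> real) \<Rightarrow> bool" where
  "adapted_L2 M W D T X \<longleftrightarrow> (\<forall>t\<in>{0..T}. (\<forall>\<omega>\<in>space M. sqint D (X t \<omega>)) \<and>
      wmeas D (natfilt M W t) (X t) \<and> integrable M (\<lambda>\<omega>. normsq D (X t \<omega>)))"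

definition Uspace :: "'w measure \<Rightarrow> (real \<Rightarrow> 'w \<Rightarrow> real) \<Rightarrow> 'x::euclidean_space set \<Rightarrow> 'x set set
    \<Rightarrow> real \<Rightarrow> nat \<Rightarrow> (real \<Rightarrow> 'w \<Rightarrow> 'x \<Rightarrow> real) \<Rightarrow> bool" where
  "Uspace M W D Th T N U \<longleftrightarrow> adapted_L2 M W D T U \<and>
     (\<forall>t\<in>{0..T}. \<forall>\<omega>\<in>space M. U t \<omega> \<in> Vh Th) \<and>
     (\<forall>n<N. \<forall>t\<in>{tn T N n..<tn T N (Suc n)}. \<forall>\<omega>\<in>space M. U t \<omega> = U (tn T N n) \<omega>)"

definition Xspace :: "'w measure \<Rightarrow> (real \<Rightarrow> 'w \<Rightarrow> real) \<Rightarrow> 'x::euclidean_space set \<Rightarrow> 'x set set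
    \<Rightarrow> real \<Rightarrow> nat \<Rightarrow> (real \<Rightarrow> 'w \<Rightarrow> 'x \<Rightarrow> real) \<Rightarrow> bool" where
  "Xspace M W D Th T N X \<longleftrightarrow> adapted_L2 M W D T X \<and>
     (\<forall>t\<in>{0..T}. \<forall>\<omega>\<in>space M. X t \<omega> \<in> Vh Th) \<and>
     (\<forall>n<N. \<forall>t\<in>{tn T N n<..<tn T N (Suc n)}.
        cexpVh M D Th (natfilt M W (tn T N n)) (X (tn T N (Suc n))) (X t))"

definition state :: "'w measure \<Rightarrow> (real \<Rightarrow> 'w \<Rightarrow> real) \<Rightarrow> 'x::euclidean_space set \<Rightarrow> 'x set set
    \<Rightarrow> real \<Rightarrow> nat \<Rightarrow> ('x \<Rightarrow> real) \<Rightarrow> (real \<Rightarrow> 'w \<Rightarrow> 'x \<Rightarrow> real)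
    \<Rightarrow> (real \<Rightarrow> 'w \<Rightarrow> 'x \<Rightarrow> real) \<Rightarrow> (real \<Rightarrow> 'w \<Rightarrow> 'x \<Rightarrow> real) \<Rightarrow> bool" where
  "state M W D Th T N X0 \<sigma> U X \<longleftrightarrow> Xspace M W D Th T N X \<and>
     (\<forall>\<omega>\<in>space M. X 0 \<omega> = Pih D Th X0) \<and>
     (\<forall>n<N. \<forall>\<omega>\<in>space M.
        (\<lambda>x. X (tn T N (Suc n)) \<omega> x - X (tn T N n) \<omega> x) =
        (\<lambda>x. (T / real N) * (Laph D Th (X (tn T N (Suc n)) \<omega>) x + U (tn T N n) \<omega> x)
             + Pih D Th (\<sigma> (tn T N n) \<omega>) x * (W (tn T N (Suc n)) \<omega> - W (tn T N n) \<omega>)))"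

definition EXint :: "'w measure \<Rightarrow> 'x::euclidean_space set \<Rightarrow> real
    \<Rightarrow> (real \<Rightarrow> 'w \<Rightarrow> 'x \<Rightarrow> real) \<Rightarrow> real" where
  "EXint M D T X = (\<integral>t. (\<integral>x. (\<integral>\<omega>. X t \<omega> x \<partial>M) \<partial>lebesgue_on D) \<partial>lebesgue_on {0..T})"

text \<open>G_{h tau}, evaluated at the state X = X_{h tau}(U)\<close>
definition Gh :: "'w measure \<Rightarrow> 'x::euclidean_space set \<Rightarrow> real \<Rightarrow> real
    \<Rightarrow> (real \<Rightarrow> 'w \<Rightarrow> 'x \<Rightarrow> real) \<Rightarrow> real" where
  "Gh M D T \<delta> X = EXint M D T X - \<delta>"

definition Xdtil :: "'w measure \<Rightarrow> (real \<Rightarrow> 'w \<Rightarrow> real) \<Rightarrow> 'x::euclidean_space set \<Rightarrow> real \<Rightarrow> nat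
    \<Rightarrow> (real \<Rightarrow> 'w \<Rightarrow> 'x \<Rightarrow> real) \<Rightarrow> real \<Rightarrow> 'w \<Rightarrow> 'x \<Rightarrow> real" where
  "Xdtil M W D T N Xd t =
     (if \<exists>n::nat. t = tn T N n then Xd t
      else (let n = nat \<lfloor>t / (T / real N)\<rfloor> in
            SOME \<eta>. cexpL2 M D (natfilt M W (tn T N n)) (Xd (tn T N (Suc n))) \<eta>))"

definition Jcost :: "'w measure \<Rightarrow> (real \<Rightarrow> 'w \<Rightarrow> real) \<Rightarrow> 'x::euclidean_space set \<Rightarrow> real \<Rightarrow> nat
    \<Rightarrow> real \<Rightarrow> (real \<Rightarrow> 'w \<Rightarrow> 'x \<Rightarrow> real)
    \<Rightarrow> (real \<Rightarrow> 'w \<Rightarrow> 'x \<Rightarrow> real) \<Rightarrow> (real \<Rightarrow> 'w \<Rightarrow> 'x \<Rightarrow> real) \<Rightarrow> real" where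
  "Jcost M W D T N \<alpha> Xd X U = 1/2 * (\<integral>t. (\<integral>\<omega>.
       normsq D (\<lambda>x. X t \<omega> x - Xdtil M W D T N Xd t \<omega> x) + \<alpha> * normsq D (U t \<omega>) \<partial>M)
     \<partial>lebesgue_on {0..T})"

end

theory Submission
  imports Defs
begin

text \<open>The set of controls is a linear space on which the cost is quadratic and the only constraint is
  one affine inequality, so with the Slater point the multiplier is explicit: if \<open>L\<close> and \<open>g\<close> are
  the derivatives of cost and constraint and \<open>d\<^sub>0\<close> points from the (active) solution to the Slater
  point, then \<open>\<mu> = - L d\<^sub>0 / g d\<^sub>0\<close>, because \<open>d - (g d / g d\<^sub>0) d\<^sub>0\<close> is feasible in both senses for
  every \<open>d\<close>. Hence \<open>L + \<mu> g = 0\<close>.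

  No adjoint state has to be constructed: put \<open>Y = - \<alpha> U\<close> before time \<open>T\<close>. Differences of states
  solve the scheme without noise, so one may prescribe the state perturbation \<open>1\<^sub>A \<phi>\<close> on a single
  time interval, with \<open>A\<close> in the past of its left endpoint, and read the control off the scheme.
  Then \<open>L + \<mu> g = 0\<close> is the backward equation for \<open>Y\<close> integrated over \<open>A\<close> against \<open>\<phi>\<close>.

  Two facts must be supplied. The averaged target \<open>X\<^sub>d\<close> is defined by choice, so the conditional
  expectation of an \<open>L\<^sup>2\<close>-valued random variable has to be shown to exist (Riesz--Fischer in a
  total orthonormal sequence). And \<open>Z\<close> is square integrable because the increments of the Brownian
  motion are independent of the augmented filtration.\<close>

text \<open>For differences of states the implicit scheme reads \<open>(1 - \<tau> \<Delta>\<^sub>h)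
  E(t\<^sub>n\<^sub>+\<^sub>1) = E(t\<^sub>n) + \<tau> V(t\<^sub>n)\<close>: a perturbation of the
  state at a grid point is already known one step earlier. Test perturbations on the interval from
  grid point n to grid point n+1 are therefore measurable for the past of its left end, and duality
  can determine the backward equation only after conditioning on that past, which is the form in
  which it is claimed. The same conditioning removes the averaged target: integrated over an event
  of the past, the averaged state and target may be replaced by their values at the right end.

  The control at time \<open>T\<close> enters neither the scheme nor the cost, so prescribing
  \<open>Y = 0\<close> at \<open>T\<close> does not conflict with \<open>Y = - \<alpha> U\<close> on
  \<open>[0,T)\<close>. In the last interval the second part of the test control would act from
  \<open>T\<close> on and so drops out of the derivative; this matches the terminal condition
  exactly.

  \<open>Z\<close> occurs in no other equation. It is defined by its own formula, and only
  membership in the space of controls has to be proved for it.\<close>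

section \<open>The pairing and seminorm of square integrable functions\<close>

lemma sqint_measurable: "sqint D f \<Longrightarrow> f \<in> borel_measurable (lebesgue_on D)"
  by (simp add: sqint_def)

lemma sqint_integrable_mult:
  assumes "sqint D f" "sqint D g"
  shows "integrable (lebesgue_on D) (\<lambda>x. f x * g x)"
proof (rule Bochner_Integration.integrable_bound)
  show "integrable (lebesgue_on D) (\<lambda>x. (f x)\<^sup>2 + (g x)\<^sup>2)"
    using assms by (simp add: sqint_def)
  show "(\<lambda>x. f x * g x) \<in> borel_measurable (lebesgue_on D)"
    using assms by (auto simp: sqint_def)
  have "\<bar>a * b\<bar> \<le> a\<^sup>2 + b\<^sup>2" for a b :: real
    using sum_squares_bound[of a b] sum_squares_bound[of "-a" b] by (auto simp: abs_if)
  then show "AE x in lebesgue_on D. norm (f x * g x) \<le> norm ((f x)\<^sup>2 + (g x)\<^sup>2)"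
    by auto
qed

lemma sqint_zero [simp]: "sqint D (\<lambda>x. 0)"
  by (simp add: sqint_def)

lemma sqint_cmult: "sqint D f \<Longrightarrow> sqint D (\<lambda>x. c * f x)"
  by (auto simp: sqint_def power_mult_distrib)

lemma sqint_add:
  assumes "sqint D f" "sqint D g"
  shows "sqint D (\<lambda>x. f x + g x)"
proof -
  have "integrable (lebesgue_on D) (\<lambda>x. (f x)\<^sup>2 + 2 * (f x * g x) + (g x)\<^sup>2)"
    using assms sqint_integrable_mult[OF assms] by (simp add: sqint_def)
  moreover have "(\<lambda>x. (f x)\<^sup>2 + 2 * (f x * g x) + (g x)\<^sup>2) = (\<lambda>x. (f x + g x)\<^sup>2)"
    by (auto simp: power2_eq_square algebra_simps)
  ultimately show ?thesis
    using assms by (auto simp: sqint_def)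
qed

lemma sqint_diff: "sqint D f \<Longrightarrow> sqint D g \<Longrightarrow> sqint D (\<lambda>x. f x - g x)"
  using sqint_add[of D f "\<lambda>x. -1 * g x"] sqint_cmult[of D g "-1"] by simp

lemma sqint_sum:
  assumes "\<And>i. i \<in> I \<Longrightarrow> sqint D (f i)"
  shows "sqint D (\<lambda>x. \<Sum>i\<in>I. f i x)"
  using assms by (induction I rule: infinite_finite_induct) (auto intro: sqint_add)

lemma l2ip_commute: "l2ip D f g = l2ip D g f"
  by (simp add: l2ip_def mult.commute)

lemma l2ip_add_left:
  assumes "sqint D f" "sqint D g" "sqint D h"
  shows "l2ip D (\<lambda>x. f x + g x) h = l2ip D f h + l2ip D g h"
  using assms by (simp add: l2ip_def distrib_right sqint_integrable_mult)

lemma l2ip_cmult_left: "l2ip D (\<lambda>x. c * f x) h = c * l2ip D f h"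
  by (simp add: l2ip_def mult.assoc)

lemma l2ip_zero_left [simp]: "l2ip D (\<lambda>x. 0) h = 0"
  by (simp add: l2ip_def)

lemma l2ip_diff_left:
  assumes "sqint D f" "sqint D g" "sqint D h"
  shows "l2ip D (\<lambda>x. f x - g x) h = l2ip D f h - l2ip D g h"
  using assms by (simp add: l2ip_def left_diff_distrib sqint_integrable_mult)

lemma l2ip_sum_left:
  assumes "\<And>i. i \<in> I \<Longrightarrow> sqint D (f i)" "sqint D h"
  shows "l2ip D (\<lambda>x. \<Sum>i\<in>I. f i x) h = (\<Sum>i\<in>I. l2ip D (f i) h)"
  using assms by (simp add: l2ip_def sum_distrib_right sqint_integrable_mult)

lemma l2ip_sum_cmult_left:
  assumes "\<And>i. i \<in> I \<Longrightarrow> sqint D (f i)" "sqint D h"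
  shows "l2ip D (\<lambda>x. \<Sum>i\<in>I. c i * f i x) h = (\<Sum>i\<in>I. c i * l2ip D (f i) h)"
  using assms by (simp add: l2ip_sum_left sqint_cmult l2ip_cmult_left)

lemma normsq_nonneg: "0 \<le> normsq D f"
  by (simp add: normsq_def l2ip_def)

lemma normsq_add:
  assumes "sqint D f" "sqint D g"
  shows "normsq D (\<lambda>x. f x + g x) = normsq D f + 2 * l2ip D f g + normsq D g"
proof -
  have "normsq D (\<lambda>x. f x + g x)
      = (\<integral>x. f x * f x + 2 * (f x * g x) + g x * g x \<partial>lebesgue_on D)"
    unfolding normsq_def l2ip_def by (intro Bochner_Integration.integral_cong) (auto simp: algebra_simps)
  also have "\<dots> = normsq D f + 2 * l2ip D f g + normsq D g"
    unfolding normsq_def l2ip_def using assms by (simp add: sqint_integrable_mult)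
  finally show ?thesis .
qed

lemma normsq_cmult: "normsq D (\<lambda>x. c * f x) = c\<^sup>2 * normsq D f"
  unfolding normsq_def l2ip_cmult_left
  by (subst l2ip_commute, subst l2ip_cmult_left) (simp add: power2_eq_square)

lemma normsq_diff:
  assumes "sqint D f" "sqint D g"
  shows "normsq D (\<lambda>x. f x - g x) = normsq D f - 2 * l2ip D f g + normsq D g"
  using normsq_add[OF assms(1) sqint_cmult[OF assms(2), of "-1"]] normsq_cmult[of D "-1" g]
    l2ip_cmult_left[of D "-1" g f] by (simp add: l2ip_commute[of D f])

text \<open>Expanding the squares of sum and difference gives a majorant without square roots, which
  is directly integrable when both arguments are square integrable random variables.\<close>

lemma l2ip_abs_le:
  assumes "sqint D f" "sqint D g"
  shows "2 * \<bar>l2ip D f g\<bar> \<le> normsq D f + normsq D g"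
  using normsq_add[OF assms] normsq_diff[OF assms]
    normsq_nonneg[of D "\<lambda>x. f x + g x"] normsq_nonneg[of D "\<lambda>x. f x - g x"] by linarith

lemma l2ip_Cauchy_Schwarz:
  assumes "sqint D f" "sqint D g"
  shows "(l2ip D f g)\<^sup>2 \<le> normsq D f * normsq D g"
proof -
  have q: "0 \<le> normsq D f + 2 * c * l2ip D f g + c\<^sup>2 * normsq D g" for c
    using normsq_nonneg[of D "\<lambda>x. f x + c * g x"] normsq_add[OF assms(1) sqint_cmult[OF assms(2), of c]]
      l2ip_cmult_left[of D c g f] by (simp add: l2ip_commute[of D f] normsq_cmult algebra_simps)
  show ?thesis
  proof (cases "normsq D g = 0")
    case True
    have "l2ip D f g = 0"
    proof (rule ccontr)
      assume n: "l2ip D f g \<noteq> 0"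
      \<comment> \<open>If \<open>g\<close> has norm 0 the quadratic is affine in \<open>c\<close>;
        this choice of \<open>c\<close> gives it the value -1.\<close>
      show False
        using q[of "- (normsq D f + 1) / (2 * l2ip D f g)"] n True by (simp add: field_simps)
    qed
    then show ?thesis using True by simp
  next
    case False
    then have p: "normsq D g > 0" using normsq_nonneg[of D g] by simp
    have "normsq D f - (l2ip D f g)\<^sup>2 / normsq D g \<ge> 0"
      using q[of "- l2ip D f g / normsq D g"] p by (simp add: power2_eq_square field_simps)
    then show ?thesis using p by (simp add: field_simps)
  qed
qed

text \<open>Functions are not identified almost everywhere, so norm 0 does not mean zero.
  Invisibility to the pairing is the substitute used from here on.\<close>

lemma l2ip_eq_0_if_normsq_eq_0:
  assumes "sqint D f" "sqint D g" "normsq D g = 0"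
  shows "l2ip D f g = 0"
  using l2ip_Cauchy_Schwarz[OF assms(1,2)] assms(3) by simp

section \<open>Orthonormal systems\<close>

text \<open>Vanishing elements are admitted, so that Gram--Schmidt applies to dependent sequences.\<close>

definition ortho_seq :: "'x::euclidean_space set \<Rightarrow> (nat \<Rightarrow> 'x \<Rightarrow> real) \<Rightarrow> bool" where
  "ortho_seq D e \<longleftrightarrow> (\<forall>k. sqint D (e k)) \<and> (\<forall>j k. j \<noteq> k \<longrightarrow> l2ip D (e j) (e k) = 0) \<and>
     (\<forall>k. normsq D (e k) \<in> {0, 1})"

fun gram_schmidt :: "'x::euclidean_space set \<Rightarrow> (nat \<Rightarrow> 'x \<Rightarrow> real) \<Rightarrow> nat \<Rightarrow> 'x \<Rightarrow> real" where
  "gram_schmidt D f n =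
     (let g = (\<lambda>x. f n x - (\<Sum>j<n. l2ip D (gram_schmidt D f j) (f n) * gram_schmidt D f j x))
      in (\<lambda>x. 1 / sqrt (normsq D g) * g x))"

declare gram_schmidt.simps [simp del]

text \<open>The third claim treats the squared norms 0 and 1 uniformly: in the first case the
  pairing with \<open>f\<close> vanishes by Cauchy-Schwarz, in the second the factor is 1.\<close>

lemma ortho_seqD:
  assumes "ortho_seq D e"
  shows "sqint D (e k)" "j \<noteq> k \<Longrightarrow> l2ip D (e j) (e k) = 0"
    "sqint D f \<Longrightarrow> l2ip D (e k) f * l2ip D (e k) (e k) = l2ip D (e k) f"
    "l2ip D (e k) (e k) \<le> 1"
proof -
  show "sqint D (e k)" "j \<noteq> k \<Longrightarrow> l2ip D (e j) (e k) = 0"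
    using assms by (auto simp: ortho_seq_def)
  have *: "normsq D (e k) = 0 \<or> normsq D (e k) = 1"
    using assms by (auto simp: ortho_seq_def)
  then show "l2ip D (e k) (e k) \<le> 1"
    by (auto simp: normsq_def)
  show "l2ip D (e k) f * l2ip D (e k) (e k) = l2ip D (e k) f" if f: "sqint D f"
    using * l2ip_eq_0_if_normsq_eq_0[OF f \<open>sqint D (e k)\<close>]
    by (auto simp: normsq_def l2ip_commute[of D f])
qed

lemma l2ip_sum_ortho_seq:
  assumes "ortho_seq D e" "finite I"
  shows "l2ip D (\<lambda>x. \<Sum>i\<in>I. c i * e i x) (e k) = (if k \<in> I then c k * l2ip D (e k) (e k) else 0)"
proof -
  have "l2ip D (\<lambda>x. \<Sum>i\<in>I. c i * e i x) (e k) = (\<Sum>i\<in>I. if i = k then c k * l2ip D (e k) (e k) else 0)"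
    by (subst l2ip_sum_cmult_left) (auto intro!: sum.cong simp: ortho_seqD[OF assms(1)])
  then show ?thesis
    using assms(2) by (simp add: sum.delta)
qed

text \<open>Pythagoras; equality can fail because vanishing members contribute nothing on the
  left.\<close>

lemma normsq_sum_ortho_seq:
  assumes "ortho_seq D e" "finite I"
  shows "normsq D (\<lambda>x. \<Sum>i\<in>I. c i * e i x) \<le> (\<Sum>i\<in>I. (c i)\<^sup>2)"
proof -
  let ?s = "\<lambda>x. \<Sum>i\<in>I. c i * e i x"
  have s: "sqint D ?s"
    by (intro sqint_sum sqint_cmult ortho_seqD[OF assms(1)])
  have "normsq D ?s = (\<Sum>i\<in>I. c i * l2ip D ?s (e i))"
    unfolding normsq_def
    by (subst l2ip_sum_cmult_left) (auto intro!: sum.cong simp: ortho_seqD[OF assms(1)] s l2ip_commute[of D ?s])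
  also have "\<dots> \<le> (\<Sum>i\<in>I. (c i)\<^sup>2)"
  proof (rule sum_mono)
    fix i assume "i \<in> I"
    then have "c i * l2ip D ?s (e i) = (c i)\<^sup>2 * l2ip D (e i) (e i)"
      by (simp add: l2ip_sum_ortho_seq[OF assms] power2_eq_square)
    also have "\<dots> \<le> (c i)\<^sup>2"
      using ortho_seqD(4)[OF assms(1), of i] by (intro mult_left_le) auto
    finally show "c i * l2ip D ?s (e i) \<le> (c i)\<^sup>2" .
  qed
  finally show ?thesis .
qed

lemma Bessel:
  assumes "ortho_seq D e" "sqint D f" "finite I"
  shows "(\<Sum>i\<in>I. (l2ip D (e i) f)\<^sup>2) \<le> normsq D f"
proof -
  let ?s = "\<lambda>x. \<Sum>i\<in>I. l2ip D (e i) f * e i x"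
  have s: "sqint D ?s"
    by (intro sqint_sum sqint_cmult ortho_seqD[OF assms(1)])
  have "l2ip D f ?s = (\<Sum>i\<in>I. (l2ip D (e i) f)\<^sup>2)"
    by (subst l2ip_commute, subst l2ip_sum_cmult_left)
       (auto simp: ortho_seqD[OF assms(1)] assms(2) power2_eq_square)
  with normsq_diff[OF assms(2) s] normsq_nonneg[of D "\<lambda>x. f x - ?s x"]
    normsq_sum_ortho_seq[OF assms(1,3), of "\<lambda>i. l2ip D (e i) f"]
  show ?thesis by linarith
qed

text \<open>The second claim transfers totality: \<open>f k\<close> is its remainder plus a
  combination of earlier members, and the remainder is either a multiple of the normalised member or
  has norm 0 and pairs to 0 with everything. Hence whatever is orthogonal to the new sequence is
  orthogonal to the old one.\<close>

lemma gram_schmidt_ortho_seq: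
  assumes f: "\<And>k. sqint D (f k)"
  shows "ortho_seq D (gram_schmidt D f)"
    and "sqint D h \<Longrightarrow> (\<And>k. l2ip D (gram_schmidt D f k) h = 0) \<Longrightarrow> l2ip D (f k) h = 0"
proof -
  let ?e = "gram_schmidt D f"
  define g where "g n = (\<lambda>x. f n x - (\<Sum>j<n. l2ip D (?e j) (f n) * ?e j x))" for n
  have e: "?e n = (\<lambda>x. 1 / sqrt (normsq D (g n)) * g n x)" for n
    by (subst gram_schmidt.simps) (simp add: g_def Let_def)
  have sqe: "sqint D (?e n)" for n
  proof (induction n rule: less_induct)
    case (less n)
    then have "sqint D (g n)"
      unfolding g_def by (intro sqint_diff f sqint_sum sqint_cmult) auto
    then show ?case unfolding e by (rule sqint_cmult)
  qed
  have sqg: "sqint D (g n)" for n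
    unfolding g_def by (intro sqint_diff f sqint_sum sqint_cmult sqe)
  have n: "normsq D (?e n) \<in> {0, 1}" for n
  proof (cases "normsq D (g n) = 0")
    case True
    then show ?thesis unfolding e by (simp add: normsq_def)
  next
    case False
    then have "normsq D (g n) > 0" using normsq_nonneg[of D "g n"] by simp
    then show ?thesis unfolding e normsq_cmult by (simp add: power_divide)
  qed
  have self: "l2ip D (?e k) h * l2ip D (?e k) (?e k) = l2ip D (?e k) h" if "sqint D h" for k h
    using n[of k] l2ip_eq_0_if_normsq_eq_0[OF that sqe, of k]
    by (auto simp: normsq_def l2ip_commute[of D h])
  have orth: "l2ip D (?e k) (?e j) = 0" if "j < k" for j k
    using that
  proof (induction k arbitrary: j rule: less_induct)
    case (less k)
    have o: "l2ip D (?e i) (?e j) = 0" if "i < k" "i \<noteq> j" for i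
      using less that by (metis l2ip_commute linorder_neqE_nat)
    have "l2ip D (g k) (?e j) = l2ip D (f k) (?e j) - (\<Sum>i<k. l2ip D (?e i) (f k) * l2ip D (?e i) (?e j))"
      unfolding g_def
      by (subst l2ip_diff_left) (auto simp: sqe f l2ip_sum_cmult_left intro!: sqint_sum sqint_cmult)
    also have "(\<Sum>i<k. l2ip D (?e i) (f k) * l2ip D (?e i) (?e j))
        = (\<Sum>i<k. if i = j then l2ip D (?e j) (f k) * l2ip D (?e j) (?e j) else 0)"
      by (intro sum.cong) (auto simp: o)
    also have "\<dots> = l2ip D (f k) (?e j)"
      using less.prems self[OF f, of j k] by (simp add: l2ip_commute[of D "f k"])
    finally have "l2ip D (g k) (?e j) = 0"
      by simp
    moreover have "l2ip D (?e k) (?e j) = 1 / sqrt (normsq D (g k)) * l2ip D (g k) (?e j)"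
      by (subst e[of k]) (rule l2ip_cmult_left)
    ultimately show ?case
      by simp
  qed
  show "ortho_seq D ?e"
    unfolding ortho_seq_def using sqe n orth by (metis l2ip_commute linorder_neqE_nat)
  assume h: "sqint D h" "\<And>k. l2ip D (?e k) h = 0"
  have "l2ip D (g k) h = 0" for k
  proof (cases "normsq D (g k) = 0")
    case True
    then show ?thesis using l2ip_eq_0_if_normsq_eq_0[OF h(1) sqg] by (simp add: l2ip_commute)
  next
    case False
    then show ?thesis using h(2)[of k] normsq_nonneg[of D "g k"] unfolding e l2ip_cmult_left by auto
  qed
  moreover have "l2ip D (g k) h = l2ip D (f k) h - (\<Sum>j<k. l2ip D (?e j) (f k) * l2ip D (?e j) h)" for k
    unfolding g_def
    by (subst l2ip_diff_left) (auto simp: sqe f h(1) l2ip_sum_cmult_left intro!: sqint_sum sqint_cmult)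
  ultimately show "l2ip D (f k) h = 0"
    by (simp add: h)
qed

section \<open>Completeness and total orthonormal sequences of \<open>L\<^sup>2(D)\<close>\<close>

lemma finite_measure_lebesgue_on: "D \<in> lmeasurable \<Longrightarrow> finite_measure (lebesgue_on D)"
  by (rule finite_measureI) (auto simp: emeasure_restrict_space fmeasurable_def)

lemma sqint_const: "D \<in> lmeasurable \<Longrightarrow> sqint D (\<lambda>x. c)"
  by (simp add: sqint_def finite_measure.integrable_const[OF finite_measure_lebesgue_on])

lemma sqint_integrable:
  assumes "D \<in> lmeasurable" "sqint D f"
  shows "integrable (lebesgue_on D) f"
  using sqint_integrable_mult[OF assms(2) sqint_const[OF assms(1), of 1]] by simp

text \<open>The partial sums are Cauchy in the square norm and, \<open>D\<close> having finite
  measure, also in the mean. A subsequence therefore converges almost everywhere, and Fatou shows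
  that its limit is at small square distance from every late partial sum. The limit is described by
  its pairings only, the one thing that is used of it.\<close>

theorem Riesz_Fischer:
  assumes D: "D \<in> lmeasurable" and e: "ortho_seq D e" and c: "summable (\<lambda>k. (c k)\<^sup>2)"
  shows "\<exists>f. sqint D f \<and> (\<forall>g. sqint D g \<longrightarrow> (\<lambda>k. c k * l2ip D (e k) g) sums l2ip D f g)"
proof -
  define S where "S n = (\<lambda>x. \<Sum>k<n. c k * e k x)" for n
  \<comment> \<open>The tail of the series of squares; it bounds the squared distance of any two
    partial sums with indices at least \<open>m\<close>.\<close>
  define t where "t m = (\<Sum>k. (c k)\<^sup>2) - (\<Sum>k<m. (c k)\<^sup>2)" for m
  have sqS: "sqint D (S n)" for n
    unfolding S_def by (intro sqint_sum sqint_cmult ortho_seqD[OF e])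
  have [measurable]: "S n \<in> borel_measurable (lebesgue_on D)" for n
    using sqS by (rule sqint_measurable)
  have t0: "t \<longlonglongrightarrow> 0"
    unfolding t_def using tendsto_diff[OF tendsto_const summable_LIMSEQ[OF c], of "\<Sum>k. (c k)\<^sup>2"] by simp
  have S_t: "normsq D (\<lambda>x. S n x - S m x) \<le> t m" if "m \<le> n" for m n
  proof -
    have split: "(\<Sum>k<n. h k) - (\<Sum>k<m. h k) = (\<Sum>k\<in>{m..<n}. h k)" for h :: "nat \<Rightarrow> real"
      using that by (simp add: atLeast0LessThan[symmetric] sum_diff_nat_ivl)
    have "(\<lambda>x. S n x - S m x) = (\<lambda>x. \<Sum>k\<in>{m..<n}. c k * e k x)"
      unfolding S_def by (simp add: split)
    then have "normsq D (\<lambda>x. S n x - S m x) \<le> (\<Sum>k\<in>{m..<n}. (c k)\<^sup>2)"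
      using normsq_sum_ortho_seq[OF e, of "{m..<n}" c] by simp
    also have "\<dots> \<le> t m"
      unfolding t_def split[symmetric] using sum_le_suminf[OF c, of "{..<n}"] by simp
    finally show ?thesis .
  qed
  have S_t2: "normsq D (\<lambda>x. S i x - S j x) \<le> t N" if "N \<le> i" "N \<le> j" for i j N
  proof -
    have t_mono: "t b \<le> t a" if "a \<le> b" for a b
      unfolding t_def using that by (auto intro!: sum_mono2)
    show ?thesis
    proof (cases "j \<le> i")
      case True
      then show ?thesis using S_t[of j i] t_mono[OF \<open>N \<le> j\<close>] by simp
    next
      case False
      have "normsq D (\<lambda>x. S i x - S j x) = normsq D (\<lambda>x. S j x - S i x)"
        unfolding normsq_def l2ip_def by (intro Bochner_Integration.integral_cong) (auto simp: algebra_simps)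
      then show ?thesis using False S_t[of i j] t_mono[OF \<open>N \<le> i\<close>] by simp
    qed
  qed
  have int1: "(\<integral>x. \<bar>h x\<bar> \<partial>lebesgue_on D)\<^sup>2 \<le> normsq D h * normsq D (\<lambda>x. 1)" if h: "sqint D h" for h
  proof -
    have "sqint D (\<lambda>x. \<bar>h x\<bar>)"
      using h by (auto simp: sqint_def)
    from l2ip_Cauchy_Schwarz[OF this sqint_const[OF D, of 1]] show ?thesis
      by (simp add: l2ip_def normsq_def)
  qed
  have Cauchy: "\<exists>N. \<forall>i\<ge>N. \<forall>j\<ge>N. (\<integral>x. norm (S i x - S j x) \<partial>lebesgue_on D) < \<epsilon>" if "\<epsilon> > 0" for \<epsilon>
  proof -
    have "(\<lambda>n. t n * normsq D (\<lambda>x::'a. 1)) \<longlonglongrightarrow> 0"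
      using tendsto_mult_right[OF t0] by simp
    from order_tendstoD(2)[OF this, of "\<epsilon>\<^sup>2"] that obtain N where N: "t N * normsq D (\<lambda>x::'a. 1) < \<epsilon>\<^sup>2"
      by (auto simp: eventually_sequentially)
    show ?thesis
    proof (intro exI allI impI)
      fix i j assume "N \<le> i" "N \<le> j"
      then have "(\<integral>x. \<bar>S i x - S j x\<bar> \<partial>lebesgue_on D)\<^sup>2 < \<epsilon>\<^sup>2"
        using int1[OF sqint_diff[OF sqS sqS], of i j] N
          mult_right_mono[OF S_t2[of N i j] normsq_nonneg[of D "\<lambda>x::'a. 1"]] by simp
      then show "(\<integral>x. norm (S i x - S j x) \<partial>lebesgue_on D) < \<epsilon>"
        using \<open>\<epsilon> > 0\<close> by (simp add: power_less_imp_less_base)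
    qed
  qed
  obtain r where r: "strict_mono r" "AE x in lebesgue_on D. Cauchy (\<lambda>i. S (r i) x)"
    using cauchy_L1_AE_cauchy_subseq[OF sqint_integrable[OF D sqS] Cauchy] by auto
  define f where "f x = lim (\<lambda>i. S (r i) x)" for x
  have [measurable]: "f \<in> borel_measurable (lebesgue_on D)"
    unfolding f_def by measurable
  have conv: "AE x in lebesgue_on D. (\<lambda>i. S (r i) x) \<longlonglongrightarrow> f x"
    using r(2) by eventually_elim (auto simp: f_def Cauchy_convergent_iff convergent_LIMSEQ_iff)
  \<comment> \<open>Fatou along the subsequence; since \<open>r i\<close> is at least
    \<open>i\<close>, the tail bound applies to all but finitely many members.\<close>
  have nn: "(\<integral>\<^sup>+x. ennreal ((f x - S m x)\<^sup>2) \<partial>lebesgue_on D) \<le> ennreal (t m)" for m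
  proof -
    have "(\<integral>\<^sup>+x. ennreal ((f x - S m x)\<^sup>2) \<partial>lebesgue_on D)
        = (\<integral>\<^sup>+x. liminf (\<lambda>i. ennreal ((S (r i) x - S m x)\<^sup>2)) \<partial>lebesgue_on D)"
    proof (rule nn_integral_cong_AE, use conv in eventually_elim)
      case (elim x)
      have "(\<lambda>i. ennreal ((S (r i) x - S m x)\<^sup>2)) \<longlonglongrightarrow> ennreal ((f x - S m x)\<^sup>2)"
        by (intro tendsto_ennrealI tendsto_power tendsto_diff elim tendsto_const)
      from lim_imp_Liminf[OF _ this] show ?case
        by simp
    qed
    also have "\<dots> \<le> liminf (\<lambda>i. \<integral>\<^sup>+x. ennreal ((S (r i) x - S m x)\<^sup>2) \<partial>lebesgue_on D)"
      by (rule nn_integral_liminf) measurable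
    also have "\<dots> \<le> limsup (\<lambda>i. \<integral>\<^sup>+x. ennreal ((S (r i) x - S m x)\<^sup>2) \<partial>lebesgue_on D)"
      by (rule Liminf_le_Limsup) simp
    also have "\<dots> \<le> ennreal (t m)"
    proof (rule Limsup_bounded)
      show "\<forall>\<^sub>F i in sequentially. (\<integral>\<^sup>+x. ennreal ((S (r i) x - S m x)\<^sup>2) \<partial>lebesgue_on D) \<le> ennreal (t m)"
        using eventually_ge_at_top[of m]
      proof eventually_elim
        case (elim i)
        have "m \<le> r i" using elim seq_suble[OF r(1), of i] by simp
        have "(\<integral>\<^sup>+x. ennreal ((S (r i) x - S m x)\<^sup>2) \<partial>lebesgue_on D) = ennreal (normsq D (\<lambda>x. S (r i) x - S m x))"
          unfolding normsq_def l2ip_def power2_eq_square[symmetric]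
          using sqint_diff[OF sqS sqS, of "r i" m] by (intro nn_integral_eq_integral) (auto simp: sqint_def)
        then show ?case
          using S_t[OF \<open>m \<le> r i\<close>] by (simp add: ennreal_leI)
      qed
    qed
    finally show ?thesis .
  qed
  have sqf: "sqint D (\<lambda>x. f x - S m x)" for m
    unfolding sqint_def
  proof (intro conjI integrableI_bounded)
    show "(\<integral>\<^sup>+x. ennreal (norm ((f x - S m x)\<^sup>2)) \<partial>lebesgue_on D) < \<infinity>"
      using nn[of m] by (simp add: order_le_less_trans[OF _ ennreal_less_top])
  qed measurable
  have t_nonneg: "0 \<le> t m" for m
    unfolding t_def using sum_le_suminf[OF c, of "{..<m}"] by simp
  have norm_f: "normsq D (\<lambda>x. f x - S m x) \<le> t m" for m
  proof -
    have "ennreal (normsq D (\<lambda>x. f x - S m x)) = (\<integral>\<^sup>+x. ennreal ((f x - S m x)\<^sup>2) \<partial>lebesgue_on D)"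
      unfolding normsq_def l2ip_def power2_eq_square[symmetric]
      using sqf[of m] by (intro nn_integral_eq_integral[symmetric]) (auto simp: sqint_def)
    also note nn[of m]
    finally show ?thesis
      by (simp add: ennreal_le_iff t_nonneg)
  qed
  have f: "sqint D f"
    using sqint_add[OF sqf[of 0] sqS[of 0]] by simp
  show ?thesis
  proof (intro exI[of _ f] conjI f allI impI)
    fix g assume g: "sqint D g"
    have "(\<lambda>m. l2ip D f g - l2ip D (S m) g) \<longlonglongrightarrow> 0"
    proof (rule Lim_null_comparison)
      show "\<forall>\<^sub>F m in sequentially. norm (l2ip D f g - l2ip D (S m) g) \<le> sqrt (t m * normsq D g)"
      proof (intro always_eventually allI)
        fix m
        have "(l2ip D f g - l2ip D (S m) g)\<^sup>2 \<le> t m * normsq D g"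
          using l2ip_Cauchy_Schwarz[OF sqf[of m] g] mult_right_mono[OF norm_f[of m] normsq_nonneg[of D g]]
          by (simp add: l2ip_diff_left f sqS g)
        then show "norm (l2ip D f g - l2ip D (S m) g) \<le> sqrt (t m * normsq D g)"
          by (simp add: real_le_rsqrt)
      qed
      show "(\<lambda>m. sqrt (t m * normsq D g)) \<longlonglongrightarrow> 0"
        using tendsto_real_sqrt[OF tendsto_mult_right[OF t0, of "normsq D g"]] by simp
    qed
    from tendsto_diff[OF tendsto_const[of "l2ip D f g"] this] have "(\<lambda>m. l2ip D (S m) g) \<longlonglongrightarrow> l2ip D f g"
      by simp
    moreover have "l2ip D (S m) g = (\<Sum>k<m. c k * l2ip D (e k) g)" for m
      unfolding S_def by (intro l2ip_sum_cmult_left ortho_seqD[OF e] g)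
    ultimately show "(\<lambda>k. c k * l2ip D (e k) g) sums l2ip D f g"
      by (simp add: sums_def)
  qed
qed

text \<open>Totality concludes with norm 0 instead of \<open>h = 0\<close>, because values on null
  sets are invisible to pairings.\<close>

definition total_ortho_seq :: "'x::euclidean_space set \<Rightarrow> (nat \<Rightarrow> 'x \<Rightarrow> real) \<Rightarrow> bool" where
  "total_ortho_seq D e \<longleftrightarrow> ortho_seq D e \<and>
     (\<forall>h. sqint D h \<longrightarrow> (\<forall>k. l2ip D (e k) h = 0) \<longrightarrow> normsq D h = 0)"

text \<open>Riesz-Fischer produces a function with the same coefficients as \<open>f\<close>;
  totality gives the difference norm 0, so both have the same pairing with \<open>g\<close>.\<close>

lemma Parseval:
  assumes D: "D \<in> lmeasurable" and e: "total_ortho_seq D e" and f: "sqint D f" and g: "sqint D g"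
  shows "(\<lambda>k. l2ip D (e k) f * l2ip D (e k) g) sums l2ip D f g"
proof -
  have o: "ortho_seq D e" using e by (simp add: total_ortho_seq_def)
  have "summable (\<lambda>k. (l2ip D (e k) f)\<^sup>2)"
    by (rule summableI_nonneg_bounded[of _ "normsq D f"]) (auto intro: Bessel[OF o f])
  from Riesz_Fischer[OF D o this] obtain f' where f': "sqint D f'"
    "\<And>g. sqint D g \<Longrightarrow> (\<lambda>k. l2ip D (e k) f * l2ip D (e k) g) sums l2ip D f' g"
    by auto
  have "l2ip D (e j) f' = l2ip D (e j) f" for j
  proof -
    have "(\<lambda>k. l2ip D (e k) f * l2ip D (e k) (e j)) = (\<lambda>k. if k = j then l2ip D (e j) f else 0)"
      by (auto simp: ortho_seqD[OF o] f)
    with f'(2)[OF ortho_seqD(1)[OF o], of j] have "(\<lambda>k. if k = j then l2ip D (e j) f else 0) sums l2ip D f' (e j)"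
      by simp
    from sums_unique2[OF this sums_single] show ?thesis
      by (simp add: l2ip_commute)
  qed
  then have "l2ip D (e j) (\<lambda>x. f x - f' x) = 0" for j
    using l2ip_diff_left[OF f f'(1) ortho_seqD(1)[OF o], of j] by (simp add: l2ip_commute)
  then have "normsq D (\<lambda>x. f x - f' x) = 0"
    using e sqint_diff[OF f f'(1)] by (simp add: total_ortho_seq_def)
  then have "l2ip D (\<lambda>x. f x - f' x) g = 0"
    using l2ip_eq_0_if_normsq_eq_0[OF g sqint_diff[OF f f'(1)]] by (simp add: l2ip_commute)
  then have "l2ip D f' g = l2ip D f g"
    by (simp add: l2ip_diff_left f f' g)
  with f'(2)[OF g] show ?thesis by simp
qed

text \<open>The indicators of a countable intersection-stable generator of the Borel sets separate
  the points of \<open>L\<^sup>2\<close>, so orthonormalising them gives a total sequence.\<close>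

lemma total_ortho_seq_exists:
  fixes D :: "'x::euclidean_space set"
  assumes D: "D \<in> lmeasurable"
  obtains e where "total_ortho_seq D e"
proof -
  obtain B :: "'x set set" where B: "countable B" "topological_basis B"
    using ex_countable_basis by blast
  \<comment> \<open>Finite intersections of base sets remain countable and become stable under
    intersection, as the Dynkin argument needs. \<open>UNIV\<close> provides the value of
    \<open>\<nu>\<close> on the whole space for the complement step.\<close>
  define C where "C = insert UNIV (Inter ` {F. finite F \<and> F \<subseteq> B})"
  have "countable C"
    unfolding C_def using B(1) by (simp add: countable_Collect_finite_subset)
  then obtain A :: "nat \<Rightarrow> 'x set" where A: "range A = C"
    using range_from_nat_into[of C] unfolding C_def by blast
  have BC: "B \<subseteq> C"
    unfolding C_def by (auto intro!: image_eqI[of _ _ "{b}" for b])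
  have Cb: "C \<subseteq> sets borel"
  proof -
    have "\<Inter> F \<in> sets borel" if "finite F" "F \<subseteq> B" for F
      using that by (induction F) (auto intro!: sets.Int intro: borel_open topological_basis_open[OF B(2)])
    then show ?thesis unfolding C_def by auto
  qed
  have sC: "sets borel = sigma_sets UNIV C"
  proof (rule antisym)
    have "sets borel = sigma_sets UNIV B"
      unfolding borel_eq_countable_basis[OF B] by (rule sets_measure_of) auto
    then show "sets borel \<subseteq> sigma_sets UNIV C"
      using sigma_sets_mono'[OF BC] by simp
    show "sigma_sets UNIV C \<subseteq> sets borel"
      using Cb sets.sigma_sets_subset[of C borel] by simp
  qed
  have iC: "Int_stable C"
  proof (rule Int_stableI)
    fix a b assume "a \<in> C" "b \<in> C"
    then show "a \<inter> b \<in> C"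
      unfolding C_def by (auto simp: Inter_Un_distrib[symmetric] intro!: imageI)
  qed
  have Dm: "D \<in> sets lebesgue" using D by (rule fmeasurableD)
  have AL: "A k \<in> sets lebesgue" for k
    using A Cb by (intro sets_completionI_sets) auto
  define f where "f k = (indicator (A k) :: 'x \<Rightarrow> real)" for k
  have sqf: "sqint D (f k)" for k
  proof -
    have "f k \<in> borel_measurable (lebesgue_on D)"
      unfolding f_def using AL by (intro measurable_restrict_space1) auto
    moreover have "integrable (lebesgue_on D) (f k)"
      using calculation
      by (intro finite_measure.integrable_const_bound[OF finite_measure_lebesgue_on[OF D], of _ 1])
         (auto simp: f_def)
    moreover have "(f k x)\<^sup>2 = f k x" for x
      by (simp add: f_def indicator_def)
    ultimately show ?thesis by (simp add: sqint_def)
  qed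
  have "total_ortho_seq D (gram_schmidt D f)"
    unfolding total_ortho_seq_def
  proof (intro conjI allI impI)
    show "ortho_seq D (gram_schmidt D f)"
      by (rule gram_schmidt_ortho_seq(1)[OF sqf])
    fix h assume h: "sqint D h" "\<forall>k. l2ip D (gram_schmidt D f k) h = 0"
    have hi: "integrable (lebesgue_on D) h" by (rule sqint_integrable[OF D h(1)])
    then have hD: "integrable lebesgue (\<lambda>x. indicator D x * h x)"
      using Dm by (simp add: integrable_restrict_space)
    \<comment> \<open>\<open>h\<close> is only Lebesgue measurable, whereas the generator controls
      Borel sets; so the argument passes to a Borel version of the extension of \<open>h\<close> by
      zero.\<close>
    then obtain g where [measurable]: "g \<in> borel_measurable lborel" and g: "AE x in lborel. indicator D x * h x = g x"
      using completion_ex_borel_measurable_real[of "\<lambda>x. indicator D x * h x" lborel] by blast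
    have g': "AE x in lebesgue. indicator D x * h x = g x"
      by (rule AE_completion[OF g])
    have gm: "g \<in> borel_measurable lebesgue"
      by (rule measurable_completion) simp
    have "integrable lebesgue g"
      using hD integrable_cong_AE[OF borel_measurable_integrable[OF hD] gm g'] by simp
    then have gi: "integrable lborel g"
      by (simp add: integrable_completion)
    define \<nu> where "\<nu> X = (LINT x:X|lborel. g x)" for X
    have g_set: "set_integrable lborel X g" if "X \<in> sigma_sets UNIV C" for X
      unfolding set_integrable_def using that sC by (intro integrable_mult_indicator gi) simp
    have "\<nu> (A k) = 0" for k
    proof -
      have [measurable]: "A k \<in> sets borel" using A Cb by blast
      have "\<nu> (A k) = (\<integral>x. indicator (A k) x * g x \<partial>lebesgue)"
        unfolding \<nu>_def set_lebesgue_integral_def by (subst integral_completion) auto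
      also have "\<dots> = (\<integral>x. indicator D x * (f k x * h x) \<partial>lebesgue)"
      proof (rule integral_cong_AE)
        show "AE x in lebesgue. indicator (A k) x * g x = indicator D x * (f k x * h x)"
          using g' by eventually_elim (auto simp: f_def indicator_def)
        show "(\<lambda>x. indicator (A k) x * g x) \<in> borel_measurable lebesgue"
          using gm AL by auto
        have "(\<lambda>x. indicator (A k) x * (indicator D x * h x)) \<in> borel_measurable lebesgue"
          by (intro borel_measurable_times borel_measurable_integrable[OF hD] borel_measurable_indicator AL)
        then show "(\<lambda>x. indicator D x * (f k x * h x)) \<in> borel_measurable lebesgue"
          by (simp add: f_def mult.left_commute)
      qed
      also have "\<dots> = l2ip D (f k) h"
        unfolding l2ip_def using Dm by (subst integral_restrict_space) auto
      also have "\<dots> = 0"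
        by (rule gram_schmidt_ortho_seq(2)[OF sqf h(1)]) (use h(2) in auto)
      finally show ?thesis .
    qed
    then have C0: "\<nu> X = 0" if "X \<in> C" for X
      using that A by auto
    have all0: "\<nu> X = 0" if "X \<in> sigma_sets UNIV C" for X
    proof -
      have "C \<subseteq> Pow UNIV" by simp
      from iC this that show ?thesis
      proof (induction rule: sigma_sets_induct_disjoint)
        case (basic X)
        then show ?case by (rule C0)
      next
        case empty
        then show ?case by (simp add: \<nu>_def set_lebesgue_integral_def)
      next
        case (compl X)
        have "\<nu> (UNIV - X) = \<nu> UNIV - \<nu> X"
          unfolding \<nu>_def set_lebesgue_integral_def
          using Bochner_Integration.integral_diff[OF gi g_set[OF compl(1), unfolded set_integrable_def]]
          by (simp add: indicator_diff left_diff_distrib)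
        then show ?case using compl C0[of UNIV] by (simp add: C_def)
      next
        case (union X)
        have "\<nu> (\<Union>i. X i) = (\<Sum>i. \<nu> (X i))"
          unfolding \<nu>_def
        proof (rule lebesgue_integral_countable_add)
          show "X i \<in> sets lborel" for i
            using union(2) sC by auto
          show "X i \<inter> X j = {}" if "i \<noteq> j" for i j
            using union(1) that by (auto simp: disjoint_family_on_def)
          show "set_integrable lborel (\<Union>i. X i) g"
            by (intro g_set sigma_sets.Union) (use union(2) in auto)
        qed
        then show ?case using union by simp
      qed
    qed
    \<comment> \<open>The signed measure with density \<open>g\<close> vanishes on all Borel sets,
      and densities are unique almost everywhere.\<close>
    have "AE x in lborel. g x = 0"
      by (rule density_unique_real[OF gi]) (auto simp: all0[unfolded \<nu>_def] sC)
    with g have "AE x in lborel. indicator D x * h x = 0"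
      by eventually_elim simp
    then have "AE x in lebesgue. indicator D x * h x = 0"
      by (rule AE_completion)
    then have "AE x in lebesgue. x \<in> D \<longrightarrow> h x = 0"
      by eventually_elim (auto simp: indicator_def split: if_splits)
    then have "AE x in lebesgue_on D. h x = 0"
      using Dm by (subst AE_restrict_space_iff) auto
    then have "AE x in lebesgue_on D. h x * h x = 0"
      by eventually_elim simp
    then show "normsq D h = 0"
      unfolding normsq_def l2ip_def by (subst integral_cong_AE[of _ _ "\<lambda>x. 0"]) (use h(1) in \<open>auto simp: sqint_def\<close>)
  qed
  then show thesis by (rule that)
qed

section \<open>Finite element spaces\<close>

text \<open>Induction on a finite set of points at which the values determine a member of
  \<open>S\<close>. The induction hypothesis is applied to the subspace vanishing at one point,
  which has codimension at most one, and at most one further vector is adjoined. This is why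
  \<open>S\<close> is an arbitrary space of functions.\<close>

lemma finite_orthonormal_basis:
  fixes S :: "('x::euclidean_space \<Rightarrow> real) set"
  assumes "finite P"
    and "\<And>v. v \<in> S \<Longrightarrow> sqint D v"
    and "\<And>v w. v \<in> S \<Longrightarrow> w \<in> S \<Longrightarrow> (\<lambda>x. v x + w x) \<in> S"
    and "\<And>v c. v \<in> S \<Longrightarrow> (\<lambda>x. c * v x) \<in> S"
    and "(\<lambda>x. 0) \<in> S"
    and "\<And>v. v \<in> S \<Longrightarrow> normsq D v = 0 \<Longrightarrow> v = (\<lambda>x. 0)"
    and "\<And>v. v \<in> S \<Longrightarrow> \<forall>p\<in>P. v p = 0 \<Longrightarrow> v = (\<lambda>x. 0)"
  shows "\<exists>B. finite B \<and> B \<subseteq> S \<and> (\<forall>b\<in>B. \<forall>c\<in>B. l2ip D b c = (if b = c then 1 else 0)) \<and>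
    (\<forall>v\<in>S. v = (\<lambda>x. \<Sum>b\<in>B. l2ip D b v * b x))"
  using assms
proof (induction P arbitrary: S rule: finite_induct)
  case empty
  then show ?case
    by (intro exI[of _ "{}"]) auto
next
  case (insert p P)
  note sq = insert.prems(1) and add = insert.prems(2) and cm = insert.prems(3) and z = insert.prems(4)
  have diff: "(\<lambda>x. v x - w x) \<in> S" if "v \<in> S" "w \<in> S" for v w
    using add[OF that(1) cm[OF that(2), of "-1"]] by simp
  have "\<exists>B. finite B \<and> B \<subseteq> {v\<in>S. v p = 0} \<and> (\<forall>b\<in>B. \<forall>c\<in>B. l2ip D b c = (if b = c then 1 else 0)) \<and>
    (\<forall>v\<in>{v\<in>S. v p = 0}. v = (\<lambda>x. \<Sum>b\<in>B. l2ip D b v * b x))"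
  proof (rule insert.IH)
    fix v assume v: "v \<in> {v \<in> S. v p = 0}"
    show "normsq D v = 0 \<Longrightarrow> v = (\<lambda>x. 0)"
      using insert.prems(5) v by blast
    show "\<forall>p\<in>P. v p = 0 \<Longrightarrow> v = (\<lambda>x. 0)"
      using insert.prems(6) v by blast
  qed (use sq add cm z in auto)
  then obtain B where B': "finite B" "B \<subseteq> {v\<in>S. v p = 0}"
      "\<forall>b\<in>B. \<forall>c\<in>B. l2ip D b c = (if b = c then 1 else 0)"
      "\<forall>v\<in>{v\<in>S. v p = 0}. v = (\<lambda>x. \<Sum>b\<in>B. l2ip D b v * b x)"
    by (elim exE conjE) (rule that; assumption)
  have B: "finite B" "B \<subseteq> S" "\<And>b. b \<in> B \<Longrightarrow> b p = 0"
      "\<And>b c. b \<in> B \<Longrightarrow> c \<in> B \<Longrightarrow> l2ip D b c = (if b = c then 1 else 0)"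
    using B'(1-3) by auto
  have Brep: "v = (\<lambda>x. \<Sum>b\<in>B. l2ip D b v * b x)" if "v \<in> S" "v p = 0" for v
    using bspec[OF B'(4), of v] that by simp
  show ?case
  proof (cases "\<forall>v\<in>S. v p = 0")
    case True
    show ?thesis
    proof (intro exI[of _ B] conjI ballI)
      show "v = (\<lambda>x. \<Sum>b\<in>B. l2ip D b v * b x)" if "v \<in> S" for v
        using Brep[OF that] True that by simp
    qed (use B in auto)
  next
    case False
    then obtain w where w: "w \<in> S" "w p \<noteq> 0" by auto
    have sum_S: "(\<lambda>x. \<Sum>b\<in>B'. c b * b x) \<in> S" if "B' \<subseteq> B" for B' c
      using finite_subset[OF that B(1)] that
      by (induction B' rule: finite_induct) (use z in auto, use add cm B(2) in blast)
    \<comment> \<open>The members of \<open>B\<close> vanish at \<open>p\<close>, so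
      orthogonalisation does not change the nonzero value of \<open>w\<close> at \<open>p\<close>;
      in particular the remainder has positive norm.\<close>
    define w' where "w' = (\<lambda>x. w x - (\<Sum>b\<in>B. l2ip D b w * b x))"
    have w'S: "w' \<in> S"
      unfolding w'_def by (intro diff w sum_S) auto
    have w'p: "w' p \<noteq> 0"
      unfolding w'_def using w(2) by (simp add: B(3))
    have pos: "normsq D w' > 0"
      using insert.prems(5)[OF w'S] w'p normsq_nonneg[of D w'] by fastforce
    have w'b: "l2ip D w' b = 0" if b: "b \<in> B" for b
    proof -
      have "l2ip D w' b = l2ip D w b - (\<Sum>c\<in>B. l2ip D c w * l2ip D c b)"
        unfolding w'_def using sq w(1) B(2) b
        by (subst l2ip_diff_left) (auto simp: l2ip_sum_cmult_left subset_iff intro!: sqint_sum sqint_cmult)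
      also have "(\<Sum>c\<in>B. l2ip D c w * l2ip D c b) = (\<Sum>c\<in>B. if c = b then l2ip D b w else 0)"
        by (intro sum.cong) (auto simp: B(4) b)
      finally show ?thesis
        using B(1) b by (simp add: l2ip_commute)
    qed
    define u where "u = (\<lambda>x. 1 / sqrt (normsq D w') * w' x)"
    have uS: "u \<in> S" unfolding u_def by (rule cm[OF w'S])
    have up: "u p \<noteq> 0" unfolding u_def using w'p pos by simp
    have uu: "l2ip D u u = 1"
      using normsq_cmult[of D "1 / sqrt (normsq D w')" w'] pos by (simp add: u_def normsq_def power_divide)
    have ub: "l2ip D u b = 0" if "b \<in> B" for b
      unfolding u_def l2ip_cmult_left by (simp add: w'b[OF that])
    have uB: "u \<notin> B" using B(3) up by auto
    have rep: "v = (\<lambda>x. \<Sum>b\<in>insert u B. l2ip D b v * b x)" if v: "v \<in> S" for v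
    proof -
      \<comment> \<open>Chosen so that \<open>v - c u\<close> vanishes at \<open>p\<close> and is
        expanded by the induction hypothesis; orthonormality then identifies \<open>c\<close> with
        the coefficient of \<open>u\<close>.\<close>
      define c where "c = v p / u p"
      define v0 where "v0 = (\<lambda>x. v x - c * u x)"
      have v0S: "v0 \<in> S" unfolding v0_def by (intro diff v cm uS)
      have "v0 p = 0" unfolding v0_def c_def using up by simp
      then have v0: "v0 = (\<lambda>x. \<Sum>b\<in>B. l2ip D b v0 * b x)" by (rule Brep[OF v0S])
      have bv0: "l2ip D b v0 = l2ip D b v" if "b \<in> B" for b
      proof -
        have "l2ip D v0 b = l2ip D v b - c * l2ip D u b"
          unfolding v0_def using sq v uS B(2) that
          by (subst l2ip_diff_left) (auto simp: l2ip_cmult_left intro!: sqint_cmult)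
        then show ?thesis using ub[OF that] by (simp add: l2ip_commute)
      qed
      have "l2ip D v0 u = (\<Sum>b\<in>B. l2ip D b v0 * l2ip D b u)"
        by (subst v0) (use sq uS B(2) in \<open>auto intro!: l2ip_sum_cmult_left\<close>)
      also have "\<dots> = 0"
        using ub by (intro sum.neutral) (auto simp: l2ip_commute)
      finally have "l2ip D v u - c * l2ip D u u = 0"
        unfolding v0_def using sq v uS
        by (subst (asm) l2ip_diff_left) (auto simp: l2ip_cmult_left intro!: sqint_cmult)
      then have uv: "l2ip D u v = c" using uu by (simp add: l2ip_commute)
      have "v x = (\<Sum>b\<in>insert u B. l2ip D b v * b x)" for x
      proof -
        have "v x = c * u x + v0 x" by (simp add: v0_def)
        also have "v0 x = (\<Sum>b\<in>B. l2ip D b v * b x)"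
          by (subst v0) (simp add: bv0)
        finally show ?thesis using uB B(1) by (simp add: uv)
      qed
      then show ?thesis by auto
    qed
    have on: "l2ip D b c = (if b = c then 1 else 0)" if "b \<in> insert u B" "c \<in> insert u B" for b c
      using that uu ub uB B(4) l2ip_commute[of D b u] by (auto; metis)
    show ?thesis
    proof (intro exI[of _ "insert u B"] conjI ballI)
      show "finite (insert u B)" "insert u B \<subseteq> S" using B uS by auto
          show "v = (\<lambda>x. \<Sum>b\<in>insert u B. l2ip D b v * b x)" if "v \<in> S" for v
        by (rule rep[OF that])
    qed (use on in auto)
  qed
qed

locale fem =
  fixes D :: "'x::euclidean_space set" and Th :: "'x set set"
  assumes D_open: "open D" and D_bdd: "bounded D"
    and Th: "regular_triangulation Th" and Th_D: "\<Union>Th \<subseteq> closure D"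
begin

lemma D_lmeasurable: "D \<in> lmeasurable"
  using D_open D_bdd by (rule lmeasurable_open[rotated])

lemma finite_Th: "finite Th"
  using Th by (simp add: regular_triangulation_def)

lemma Th_simplex: "K \<in> Th \<Longrightarrow> \<exists>S. finite S \<and> K = convex hull S"
  using Th by (auto simp: regular_triangulation_def dsimplex_def)

lemma Th_convex_compact: "K \<in> Th \<Longrightarrow> convex K" "K \<in> Th \<Longrightarrow> compact K"
  using Th_simplex[of K] finite_imp_compact_convex_hull by auto

lemma Vh_zero: "(\<lambda>x. 0) \<in> Vh Th"
  unfolding Vh_def by (auto intro!: exI[of _ 0])

lemma Vh_affine: "v \<in> Vh Th \<Longrightarrow> K \<in> Th \<Longrightarrow> \<exists>a b. \<forall>x\<in>K. v x = inner a x + b"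
  by (simp add: Vh_def)

lemma Vh_outside: "v \<in> Vh Th \<Longrightarrow> x \<notin> \<Union>Th \<Longrightarrow> v x = 0"
  by (simp add: Vh_def)

lemma Vh_add:
  assumes "v \<in> Vh Th" "w \<in> Vh Th"
  shows "(\<lambda>x. v x + w x) \<in> Vh Th"
proof -
  have "\<exists>a b. \<forall>x\<in>K. v x + w x = inner a x + b" if K: "K \<in> Th" for K
  proof -
    obtain a b a' b' where "\<forall>x\<in>K. v x = inner a x + b" "\<forall>x\<in>K. w x = inner a' x + b'"
      using Vh_affine[OF assms(1) K] Vh_affine[OF assms(2) K] by auto
    then show ?thesis
      by (intro exI[of _ "a + a'"] exI[of _ "b + b'"]) (auto simp: inner_add_left)
  qed
  then show ?thesis
    using assms by (auto simp: Vh_def intro!: continuous_intros)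
qed

lemma Vh_cmult:
  assumes "v \<in> Vh Th"
  shows "(\<lambda>x. c * v x) \<in> Vh Th"
proof -
  have "\<exists>a b. \<forall>x\<in>K. c * v x = inner a x + b" if K: "K \<in> Th" for K
  proof -
    obtain a b where "\<forall>x\<in>K. v x = inner a x + b"
      using Vh_affine[OF assms K] by auto
    then show ?thesis
      by (intro exI[of _ "c *\<^sub>R a"] exI[of _ "c * b"]) (auto simp: algebra_simps)
  qed
  then show ?thesis
    using assms by (auto simp: Vh_def intro!: continuous_intros)
qed

lemma Vh_diff: "v \<in> Vh Th \<Longrightarrow> w \<in> Vh Th \<Longrightarrow> (\<lambda>x. v x - w x) \<in> Vh Th"
  using Vh_add[of v "\<lambda>x. -1 * w x"] Vh_cmult[of w "-1"] by simp

lemma Vh_sum: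
  assumes "\<And>i. i \<in> I \<Longrightarrow> f i \<in> Vh Th"
  shows "(\<lambda>x. \<Sum>i\<in>I. f i x) \<in> Vh Th"
  using assms by (induction I rule: infinite_finite_induct) (auto intro: Vh_add Vh_zero)

lemma Vh_continuous: "v \<in> Vh Th \<Longrightarrow> continuous_on A v"
  by (auto simp: Vh_def intro: continuous_on_subset)

lemma Vh_sqint:
  assumes v: "v \<in> Vh Th"
  shows "sqint D v"
proof -
  have "v \<in> borel_measurable lebesgue"
    using borel_measurable_continuous_onI[OF Vh_continuous[OF v]] by (intro measurable_completion) simp
  then have m: "v \<in> borel_measurable (lebesgue_on D)"
    by (rule measurable_restrict_space1)
  have "compact (v ` closure D)"
    using D_bdd by (intro compact_continuous_image Vh_continuous[OF v]) simp
  then obtain C where C: "\<forall>y\<in>v ` closure D. norm y \<le> C"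
    using compact_imp_bounded bounded_iff by metis
  have "integrable (lebesgue_on D) (\<lambda>x. (v x)\<^sup>2)"
  proof (rule finite_measure.integrable_const_bound[OF finite_measure_lebesgue_on[OF D_lmeasurable]])
    show "AE x in lebesgue_on D. norm ((v x)\<^sup>2) \<le> C\<^sup>2"
      using C closure_subset[of D] by (intro AE_I2) (auto intro!: abs_le_square_iff[THEN iffD1] simp: space_restrict_space, fastforce)
  qed (use m in measurable)
  with m show ?thesis by (simp add: sqint_def)
qed

text \<open>The set where a continuous function is nonzero is open within \<open>D\<close>, and a
  nonempty open set is not negligible. So \<open>v\<close> vanishes on \<open>D\<close>, by
  continuity on its closure, and elsewhere because the triangulated region lies in that closure. On
  \<open>Vh Th\<close> the seminorm is thus a norm.\<close>

lemma Vh_eq_0_if_normsq_eq_0: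
  assumes v: "v \<in> Vh Th" and n: "normsq D v = 0"
  shows "v = (\<lambda>x. 0)"
proof -
  have "AE x in lebesgue_on D. v x * v x = 0"
    using n Vh_sqint[OF v] unfolding normsq_def l2ip_def
    by (subst (asm) integral_nonneg_eq_0_iff_AE) (auto simp: sqint_integrable_mult)
  then have "AE x in lebesgue_on D. v x = 0" by simp
  then have "AE x in lebesgue. x \<in> D \<longrightarrow> v x = 0"
    using fmeasurableD[OF D_lmeasurable] by (subst (asm) AE_restrict_space_iff) auto
  moreover have o: "open {x \<in> D. v x \<noteq> 0}"
    using D_open continuous_open_preimage[OF Vh_continuous[OF v] D_open, of "-{0}"]
    by (simp add: vimage_def Int_def open_Compl)
  then have "{x \<in> space lebesgue. \<not> (x \<in> D \<longrightarrow> v x = 0)} \<in> sets lebesgue"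
    by (simp add: borel_open)
  ultimately have "negligible {x \<in> D. v x \<noteq> 0}"
    by (subst (asm) AE_iff_null) (auto simp: negligible_iff_null_sets)
  with o have "{x \<in> D. v x \<noteq> 0} = {}"
    using open_not_negligible by blast
  then have D0: "\<And>x. x \<in> D \<Longrightarrow> v x = 0" by auto
  have "v x = 0" if "x \<in> closure D" for x
    using continuous_constant_on_closure[OF Vh_continuous[OF v] D0 that] by simp
  then show ?thesis
    using Vh_outside[OF v] Th_D by (intro ext) blast
qed

text \<open>The spanning points of the simplices determine a finite element function: an affine
  function vanishing at them vanishes on their convex hull.\<close>

lemma Vh_basis_exists:
  "\<exists>B. finite B \<and> B \<subseteq> Vh Th \<and> (\<forall>b\<in>B. \<forall>c\<in>B. l2ip D b c = (if b = c then 1 else 0)) \<and>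
    (\<forall>v\<in>Vh Th. v = (\<lambda>x. \<Sum>b\<in>B. l2ip D b v * b x))"
proof -
  obtain S where S: "\<And>K. K \<in> Th \<Longrightarrow> finite (S K) \<and> K = convex hull (S K)"
    using Th_simplex by metis
  show ?thesis
  proof (rule finite_orthonormal_basis[of "\<Union>K\<in>Th. S K"])
    show "finite (\<Union>K\<in>Th. S K)" using S finite_Th by auto
    fix v assume v: "v \<in> Vh Th" and 0: "\<forall>p\<in>\<Union>K\<in>Th. S K. v p = 0"
    have "v x = 0" if K: "K \<in> Th" "x \<in> K" for x K
    proof -
      obtain a b where ab: "\<forall>x\<in>K. v x = inner a x + b"
        using Vh_affine[OF v K(1)] by auto
      have SK: "S K \<subseteq> K" using S[OF K(1)] hull_subset by metis
      have "convex hull (S K) \<subseteq> {x. inner a x = - b}"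
      proof (rule hull_minimal)
        show "S K \<subseteq> {x. inner a x = - b}"
          using 0 K(1) ab SK by fastforce
      qed (rule convex_hyperplane)
      then have "K \<subseteq> {x. inner a x = - b}" using S[OF K(1)] by simp
      then show ?thesis using ab K(2) by auto
    qed
    then show "v = (\<lambda>x. 0)"
      using Vh_outside[OF v] by blast
  qed (use Vh_sqint Vh_add Vh_cmult Vh_zero Vh_eq_0_if_normsq_eq_0 in auto)
qed

text \<open>Fixing one orthonormal basis turns statements about random elements of
  \<open>Vh Th\<close> into statements about finitely many real random variables.\<close>

definition Bh :: "('x \<Rightarrow> real) set" where
  "Bh = (SOME B. finite B \<and> B \<subseteq> Vh Th \<and> (\<forall>b\<in>B. \<forall>c\<in>B. l2ip D b c = (if b = c then 1 else 0)) \<and>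
    (\<forall>v\<in>Vh Th. v = (\<lambda>x. \<Sum>b\<in>B. l2ip D b v * b x)))"

lemma Bh: "finite Bh" "b \<in> Bh \<Longrightarrow> b \<in> Vh Th" "b \<in> Bh \<Longrightarrow> sqint D b"
    "b \<in> Bh \<Longrightarrow> c \<in> Bh \<Longrightarrow> l2ip D b c = (if b = c then 1 else 0)"
    "v \<in> Vh Th \<Longrightarrow> v = (\<lambda>x. \<Sum>b\<in>Bh. l2ip D b v * b x)"
  using someI_ex[OF Vh_basis_exists] Vh_sqint unfolding Bh_def[symmetric] by blast+

lemma sum_Bh_in_Vh: "(\<lambda>x. \<Sum>b\<in>Bh. c b * b x) \<in> Vh Th"
  by (intro Vh_sum Vh_cmult Bh)

lemma l2ip_sum_Bh:
  assumes "\<phi> \<in> Vh Th"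
  shows "l2ip D (\<lambda>x. \<Sum>b\<in>Bh. c b * b x) \<phi> = (\<Sum>b\<in>Bh. c b * l2ip D b \<phi>)"
  by (intro l2ip_sum_cmult_left Bh Vh_sqint assms)

lemma Vh_eqI:
  assumes v: "v \<in> Vh Th" and w: "w \<in> Vh Th" and eq: "\<And>\<phi>. \<phi> \<in> Vh Th \<Longrightarrow> l2ip D v \<phi> = l2ip D w \<phi>"
  shows "v = w"
proof -
  have "(\<lambda>x. \<Sum>b\<in>Bh. l2ip D b v * b x) = (\<lambda>x. \<Sum>b\<in>Bh. l2ip D b w * b x)"
    using eq[OF Bh(2)] by (intro ext sum.cong refl) (simp add: l2ip_commute[of D _ v] l2ip_commute[of D _ w])
  with Bh(5)[OF v] Bh(5)[OF w] show ?thesis by metis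
qed

text \<open>Riesz representation in finite dimension, with coefficients \<open>F b\<close> in the
  orthonormal basis. Unique existence is what the definite descriptions in \<open>Pih\<close> and
  \<open>Laph\<close> require.\<close>

lemma Vh_representation:
  assumes add: "\<And>v w. v \<in> Vh Th \<Longrightarrow> w \<in> Vh Th \<Longrightarrow> F (\<lambda>x. v x + w x) = F v + F w"
    and cm: "\<And>c v. v \<in> Vh Th \<Longrightarrow> F (\<lambda>x. c * v x) = c * (F v :: real)"
  shows "\<exists>!v. v \<in> Vh Th \<and> (\<forall>\<phi>\<in>Vh Th. l2ip D v \<phi> = F \<phi>)"
proof (rule ex_ex1I)
  have F0: "F (\<lambda>x. 0) = 0" using cm[OF Vh_zero, of 0] by simp
  have Fsum: "F (\<lambda>x. \<Sum>b\<in>B. c b * b x) = (\<Sum>b\<in>B. c b * F b)" if "B \<subseteq> Bh" for B c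
    using finite_subset[OF that Bh(1)] that
  proof (induction B rule: finite_induct)
    case (insert b B)
    have "F (\<lambda>x. c b * b x + (\<Sum>b\<in>B. c b * b x)) = F (\<lambda>x. c b * b x) + F (\<lambda>x. \<Sum>b\<in>B. c b * b x)"
      using insert.prems by (intro add Vh_sum Vh_cmult Bh) auto
    then show ?case using insert Bh(2) by (simp add: cm)
  qed (simp add: F0)
  show "\<exists>v. v \<in> Vh Th \<and> (\<forall>\<phi>\<in>Vh Th. l2ip D v \<phi> = F \<phi>)"
  proof (intro exI conjI ballI)
    show "(\<lambda>x. \<Sum>b\<in>Bh. F b * b x) \<in> Vh Th" by (rule sum_Bh_in_Vh)
    fix \<phi> assume \<phi>: "\<phi> \<in> Vh Th"
    have "F \<phi> = (\<Sum>b\<in>Bh. l2ip D b \<phi> * F b)"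
      by (subst Bh(5)[OF \<phi>]) (rule Fsum[OF order_refl])
    then show "l2ip D (\<lambda>x. \<Sum>b\<in>Bh. F b * b x) \<phi> = F \<phi>"
      unfolding l2ip_sum_Bh[OF \<phi>] by (simp add: mult.commute)
  qed
qed (auto intro: Vh_eqI)

lemma Pih:
  assumes "sqint D f"
  shows "Pih D Th f \<in> Vh Th" "\<phi> \<in> Vh Th \<Longrightarrow> l2ip D (Pih D Th f) \<phi> = l2ip D f \<phi>"
proof -
  have "\<exists>!v. v \<in> Vh Th \<and> (\<forall>\<phi>\<in>Vh Th. l2ip D v \<phi> = l2ip D f \<phi>)"
    by (rule Vh_representation) (simp_all add: l2ip_commute[of D f] l2ip_add_left Vh_sqint assms l2ip_cmult_left)
  then have "\<exists>!v. v \<in> Vh Th \<and> (\<forall>\<phi>\<in>Vh Th. l2ip D (\<lambda>x. f x - v x) \<phi> = 0)"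
    by (simp add: l2ip_diff_left Vh_sqint assms eq_commute[of "l2ip D f _"] cong: conj_cong)
  from theI'[OF this] have "Pih D Th f \<in> Vh Th \<and> (\<forall>\<phi>\<in>Vh Th. l2ip D (\<lambda>x. f x - Pih D Th f x) \<phi> = 0)"
    unfolding Pih_def .
  then show "Pih D Th f \<in> Vh Th" "\<phi> \<in> Vh Th \<Longrightarrow> l2ip D (Pih D Th f) \<phi> = l2ip D f \<phi>"
    by (auto simp: l2ip_diff_left Vh_sqint assms)
qed

section \<open>Gradients, the Dirichlet form and the discrete Laplacian\<close>

text \<open>On the boundaries of the simplices a finite element function may fail to be
  differentiable and \<open>grad\<close> is an arbitrary choice. Off this null set each point is
  interior to a simplex or lies in the open complement of the triangulated region, so gradients
  exist there and depend linearly on the function.\<close>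

definition skeleton :: "'x set" where
  "skeleton = (\<Union>K\<in>Th. frontier K)"

lemma negligible_skeleton: "negligible skeleton"
  unfolding skeleton_def using finite_Th Th_convex_compact(1)
  by (intro negligible_Union) (auto intro: negligible_convex_frontier)

lemma off_skeleton: "x \<notin> skeleton \<Longrightarrow> (\<exists>K\<in>Th. x \<in> interior K) \<or> x \<notin> \<Union>Th"
  unfolding skeleton_def frontier_def using closure_subset by blast

lemma grad_eq: "GDERIV f x :> g \<Longrightarrow> grad f x = g"
  unfolding grad_def gderiv_def
proof (rule some_equality)
  fix g' assume "(f has_derivative (\<lambda>h. inner h g')) (at x)" "(f has_derivative (\<lambda>h. inner h g)) (at x)"
  then have "(\<lambda>h. inner h g') = (\<lambda>h. inner h g)"
    by (rule has_derivative_unique)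
  then show "g' = g"
    by (metis vector_eq_ldot)
qed

lemma Vh_GDERIV:
  assumes v: "v \<in> Vh Th" and K: "K \<in> Th"
  shows "\<exists>a. \<forall>x\<in>interior K. GDERIV v x :> a"
proof -
  obtain a b where ab: "\<forall>x\<in>K. v x = inner a x + b"
    using Vh_affine[OF v K] by auto
  have "GDERIV v x :> a" if x: "x \<in> interior K" for x
    unfolding gderiv_def
  proof (rule has_derivative_transform_within_open[OF _ open_interior x])
    show "((\<lambda>x. inner a x + b) has_derivative (\<lambda>h. inner h a)) (at x)"
      by (auto intro!: derivative_eq_intros simp: inner_commute)
    show "inner a y + b = v y" if "y \<in> interior K" for y
      using ab that interior_subset by fastforce
  qed
  then show ?thesis by blast
qed

lemma Vh_GDERIV_outside:
  assumes v: "v \<in> Vh Th" and x: "x \<notin> \<Union>Th"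
  shows "GDERIV v x :> 0"
  unfolding gderiv_def
proof (rule has_derivative_transform_within_open[of "\<lambda>x. 0"])
  have "closed (\<Union>Th)"
    using finite_Th Th_convex_compact(2) by (intro closed_Union) (auto intro: compact_imp_closed)
  then show "open (- \<Union>Th)" by (rule open_Compl)
qed (use Vh_outside[OF v] x in auto)

lemma Vh_GDERIV_grad:
  assumes v: "v \<in> Vh Th" and x: "x \<notin> skeleton"
  shows "GDERIV v x :> grad v x"
  using off_skeleton[OF x] Vh_GDERIV[OF v] Vh_GDERIV_outside[OF v] grad_eq by metis

lemma AE_off_skeleton: "AE x in lebesgue_on D. x \<notin> skeleton"
proof -
  have "AE x in lebesgue. x \<notin> skeleton"
    using negligible_skeleton by (intro AE_not_in) (simp add: negligible_iff_null_sets)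
  then show ?thesis
    using fmeasurableD[OF D_lmeasurable] by (subst AE_restrict_space_iff) auto
qed

text \<open>Almost everywhere the integrand is constant on each of finitely many bounded interiors
  and zero elsewhere.\<close>

lemma grad_inner_integrable:
  assumes v: "v \<in> Vh Th" and w: "w \<in> Vh Th"
  shows "integrable (lebesgue_on D) (\<lambda>x. inner (grad v x) (grad w x))"
proof -
  let ?h = "\<lambda>x. inner (grad v x) (grad w x)"
  have K: "set_integrable lebesgue (interior K) ?h" if K: "K \<in> Th" for K
  proof -
    obtain a a' where a: "\<forall>x\<in>interior K. GDERIV v x :> a" "\<forall>x\<in>interior K. GDERIV w x :> a'"
      using Vh_GDERIV[OF v K] Vh_GDERIV[OF w K] by blast
    have "interior K \<in> lmeasurable"
      using compact_imp_bounded[OF Th_convex_compact(2)[OF K]] by (intro lmeasurable_interior)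
    then have "integrable lebesgue (\<lambda>x. indicator (interior K) x * inner a a')"
      by (intro integrable_mult_left integrable_real_indicator) (auto simp: fmeasurable_def)
    moreover have "(\<lambda>x. indicator (interior K) x * inner a a') = (\<lambda>x. indicator (interior K) x *\<^sub>R ?h x)"
      using a by (auto simp: indicator_def fun_eq_iff grad_eq[of v _ a] grad_eq[of w _ a'])
    ultimately show ?thesis by (simp add: set_integrable_def)
  qed
  have I: "integrable lebesgue (\<lambda>x. indicator (\<Union>K\<in>Th. interior K) x *\<^sub>R ?h x)"
    unfolding set_integrable_def[symmetric] using finite_Th K by (intro set_integrable_UN) auto
  have A: "AE x in lebesgue. indicator (\<Union>K\<in>Th. interior K) x *\<^sub>R ?h x = ?h x"
  proof -
    have "AE x in lebesgue. x \<notin> skeleton"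
      using negligible_skeleton by (intro AE_not_in) (simp add: negligible_iff_null_sets)
    then show ?thesis
    proof eventually_elim
      case (elim x)
      show ?case
        using off_skeleton[OF elim] grad_eq[OF Vh_GDERIV_outside[OF v]]
        by (auto simp: indicator_def)
    qed
  qed
  \<comment> \<open>Completeness of Lebesgue measure: the arbitrary values on the skeleton cannot
    destroy measurability.\<close>
  have m: "?h \<in> borel_measurable lebesgue"
    by (rule borel_measurable_AE[OF borel_measurable_integrable[OF I] A])
  have "integrable lebesgue ?h"
    using integrable_cong_AE[OF borel_measurable_integrable[OF I] m A] I by simp
  from integrable_mult_indicator[OF fmeasurableD[OF D_lmeasurable] this] show ?thesis
    using fmeasurableD[OF D_lmeasurable] by (subst integrable_restrict_space) auto
qed

lemma dform_commute: "dform D v w = dform D w v"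
  by (simp add: dform_def inner_commute)

lemma dform_add_right:
  assumes u: "u \<in> Vh Th" and v: "v \<in> Vh Th" and w: "w \<in> Vh Th"
  shows "dform D u (\<lambda>x. v x + w x) = dform D u v + dform D u w"
proof -
  have "dform D u (\<lambda>x. v x + w x)
      = (\<integral>x. inner (grad u x) (grad v x) + inner (grad u x) (grad w x) \<partial>lebesgue_on D)"
    unfolding dform_def
  proof (rule integral_cong_AE)
    show "AE x in lebesgue_on D. inner (grad u x) (grad (\<lambda>x. v x + w x) x)
        = inner (grad u x) (grad v x) + inner (grad u x) (grad w x)"
      using AE_off_skeleton
    proof eventually_elim
      case (elim x)
      have "grad (\<lambda>x. v x + w x) x = grad v x + grad w x"
        by (rule grad_eq[OF GDERIV_add[OF Vh_GDERIV_grad[OF v elim] Vh_GDERIV_grad[OF w elim]]])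
      then show ?case by (simp add: inner_add_right)
    qed
  qed (use grad_inner_integrable[OF u Vh_add[OF v w]] grad_inner_integrable[OF u v]
      grad_inner_integrable[OF u w] in \<open>auto intro: borel_measurable_integrable\<close>)
  then show ?thesis
    using grad_inner_integrable u v w by (simp add: dform_def)
qed

lemma dform_cmult_right:
  assumes u: "u \<in> Vh Th" and v: "v \<in> Vh Th"
  shows "dform D u (\<lambda>x. c * v x) = c * dform D u v"
proof -
  have "dform D u (\<lambda>x. c * v x) = (\<integral>x. c * inner (grad u x) (grad v x) \<partial>lebesgue_on D)"
    unfolding dform_def
  proof (rule integral_cong_AE)
    show "AE x in lebesgue_on D. inner (grad u x) (grad (\<lambda>x. c * v x) x) = c * inner (grad u x) (grad v x)"
      using AE_off_skeleton
    proof eventually_elim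
      case (elim x)
      have "GDERIV (\<lambda>x. c * v x) x :> (c *\<^sub>R grad v x + v x *\<^sub>R 0)"
        by (rule GDERIV_mult[OF GDERIV_const Vh_GDERIV_grad[OF v elim]])
      then have "grad (\<lambda>x. c * v x) x = c *\<^sub>R grad v x"
        using grad_eq by fastforce
      then show ?case by simp
    qed
  qed (use grad_inner_integrable[OF u Vh_cmult[OF v]] grad_inner_integrable[OF u v]
      in \<open>auto intro: borel_measurable_integrable\<close>)
  then show ?thesis
    by (simp add: dform_def)
qed

lemma Laph:
  assumes v: "v \<in> Vh Th"
  shows "Laph D Th v \<in> Vh Th" "\<phi> \<in> Vh Th \<Longrightarrow> l2ip D (Laph D Th v) \<phi> = - dform D v \<phi>"
proof -
  have "\<exists>!u. u \<in> Vh Th \<and> (\<forall>\<phi>\<in>Vh Th. l2ip D u \<phi> = - dform D v \<phi>)"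
    by (rule Vh_representation) (simp_all add: dform_add_right dform_cmult_right v)
  then have "\<exists>!u. u \<in> Vh Th \<and> (\<forall>\<phi>\<in>Vh Th. - l2ip D u \<phi> = dform D v \<phi>)"
    by (simp add: minus_equation_iff[of _ "dform D v _"] eq_commute[of "- dform D v _"])
  from theI'[OF this] have "Laph D Th v \<in> Vh Th \<and> (\<forall>\<phi>\<in>Vh Th. - l2ip D (Laph D Th v) \<phi> = dform D v \<phi>)"
    unfolding Laph_def .
  then show "Laph D Th v \<in> Vh Th" "\<phi> \<in> Vh Th \<Longrightarrow> l2ip D (Laph D Th v) \<phi> = - dform D v \<phi>"
    by force+
qed

text \<open>Moves the discrete Laplacian from the adjoint state to the test function, where the
  elementary controls produce it.\<close>

lemma Laph_symmetric:
  "v \<in> Vh Th \<Longrightarrow> w \<in> Vh Th \<Longrightarrow> l2ip D (Laph D Th v) w = l2ip D v (Laph D Th w)"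
  by (simp add: Laph dform_commute[of v w] l2ip_commute[of D v])

lemma Laph_add:
  assumes v: "v \<in> Vh Th" and w: "w \<in> Vh Th"
  shows "Laph D Th (\<lambda>x. v x + w x) = (\<lambda>x. Laph D Th v x + Laph D Th w x)"
proof (rule Vh_eqI)
  fix \<phi> assume \<phi>: "\<phi> \<in> Vh Th"
  show "l2ip D (Laph D Th (\<lambda>x. v x + w x)) \<phi> = l2ip D (\<lambda>x. Laph D Th v x + Laph D Th w x) \<phi>"
    using v w \<phi> by (simp add: Laph Vh_add l2ip_add_left Vh_sqint dform_commute[of _ \<phi>] dform_add_right)
qed (intro Laph Vh_add v w)+

lemma Laph_cmult:
  assumes v: "v \<in> Vh Th"
  shows "Laph D Th (\<lambda>x. c * v x) = (\<lambda>x. c * Laph D Th v x)"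
proof (rule Vh_eqI)
  fix \<phi> assume \<phi>: "\<phi> \<in> Vh Th"
  show "l2ip D (Laph D Th (\<lambda>x. c * v x)) \<phi> = l2ip D (\<lambda>x. c * Laph D Th v x) \<phi>"
    using v \<phi> by (simp add: Laph Vh_cmult l2ip_cmult_left dform_commute[of _ \<phi>] dform_cmult_right)
qed (intro Laph Vh_cmult v)+

end

section \<open>Square integrable random variables with values in \<open>L\<^sup>2\<close>\<close>

lemma (in prob_space) subalg_sigma_finite: "subalgebra M G \<Longrightarrow> sigma_finite_subalgebra M G"
  by (rule finite_measure_subalgebra_is_sigma_finite)
     (simp add: finite_measure_subalgebra_def finite_measure_subalgebra_axioms_def finite_measure_axioms)

lemma (in prob_space) integrable_if_square_integrable:
  assumes [measurable]: "f \<in> borel_measurable M" and "integrable M (\<lambda>x. (f x :: real)\<^sup>2)"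
  shows "integrable M f"
proof (rule Bochner_Integration.integrable_bound)
  show "integrable M (\<lambda>x. 1 + (f x)\<^sup>2)" using assms(2) by simp
  have "\<bar>a\<bar> \<le> 1 + a\<^sup>2" for a :: real
    using sum_squares_bound[of 1 "\<bar>a\<bar>"] zero_le_power2[of a] by simp
  then show "AE x in M. norm (f x) \<le> norm (1 + (f x)\<^sup>2)" by simp
qed simp

text \<open>Conditional Jensen for the square; it makes the coordinates of a conditional expectation
  square summable in the mean.\<close>

lemma (in prob_space) cond_exp_square:
  assumes G: "subalgebra M G" and f[measurable]: "f \<in> borel_measurable M" and f2: "integrable M (\<lambda>x. (f x :: real)\<^sup>2)"
  shows "integrable M (\<lambda>x. (real_cond_exp M G f x)\<^sup>2)"
    "(\<integral>x. (real_cond_exp M G f x)\<^sup>2 \<partial>M) \<le> (\<integral>x. (f x)\<^sup>2 \<partial>M)"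
proof -
  interpret sigma_finite_subalgebra M G by (rule subalg_sigma_finite[OF G])
  have fi: "integrable M f" by (rule integrable_if_square_integrable[OF f f2])
  have conv: "convex_on UNIV (\<lambda>x::real. x\<^sup>2)" by (rule convex_power2)
  show i: "integrable M (\<lambda>x. (real_cond_exp M G f x)\<^sup>2)"
    by (rule integrable_convex_cond_exp[OF fi, where I=UNIV and q="\<lambda>x. x\<^sup>2"]) (use f2 conv in auto)
  have "AE x in M. (real_cond_exp M G f x)\<^sup>2 \<le> real_cond_exp M G (\<lambda>x. (f x)\<^sup>2) x"
    by (rule real_cond_exp_jensens_inequality(2)[OF fi, where I=UNIV and q="\<lambda>x. x\<^sup>2"]) (use f2 conv in auto)
  from integral_mono_AE[OF i real_cond_exp_int(1)[OF f2] this]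
  show "(\<integral>x. (real_cond_exp M G f x)\<^sup>2 \<partial>M) \<le> (\<integral>x. (f x)\<^sup>2 \<partial>M)"
    by (simp add: real_cond_exp_int(2)[OF f2])
qed

lemma (in prob_space) square_summable_series:
  fixes b :: "nat \<Rightarrow> 'a \<Rightarrow> real"
  assumes b[measurable]: "\<And>k. b k \<in> borel_measurable M" and b2: "\<And>k. integrable M (\<lambda>x. (b k x)\<^sup>2)"
    and sb: "summable (\<lambda>k. \<integral>x. (b k x)\<^sup>2 \<partial>M)"
  shows "AE x in M. (\<Sum>k. ennreal ((b k x)\<^sup>2)) \<noteq> top"
    and "(\<integral>\<^sup>+x. (\<Sum>k. ennreal ((b k x)\<^sup>2)) \<partial>M) < top"
proof -
  have e: "(\<integral>\<^sup>+x. ennreal ((b k x)\<^sup>2) \<partial>M) = ennreal (\<integral>x. (b k x)\<^sup>2 \<partial>M)" for k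
    by (rule nn_integral_eq_integral[OF b2]) simp
  have "(\<integral>\<^sup>+x. (\<Sum>k. ennreal ((b k x)\<^sup>2)) \<partial>M) = (\<Sum>k. \<integral>\<^sup>+x. ennreal ((b k x)\<^sup>2) \<partial>M)"
    by (rule nn_integral_suminf) simp
  also have "\<dots> = (\<Sum>k. ennreal (\<integral>x. (b k x)\<^sup>2 \<partial>M))"
    by (simp only: e)
  also have "\<dots> = ennreal (\<Sum>k. \<integral>x. (b k x)\<^sup>2 \<partial>M)"
    by (rule suminf_ennreal2[OF _ sb]) simp
  finally have "(\<integral>\<^sup>+x. (\<Sum>k. ennreal ((b k x)\<^sup>2)) \<partial>M) = ennreal (\<Sum>k. \<integral>x. (b k x)\<^sup>2 \<partial>M)" .
  then show *: "(\<integral>\<^sup>+x. (\<Sum>k. ennreal ((b k x)\<^sup>2)) \<partial>M) < top"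
    by simp
  show "AE x in M. (\<Sum>k. ennreal ((b k x)\<^sup>2)) \<noteq> top"
    by (rule nn_integral_noteq_infinite[unfolded infinity_ennreal_def]) (measurable, rule less_imp_neq[OF *])
qed

text \<open>The terms are dominated by \<open>(b k x)\<^sup>2 + (\<phi> k)\<^sup>2\<close>, whose
  sum is finite almost surely and in expectation, so sum and expectation may be exchanged on every
  event. It will be applied both to a random element and to its conditional expectation, to compare
  the two coordinate by coordinate.\<close>

lemma (in prob_space) square_summable_pairing:
  fixes b :: "nat \<Rightarrow> 'a \<Rightarrow> real" and \<phi> :: "nat \<Rightarrow> real"
  assumes b[measurable]: "\<And>k. b k \<in> borel_measurable M" and b2: "\<And>k. integrable M (\<lambda>x. (b k x)\<^sup>2)"
    and sb: "summable (\<lambda>k. \<integral>x. (b k x)\<^sup>2 \<partial>M)" and s\<phi>: "summable (\<lambda>k. (\<phi> k)\<^sup>2)"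
    and h: "AE x in M. (\<lambda>k. b k x * \<phi> k) sums h x" and [measurable]: "h \<in> borel_measurable M"
    and A[measurable]: "A \<in> sets M"
  shows "integrable M h" "(\<lambda>k. \<phi> k * (\<integral>x\<in>A. b k x \<partial>M)) sums (\<integral>x\<in>A. h x \<partial>M)"
proof -
  have bi: "integrable M (b k)" for k by (rule integrable_if_square_integrable[OF b b2])
  have ab: "\<bar>x * y\<bar> \<le> x\<^sup>2 + y\<^sup>2" for x y :: real
    using sum_squares_bound[of x y] sum_squares_bound[of "-x" y] by (auto simp: abs_if)
  have *: "integrable M (\<lambda>x. indicator X x * h x) \<and>
      (\<lambda>k. \<integral>x. indicator X x * (b k x * \<phi> k) \<partial>M) sums (\<integral>x. indicator X x * h x \<partial>M)"
    if X[measurable]: "X \<in> sets M" for X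
  proof -
    let ?f = "\<lambda>k x. indicator X x * (b k x * \<phi> k)"
    have fi: "integrable M (?f k)" for k
      using integrable_mult_indicator[OF X integrable_mult_left[OF bi]] by simp
    have S1: "AE x in M. summable (\<lambda>k. norm (?f k x))"
      using square_summable_series(1)[OF b b2 sb]
    proof eventually_elim
      case (elim x)
      have "summable (\<lambda>k. (b k x)\<^sup>2 + (\<phi> k)\<^sup>2)"
        by (intro summable_add s\<phi> summable_suminf_not_top) (use elim in auto)
      then show ?case
        by (rule summable_comparison_test'[where N=0]) (use ab in \<open>auto simp: indicator_def\<close>)
    qed
    have S2: "summable (\<lambda>k. \<integral>x. norm (?f k x) \<partial>M)"
    proof (rule summable_comparison_test'[where N=0])
      show "summable (\<lambda>k. (\<integral>x. (b k x)\<^sup>2 \<partial>M) + (\<phi> k)\<^sup>2)"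
        by (intro summable_add s\<phi> sb)
      fix k
      have "(\<integral>x. norm (?f k x) \<partial>M) \<le> (\<integral>x. (b k x)\<^sup>2 + (\<phi> k)\<^sup>2 \<partial>M)"
        by (rule integral_mono) (use fi b2 ab in \<open>auto simp: indicator_def\<close>)
      then show "norm (\<integral>x. norm (?f k x) \<partial>M) \<le> (\<integral>x. (b k x)\<^sup>2 \<partial>M) + (\<phi> k)\<^sup>2"
        using b2 by (simp add: prob_space)
    qed
    have eq: "AE x in M. (\<Sum>k. ?f k x) = indicator X x * h x"
      using h
    proof eventually_elim
      case (elim x)
      show ?case using sums_unique[OF sums_mult[OF elim, of "indicator X x"]] by simp
    qed
    have m: "(\<lambda>x. \<Sum>k. ?f k x) \<in> borel_measurable M" by measurable
    have "integrable M (\<lambda>x. \<Sum>k. ?f k x)"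
      by (rule integrable_suminf[OF fi S1 S2])
    then have "integrable M (\<lambda>x. indicator X x * h x)"
      using integrable_cong_AE[OF m _ eq] by simp
    moreover have "(\<integral>x. (\<Sum>k. ?f k x) \<partial>M) = (\<integral>x. indicator X x * h x \<partial>M)"
      by (rule integral_cong_AE[OF m _ eq]) simp
    ultimately show ?thesis
      using sums_integral[OF fi S1 S2] by simp
  qed
  have "integrable M (\<lambda>x. indicator (space M) x * h x)"
    using *[of "space M"] by simp
  then show "integrable M h"
    by (subst (asm) Bochner_Integration.integrable_cong[OF refl, of _ _ h]) auto
  show "(\<lambda>k. \<phi> k * (\<integral>x\<in>A. b k x \<partial>M)) sums (\<integral>x\<in>A. h x \<partial>M)"
    using *[OF A] by (simp add: set_lebesgue_integral_def mult.assoc[symmetric])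
       (simp add: mult.commute)
qed

text \<open>One time slice of \<open>adapted_L2\<close> with the sigma-algebra as a parameter, so
  that a random element can be viewed as measurable for the past, for any later time, or for
  \<open>M\<close> itself.\<close>

definition l2rv :: "'w measure \<Rightarrow> 'x::euclidean_space set \<Rightarrow> 'w measure \<Rightarrow> ('w \<Rightarrow> 'x \<Rightarrow> real) \<Rightarrow> bool" where
  "l2rv M D G \<xi> \<longleftrightarrow> (\<forall>\<omega>\<in>space M. sqint D (\<xi> \<omega>)) \<and> wmeas D G \<xi> \<and> integrable M (\<lambda>\<omega>. normsq D (\<xi> \<omega>))"

lemma adapted_L2_iff: "adapted_L2 M W D T X \<longleftrightarrow> (\<forall>t\<in>{0..T}. l2rv M D (natfilt M W t) (X t))"
  by (auto simp: adapted_L2_def l2rv_def)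

lemma l2rv_sqint: "l2rv M D G \<xi> \<Longrightarrow> \<omega> \<in> space M \<Longrightarrow> sqint D (\<xi> \<omega>)"
  by (simp add: l2rv_def)

lemma l2rv_mono:
  assumes "l2rv M D G \<xi>" "subalgebra G' G"
  shows "l2rv M D G' \<xi>"
  using assms by (auto simp: l2rv_def wmeas_def intro: measurable_from_subalg)

locale l2_prob = prob_space M for M :: "'w measure" +
  fixes D :: "'x::euclidean_space set"
  assumes D_lm: "D \<in> lmeasurable"
begin

definition eD :: "nat \<Rightarrow> 'x \<Rightarrow> real" where
  "eD = (SOME e. total_ortho_seq D e)"

lemma eD: "total_ortho_seq D eD" "ortho_seq D eD"
proof -
  show "total_ortho_seq D eD"
    unfolding eD_def by (metis total_ortho_seq_exists[OF D_lm] someI_ex)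
  then show "ortho_seq D eD" by (simp add: total_ortho_seq_def)
qed

lemma eD_sqint: "sqint D (eD k)"
  by (rule ortho_seqD(1)[OF eD(2)])

text \<open>Weak measurability speaks about pairings with fixed functions only. When both arguments
  are random, Parseval writes the pairing as a countable sum of products of measurable
  coordinates.\<close>

lemma l2ip_rv_measurable:
  assumes sp: "space G = space M"
    and \<xi>: "\<And>\<omega>. \<omega> \<in> space M \<Longrightarrow> sqint D (\<xi> \<omega>)" "wmeas D G \<xi>"
    and \<zeta>: "\<And>\<omega>. \<omega> \<in> space M \<Longrightarrow> sqint D (\<zeta> \<omega>)" "wmeas D G \<zeta>"
  shows "(\<lambda>\<omega>. l2ip D (\<xi> \<omega>) (\<zeta> \<omega>)) \<in> borel_measurable G"
proof -
  have [measurable]: "(\<lambda>\<omega>. l2ip D (\<xi> \<omega>) (eD k)) \<in> borel_measurable G"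
    "(\<lambda>\<omega>. l2ip D (\<zeta> \<omega>) (eD k)) \<in> borel_measurable G" for k
    using \<xi>(2) \<zeta>(2) eD_sqint by (auto simp: wmeas_def)
  have "(\<lambda>\<omega>. \<Sum>k. l2ip D (\<xi> \<omega>) (eD k) * l2ip D (\<zeta> \<omega>) (eD k)) \<in> borel_measurable G"
    by measurable
  moreover have "(\<Sum>k. l2ip D (\<xi> \<omega>) (eD k) * l2ip D (\<zeta> \<omega>) (eD k)) = l2ip D (\<xi> \<omega>) (\<zeta> \<omega>)"
    if "\<omega> \<in> space G" for \<omega>
    using sums_unique[OF Parseval[OF D_lm eD(1) \<xi>(1) \<zeta>(1), of \<omega> \<omega>]] that sp by (simp add: l2ip_commute)
  ultimately show ?thesis
    by (simp cong: measurable_cong)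
qed

lemma l2rv_zero: "l2rv M D G (\<lambda>\<omega> x. 0)"
  by (simp add: l2rv_def wmeas_def normsq_def)

lemma l2rv_cmult: "l2rv M D G \<xi> \<Longrightarrow> l2rv M D G (\<lambda>\<omega> x. c * \<xi> \<omega> x)"
  by (auto simp: l2rv_def wmeas_def normsq_cmult l2ip_cmult_left sqint_cmult)

lemma l2rv_indicator:
  assumes G: "subalgebra M G" and \<xi>: "l2rv M D G \<xi>" and A[measurable]: "A \<in> sets G"
  shows "l2rv M D G (\<lambda>\<omega> x. indicator A \<omega> * \<xi> \<omega> x)"
proof -
  have "A \<in> sets M" using A G by (auto simp: subalgebra_def)
  moreover have "(indicator A \<omega> :: real)\<^sup>2 = indicator A \<omega>" for \<omega>
    by (simp add: indicator_def)
  ultimately show ?thesis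
    using \<xi> integrable_mult_indicator[of A M "\<lambda>\<omega>. normsq D (\<xi> \<omega>)"]
    by (auto simp: l2rv_def wmeas_def normsq_cmult l2ip_cmult_left sqint_cmult)
qed

lemma l2rv_const: "sqint D \<phi> \<Longrightarrow> l2rv M D G (\<lambda>\<omega>. \<phi>)"
  by (simp add: l2rv_def wmeas_def)

lemma l2rv_l2ip_measurable:
  assumes "subalgebra M G" "l2rv M D G \<xi>" "l2rv M D G \<zeta>"
  shows "(\<lambda>\<omega>. l2ip D (\<xi> \<omega>) (\<zeta> \<omega>)) \<in> borel_measurable G"
  using assms by (intro l2ip_rv_measurable) (auto simp: subalgebra_def l2rv_def)

lemma subalgebra_refl: "subalgebra M M"
  by (simp add: subalgebra_def)

lemma l2rv_l2ip_integrable: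
  assumes \<xi>: "l2rv M D M \<xi>" and \<zeta>: "l2rv M D M \<zeta>"
  shows "integrable M (\<lambda>\<omega>. l2ip D (\<xi> \<omega>) (\<zeta> \<omega>))"
proof (rule Bochner_Integration.integrable_bound)
  show "integrable M (\<lambda>\<omega>. normsq D (\<xi> \<omega>) + normsq D (\<zeta> \<omega>))"
    using \<xi> \<zeta> by (auto simp: l2rv_def)
  show "(\<lambda>\<omega>. l2ip D (\<xi> \<omega>) (\<zeta> \<omega>)) \<in> borel_measurable M"
    by (rule l2rv_l2ip_measurable[OF subalgebra_refl \<xi> \<zeta>])
  show "AE \<omega> in M. norm (l2ip D (\<xi> \<omega>) (\<zeta> \<omega>)) \<le> norm (normsq D (\<xi> \<omega>) + normsq D (\<zeta> \<omega>))"
  proof (rule AE_I2)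
    fix \<omega> assume "\<omega> \<in> space M"
    then show "norm (l2ip D (\<xi> \<omega>) (\<zeta> \<omega>)) \<le> norm (normsq D (\<xi> \<omega>) + normsq D (\<zeta> \<omega>))"
      using l2ip_abs_le[OF l2rv_sqint[OF \<xi>] l2rv_sqint[OF \<zeta>], of \<omega> \<omega>] by simp
  qed
qed

lemma l2rv_add:
  assumes G: "subalgebra M G" and \<xi>: "l2rv M D G \<xi>" and \<zeta>: "l2rv M D G \<zeta>"
  shows "l2rv M D G (\<lambda>\<omega> x. \<xi> \<omega> x + \<zeta> \<omega> x)"
  unfolding l2rv_def
proof (intro conjI ballI)
  show "sqint D (\<lambda>x. \<xi> \<omega> x + \<zeta> \<omega> x)" if "\<omega> \<in> space M" for \<omega>
    using that by (intro sqint_add l2rv_sqint[OF \<xi>] l2rv_sqint[OF \<zeta>])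
  show "wmeas D G (\<lambda>\<omega> x. \<xi> \<omega> x + \<zeta> \<omega> x)"
    unfolding wmeas_def
  proof (intro allI impI)
    fix \<phi> assume \<phi>: "sqint D \<phi>"
    then have "(\<lambda>\<omega>. l2ip D (\<xi> \<omega>) \<phi> + l2ip D (\<zeta> \<omega>) \<phi>) \<in> borel_measurable G"
      using \<xi> \<zeta> by (intro borel_measurable_add) (auto simp: l2rv_def wmeas_def)
    then show "(\<lambda>\<omega>. l2ip D (\<lambda>x. \<xi> \<omega> x + \<zeta> \<omega> x) \<phi>) \<in> borel_measurable G"
      using G \<phi> by (subst measurable_cong[of _ _ "\<lambda>\<omega>. l2ip D (\<xi> \<omega>) \<phi> + l2ip D (\<zeta> \<omega>) \<phi>"])
        (auto simp: subalgebra_def l2ip_add_left l2rv_sqint[OF \<xi>] l2rv_sqint[OF \<zeta>])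
  qed
  have "integrable M (\<lambda>\<omega>. normsq D (\<xi> \<omega>) + 2 * l2ip D (\<xi> \<omega>) (\<zeta> \<omega>) + normsq D (\<zeta> \<omega>))"
    using \<xi> \<zeta> l2rv_l2ip_integrable[OF l2rv_mono[OF \<xi> G] l2rv_mono[OF \<zeta> G]] by (auto simp: l2rv_def)
  then show "integrable M (\<lambda>\<omega>. normsq D (\<lambda>x. \<xi> \<omega> x + \<zeta> \<omega> x))"
    by (rule Bochner_Integration.integrable_cong[THEN iffD1, rotated 2])
       (auto simp: normsq_add l2rv_sqint[OF \<xi>] l2rv_sqint[OF \<zeta>])
qed

lemma l2rv_diff:
  assumes G: "subalgebra M G" and \<xi>: "l2rv M D G \<xi>" and \<zeta>: "l2rv M D G \<zeta>"
  shows "l2rv M D G (\<lambda>\<omega> x. \<xi> \<omega> x - \<zeta> \<omega> x)"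
  using l2rv_add[OF G \<xi> l2rv_cmult[OF \<zeta>, of "-1"]] by simp

lemma l2rv_coordinate:
  assumes \<xi>: "l2rv M D M \<xi>" and \<phi>: "sqint D \<phi>"
  shows "(\<lambda>\<omega>. l2ip D (\<xi> \<omega>) \<phi>) \<in> borel_measurable M"
    "integrable M (\<lambda>\<omega>. (l2ip D (\<xi> \<omega>) \<phi>)\<^sup>2)" "integrable M (\<lambda>\<omega>. l2ip D (\<xi> \<omega>) \<phi>)"
proof -
  show m: "(\<lambda>\<omega>. l2ip D (\<xi> \<omega>) \<phi>) \<in> borel_measurable M"
    using \<xi> \<phi> by (auto simp: l2rv_def wmeas_def)
  show 2: "integrable M (\<lambda>\<omega>. (l2ip D (\<xi> \<omega>) \<phi>)\<^sup>2)"
  proof (rule Bochner_Integration.integrable_bound)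
    show "integrable M (\<lambda>\<omega>. normsq D (\<xi> \<omega>) * normsq D \<phi>)"
      using \<xi> by (auto simp: l2rv_def)
    show "AE \<omega> in M. norm ((l2ip D (\<xi> \<omega>) \<phi>)\<^sup>2) \<le> norm (normsq D (\<xi> \<omega>) * normsq D \<phi>)"
      using l2ip_Cauchy_Schwarz[OF l2rv_sqint[OF \<xi>] \<phi>] by (intro AE_I2) (auto simp: abs_mult normsq_nonneg)
  qed (use m in measurable)
  show "integrable M (\<lambda>\<omega>. l2ip D (\<xi> \<omega>) \<phi>)"
    by (rule integrable_if_square_integrable[OF m 2])
qed

lemma l2rv_coordinates_summable:
  assumes \<xi>: "l2rv M D M \<xi>"
  shows "summable (\<lambda>k. \<integral>\<omega>. (l2ip D (\<xi> \<omega>) (eD k))\<^sup>2 \<partial>M)"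
proof (rule summableI_nonneg_bounded)
  fix n
  have "(\<Sum>k<n. \<integral>\<omega>. (l2ip D (\<xi> \<omega>) (eD k))\<^sup>2 \<partial>M) = (\<integral>\<omega>. (\<Sum>k<n. (l2ip D (\<xi> \<omega>) (eD k))\<^sup>2) \<partial>M)"
    by (subst Bochner_Integration.integral_sum) (auto intro: l2rv_coordinate[OF \<xi> eD_sqint])
  also have "\<dots> \<le> (\<integral>\<omega>. normsq D (\<xi> \<omega>) \<partial>M)"
  proof (rule integral_mono)
    show "integrable M (\<lambda>\<omega>. \<Sum>k<n. (l2ip D (\<xi> \<omega>) (eD k))\<^sup>2)"
      by (auto intro: l2rv_coordinate[OF \<xi> eD_sqint])
    show "integrable M (\<lambda>\<omega>. normsq D (\<xi> \<omega>))"
      using \<xi> by (simp add: l2rv_def)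
    show "(\<Sum>k<n. (l2ip D (\<xi> \<omega>) (eD k))\<^sup>2) \<le> normsq D (\<xi> \<omega>)" if "\<omega> \<in> space M" for \<omega>
      using Bessel[OF eD(2) l2rv_sqint[OF \<xi> that], of "{..<n}"] by (simp add: l2ip_commute)
  qed
  finally show "(\<Sum>k<n. \<integral>\<omega>. (l2ip D (\<xi> \<omega>) (eD k))\<^sup>2 \<partial>M) \<le> (\<integral>\<omega>. normsq D (\<xi> \<omega>) \<partial>M)" .
qed simp

context
  fixes G \<xi>
  assumes G: "subalgebra M G" and \<xi>: "l2rv M D M \<xi>"
begin

definition cexp_coord :: "nat \<Rightarrow> 'w \<Rightarrow> real" where
  "cexp_coord k = real_cond_exp M G (\<lambda>\<omega>. l2ip D (\<xi> \<omega>) (eD k))"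

lemma cexp_coord_measurable [measurable]: "cexp_coord k \<in> borel_measurable G"
  by (simp add: cexp_coord_def)

lemma cexp_coord_measurable' [measurable]: "cexp_coord k \<in> borel_measurable M"
  by (rule measurable_from_subalg[OF G]) measurable

lemma cexp_coord_square_integrable: "integrable M (\<lambda>\<omega>. (cexp_coord k \<omega>)\<^sup>2)"
  unfolding cexp_coord_def by (rule cond_exp_square(1)[OF G l2rv_coordinate(1,2)[OF \<xi> eD_sqint]])

lemma cexp_coord_summable: "summable (\<lambda>k. \<integral>\<omega>. (cexp_coord k \<omega>)\<^sup>2 \<partial>M)"
  by (rule summable_comparison_test'[OF l2rv_coordinates_summable[OF \<xi>], where N=0])
     (use cond_exp_square(2)[OF G l2rv_coordinate(1,2)[OF \<xi> eD_sqint]] in \<open>simp add: cexp_coord_def\<close>)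

text \<open>The conditional expectations of the coordinates are almost surely square summable, so
  Riesz-Fischer can be applied for each outcome. That the resulting element is a conditional
  expectation is tested on events of \<open>G\<close>, where all coordinates have the right
  integrals.\<close>

lemma cexpL2_exists: "\<exists>\<eta>. cexpL2 M D G \<xi> \<eta>"
proof -
  interpret sigma_finite_subalgebra M G by (rule subalg_sigma_finite[OF G])
  let ?c = cexp_coord
  \<comment> \<open>\<open>cexpL2\<close> demands square integrability at every outcome, not just
    almost surely; the exceptional event is handled by zero coefficients. It belongs to
    \<open>G\<close>, so the modification stays measurable.\<close>
  define P where "P \<omega> \<longleftrightarrow> (\<Sum>k. ennreal ((?c k \<omega>)\<^sup>2)) \<noteq> top" for \<omega>
  have [measurable]: "Measurable.pred G P" unfolding P_def by measurable
  have AE_P: "AE \<omega> in M. P \<omega>"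
    unfolding P_def
    by (rule square_summable_series(1)[OF _ cexp_coord_square_integrable cexp_coord_summable]) measurable
  have "\<exists>f. sqint D f \<and> (\<forall>g. sqint D g \<longrightarrow> (\<lambda>k. (if P \<omega> then ?c k \<omega> else 0) * l2ip D (eD k) g) sums l2ip D f g)" for \<omega>
  proof (rule Riesz_Fischer[OF D_lm eD(2)])
    show "summable (\<lambda>k. (if P \<omega> then ?c k \<omega> else 0)\<^sup>2)"
      by (cases "P \<omega>") (auto simp: P_def intro: summable_suminf_not_top)
  qed
  from choice[OF allI[OF this]] obtain \<eta> where H: "\<forall>\<omega>. sqint D (\<eta> \<omega>) \<and>
    (\<forall>g. sqint D g \<longrightarrow> (\<lambda>k. (if P \<omega> then ?c k \<omega> else 0) * l2ip D (eD k) g) sums l2ip D (\<eta> \<omega>) g)" ..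
  have \<eta>: "sqint D (\<eta> \<omega>)"
    "sqint D g \<Longrightarrow> (\<lambda>k. (if P \<omega> then ?c k \<omega> else 0) * l2ip D (eD k) g) sums l2ip D (\<eta> \<omega>) g" for \<omega> g
    using spec[OF H, of \<omega>] by simp_all
  have wm: "(\<lambda>\<omega>. l2ip D (\<eta> \<omega>) \<phi>) \<in> borel_measurable G" if \<phi>: "sqint D \<phi>" for \<phi>
  proof -
    have "(\<lambda>\<omega>. l2ip D (\<eta> \<omega>) \<phi>) = (\<lambda>\<omega>. \<Sum>k. (if P \<omega> then ?c k \<omega> else 0) * l2ip D (eD k) \<phi>)"
      by (rule ext) (rule sums_unique[OF \<eta>(2)[OF \<phi>]])
    also have "\<dots> \<in> borel_measurable G" by measurable
    finally show ?thesis .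
  qed
  have "AE \<omega> in M. real_cond_exp M G (\<lambda>\<omega>. l2ip D (\<xi> \<omega>) \<phi>) \<omega> = l2ip D (\<eta> \<omega>) \<phi>" if \<phi>: "sqint D \<phi>" for \<phi>
  proof (rule real_cond_exp_charact)
    have s\<phi>: "summable (\<lambda>k. (l2ip D (eD k) \<phi>)\<^sup>2)"
      by (rule summableI_nonneg_bounded[of _ "normsq D \<phi>"]) (auto intro: Bessel[OF eD(2) \<phi>])
    have h1: "AE \<omega> in M. (\<lambda>k. l2ip D (\<xi> \<omega>) (eD k) * l2ip D (eD k) \<phi>) sums l2ip D (\<xi> \<omega>) \<phi>"
      using Parseval[OF D_lm eD(1) l2rv_sqint[OF \<xi>] \<phi>]
      by (intro AE_I2) (subst l2ip_commute[of D _ "eD _"], simp)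
    have h2: "AE \<omega> in M. (\<lambda>k. ?c k \<omega> * l2ip D (eD k) \<phi>) sums l2ip D (\<eta> \<omega>) \<phi>"
      using AE_P
    proof eventually_elim
      case (elim \<omega>)
      then show ?case using \<eta>(2)[OF \<phi>, of \<omega>] by simp
    qed
    have m: "(\<lambda>\<omega>. l2ip D (\<eta> \<omega>) \<phi>) \<in> borel_measurable M"
      by (rule measurable_from_subalg[OF G wm[OF \<phi>]])
    have cm: "?c k \<in> borel_measurable M" for k by measurable
    note p1 = square_summable_pairing[OF l2rv_coordinate(1,2)[OF \<xi> eD_sqint] l2rv_coordinates_summable[OF \<xi>]
        s\<phi> h1 l2rv_coordinate(1)[OF \<xi> \<phi>]]
    note p2 = square_summable_pairing[OF cm cexp_coord_square_integrable cexp_coord_summable s\<phi> h2 m]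
    show "integrable M (\<lambda>\<omega>. l2ip D (\<xi> \<omega>) \<phi>)" by (rule p1(1)[OF sets.top])
    show "integrable M (\<lambda>\<omega>. l2ip D (\<eta> \<omega>) \<phi>)" by (rule p2(1)[OF sets.top])
    show "(\<lambda>\<omega>. l2ip D (\<eta> \<omega>) \<phi>) \<in> borel_measurable G" by (rule wm[OF \<phi>])
    fix A assume A: "A \<in> sets G"
    then have AM: "A \<in> sets M" using G by (auto simp: subalgebra_def)
    have "(\<integral>\<omega>\<in>A. l2ip D (\<xi> \<omega>) (eD k) \<partial>M) = (\<integral>\<omega>\<in>A. ?c k \<omega> \<partial>M)" for k
      unfolding cexp_coord_def by (rule real_cond_exp_intA[OF l2rv_coordinate(3)[OF \<xi> eD_sqint] A])
    then show "(\<integral>\<omega>\<in>A. l2ip D (\<xi> \<omega>) \<phi> \<partial>M) = (\<integral>\<omega>\<in>A. l2ip D (\<eta> \<omega>) \<phi> \<partial>M)"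
      using sums_unique2[OF p1(2)[OF AM]] p2(2)[OF AM] by simp
  qed
  then have "cexpL2 M D G \<xi> \<eta>"
    using \<eta>(1) wm by (auto simp: cexpL2_def wmeas_def eq_commute)
  then show ?thesis by (rule exI[of _ \<eta>])
qed

text \<open>Proved for an arbitrary version, since the target of the cost is picked by choice. By
  Parseval its squared norm is almost surely the sum of the squared conditional coordinates, which
  has finite expectation.\<close>

lemma cexpL2_l2rv:
  assumes \<eta>: "cexpL2 M D G \<xi> \<eta>"
  shows "l2rv M D G \<eta>"
proof -
  have sq: "\<And>\<omega>. \<omega> \<in> space M \<Longrightarrow> sqint D (\<eta> \<omega>)" and wm: "wmeas D G \<eta>"
    using \<eta> by (auto simp: cexpL2_def)
  have "(\<lambda>\<omega>. normsq D (\<eta> \<omega>)) \<in> borel_measurable G"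
    unfolding normsq_def using G by (intro l2ip_rv_measurable sq wm) (auto simp: subalgebra_def)
  then have m: "(\<lambda>\<omega>. normsq D (\<eta> \<omega>)) \<in> borel_measurable M"
    by (rule measurable_from_subalg[OF G])
  have "AE \<omega> in M. \<forall>k. l2ip D (\<eta> \<omega>) (eD k) = cexp_coord k \<omega>"
    unfolding AE_all_countable cexp_coord_def using \<eta> eD_sqint by (auto simp: cexpL2_def)
  then have "AE \<omega> in M. ennreal (normsq D (\<eta> \<omega>)) = (\<Sum>k. ennreal ((cexp_coord k \<omega>)\<^sup>2))"
    using AE_space
  proof eventually_elim
    case (elim \<omega>)
    have "(\<lambda>k. (cexp_coord k \<omega>)\<^sup>2) sums normsq D (\<eta> \<omega>)"
      using Parseval[OF D_lm eD(1) sq sq, of \<omega> \<omega>] elim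
      by (simp add: l2ip_commute[of D "eD _"] power2_eq_square normsq_def)
    then show ?case
      by (simp add: suminf_ennreal2 sums_iff)
  qed
  then have "(\<integral>\<^sup>+\<omega>. ennreal (normsq D (\<eta> \<omega>)) \<partial>M) = (\<integral>\<^sup>+\<omega>. (\<Sum>k. ennreal ((cexp_coord k \<omega>)\<^sup>2)) \<partial>M)"
    by (rule nn_integral_cong_AE)
  also have "\<dots> < top"
    by (rule square_summable_series(2)[OF _ cexp_coord_square_integrable cexp_coord_summable]) measurable
  finally have "integrable M (\<lambda>\<omega>. normsq D (\<eta> \<omega>))"
    using m by (intro integrableI_bounded) (auto simp: normsq_nonneg)
  then show ?thesis
    using sq wm by (simp add: l2rv_def)
qed

end

end

section \<open>Brownian motion and its filtration\<close>

lemma sets_natfilt: "sets (natfilt M W t) = sigma_sets (space M)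
     ({W s -` B \<inter> space M | s B. 0 \<le> s \<and> s \<le> t \<and> B \<in> sets borel} \<union> null_sets M)"
  unfolding natfilt_def using sets.sets_into_space by (intro sets_measure_of) fastforce

lemma space_natfilt [simp]: "space (natfilt M W t) = space M"
  by (simp add: natfilt_def space_measure_of_conv)

lemma natfilt_mono: "s \<le> t \<Longrightarrow> subalgebra (natfilt M W t) (natfilt M W s)"
  unfolding subalgebra_def space_natfilt sets_natfilt
  by (intro conjI refl sigma_sets_mono') fastforce

lemma natfilt_subalgebra:
  assumes "std_BM M W"
  shows "subalgebra M (natfilt M W t)"
proof -
  have "W s -` B \<inter> space M \<in> sets M" if "0 \<le> s" "B \<in> sets borel" for s B
    using assms that by (auto simp: std_BM_def intro: measurable_sets)
  then show ?thesis
    unfolding subalgebra_def sets_natfilt by (auto intro!: sets.sigma_sets_subset)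
qed

text \<open>Finitely many values \<open>W\<^sub>i\<close>, \<open>i \<in> I \<subseteq> [0,s]\<close>, are functions of the increments over the
  partition \<open>I \<union> {0,s}\<close>, since \<open>W\<^sub>0 = 0\<close> almost surely.\<close>

lemma BM_increment_indep_cylinder:
  assumes BM: "std_BM M W" and st: "0 \<le> s" "s < t"
    and I: "finite I" "I \<subseteq> {0..s}" and B: "\<And>i. i \<in> I \<Longrightarrow> B i \<in> sets borel"
    and A: "A \<in> sets M" "AE \<omega> in M. \<omega> \<in> A \<longleftrightarrow> (\<forall>i\<in>I. W i \<omega> \<in> B i)"
    and B': "B' \<in> sets borel"
  shows "measure M (A \<inter> ((\<lambda>\<omega>. W t \<omega> - W s \<omega>) -` B' \<inter> space M))
     = measure M A * measure M ((\<lambda>\<omega>. W t \<omega> - W s \<omega>) -` B' \<inter> space M)"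
proof -
  interpret prob_space M using BM by (simp add: std_BM_def)
  have Wm[measurable]: "r \<ge> 0 \<Longrightarrow> W r \<in> borel_measurable M" for r
    using BM by (simp add: std_BM_def)
  define J where "J = I \<union> {0, s}"
  have J: "finite J" "J \<subseteq> {0..s}" "0 \<in> J" "s \<in> J"
    using I st by (auto simp: J_def)
  define l where "l = sorted_list_of_set J"
  have l: "set l = J" "sorted l" "distinct l" "sorted_wrt (<) l"
    using J(1) by (auto simp: l_def)
  define m where "m = length l - 1"
  have "l \<noteq> []" using l(1) J(3) by auto
  then have len: "length l = Suc m" by (simp add: m_def)
  \<comment> \<open>Beyond the list the value is \<open>t\<close>: increment number \<open>m\<close>
    runs from \<open>s\<close> to \<open>t\<close>, all earlier ones lie in
    \<open>[0,s]\<close>.\<close>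
  define ts where "ts i = (if i < length l then l ! i else t)" for i
  have mem: "ts i \<in> J" if "i \<le> m" for i
    using that len l(1) by (auto simp: ts_def)
  have ex: "\<exists>i\<le>m. ts i = j" if "j \<in> J" for j
    using that l(1) len by (metis in_set_conv_nth less_Suc_eq_le ts_def)
  have mono_le: "ts i \<le> ts j" if "i \<le> j" "j \<le> m" for i j
    using that len l(2) by (auto simp: ts_def sorted_nth_mono)
  have ts0: "ts 0 = 0"
    using ex[OF J(3)] mono_le[of 0] mem[of 0] J(2) by fastforce
  have tsm: "ts m = s"
    using ex[OF J(4)] mono_le[of _ m] mem[of m] J(2) by fastforce
  have tsS: "ts (Suc m) = t"
    by (simp add: ts_def len)
  have inc: "\<forall>i<Suc m. ts i < ts (Suc i)"
  proof (intro allI impI)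
    fix i assume "i < Suc m"
    show "ts i < ts (Suc i)"
    proof (cases "i = m")
      case True
      then show ?thesis using tsm tsS st by simp
    next
      case False
      then show ?thesis using \<open>i < Suc m\<close> len l(4) by (auto simp: ts_def sorted_wrt_nth_less)
    qed
  qed
  let ?\<Delta> = "\<lambda>i \<omega>. W (ts (Suc i)) \<omega> - W (ts i) \<omega>"
  have ind: "indep_vars (\<lambda>_. borel) ?\<Delta> {..<Suc m}"
    using BM inc ts0 unfolding std_BM_def by simp
  have ind2: "indep_var (PiM {m} (\<lambda>_. borel)) (\<lambda>\<omega>. restrict (\<lambda>i. ?\<Delta> i \<omega>) {m})
      (PiM {..<m} (\<lambda>_. borel)) (\<lambda>\<omega>. restrict (\<lambda>i. ?\<Delta> i \<omega>) {..<m})"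
    by (rule indep_var_restrict[OF ind]) auto
  \<comment> \<open>Partial sums of increments telescope to \<open>W (ts j) - W 0\<close>, so
    \<open>Q\<close> expresses the cylinder event through the first \<open>m\<close> increments, up
    to the null event where \<open>W 0\<close> is not 0.\<close>
  define Q where "Q f \<longleftrightarrow> (\<forall>j\<in>{..m}. ts j \<in> I \<longrightarrow> (\<Sum>i<j. f i) \<in> B (ts j))" for f :: "nat \<Rightarrow> real"
  have sm: "(\<lambda>f. \<Sum>i<j. f i) \<in> borel_measurable (PiM {..<m} (\<lambda>_. borel :: real measure))" if "j \<le> m" for j
    using that by (intro borel_measurable_sum measurable_component_singleton) auto
  have "Measurable.pred (PiM {..<m} (\<lambda>_. borel :: real measure)) Q"
    unfolding Q_def
  proof (intro pred_intros_finite pred_intros_imp' finite_atMost)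
    fix j assume "j \<in> {..m}" "ts j \<in> I"
    then show "Measurable.pred (PiM {..<m} (\<lambda>_. borel :: real measure)) (\<lambda>f. (\<Sum>i<j. f i) \<in> B (ts j))"
      using measurable_sets[OF sm[of j] B[of "ts j"]] by (simp add: pred_def vimage_def Int_def conj_commute)
  qed
  then have Xb: "{f \<in> space (PiM {..<m} (\<lambda>_. borel :: real measure)). Q f} \<in> sets (PiM {..<m} (\<lambda>_. borel))"
    by (simp add: pred_def)
  have Xa: "{f \<in> space (PiM {m} (\<lambda>_. borel :: real measure)). f m \<in> B'} \<in> sets (PiM {m} (\<lambda>_. borel))"
    using B' by measurable
  define P where "P \<omega> \<longleftrightarrow> Q (\<lambda>i. ?\<Delta> i \<omega>)" for \<omega>
  let ?A = "{\<omega>\<in>space M. P \<omega>}" and ?E = "(\<lambda>\<omega>. W t \<omega> - W s \<omega>) -` B' \<inter> space M"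
  have QP: "Q (restrict (\<lambda>i. ?\<Delta> i \<omega>) {..<m}) \<longleftrightarrow> P \<omega>" for \<omega>
    by (auto simp: P_def Q_def)
  have pre_b: "(\<lambda>\<omega>. restrict (\<lambda>i. ?\<Delta> i \<omega>) {..<m}) -` {f \<in> space (PiM {..<m} (\<lambda>_. borel)). Q f} \<inter> space M = ?A"
    using QP by (auto simp: space_PiM)
  have pre_a: "(\<lambda>\<omega>. restrict (\<lambda>i. ?\<Delta> i \<omega>) {m}) -` {f \<in> space (PiM {m} (\<lambda>_. borel)). f m \<in> B'} \<inter> space M = ?E"
    by (auto simp: space_PiM tsm tsS)
  have [measurable]: "?A \<in> sets M"
    using indep_var_rv2[OF ind2] Xb unfolding pre_b[symmetric] by (rule measurable_sets)
  have [measurable]: "?E \<in> sets M"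
    using st B' by (intro measurable_sets[of _ M borel]) auto
  have tel: "(\<Sum>i<j. ?\<Delta> i \<omega>) = W (ts j) \<omega> - W (ts 0) \<omega>" for j \<omega>
    by (induction j) auto
  have W0: "AE \<omega> in M. W 0 \<omega> = 0"
    using BM unfolding std_BM_def by (auto elim: eventually_mono)
  have AA: "AE \<omega> in M. \<omega> \<in> A \<longleftrightarrow> \<omega> \<in> ?A"
    using W0 A(2) AE_space
  proof eventually_elim
    case (elim \<omega>)
    have "P \<omega> \<longleftrightarrow> (\<forall>j\<le>m. ts j \<in> I \<longrightarrow> W (ts j) \<omega> \<in> B (ts j))"
      unfolding P_def Q_def tel using elim ts0 by (simp add: Ball_def)
    also have "\<dots> \<longleftrightarrow> (\<forall>i\<in>I. W i \<omega> \<in> B i)"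
      using ex by (auto simp: J_def)
    finally show ?case using elim by simp
  qed
  have "prob (A \<inter> ?E) = prob (?A \<inter> ?E)"
    by (rule finite_measure_eq_AE) (use AA A in auto)
  also have "?A \<inter> ?E = (\<lambda>\<omega>. (restrict (\<lambda>i. ?\<Delta> i \<omega>) {m}, restrict (\<lambda>i. ?\<Delta> i \<omega>) {..<m})) -`
      ({f \<in> space (PiM {m} (\<lambda>_. borel)). f m \<in> B'} \<times> {f \<in> space (PiM {..<m} (\<lambda>_. borel)). Q f}) \<inter> space M"
    unfolding pre_a[symmetric] pre_b[symmetric] by auto
  also have "prob \<dots> = prob ?E * prob ?A"
    unfolding indep_varD[OF ind2 Xa Xb] pre_a pre_b ..
  also have "prob ?A = prob A"
    by (rule finite_measure_eq_AE) (use AA A in auto)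
  finally show ?thesis by simp
qed

text \<open>Taking cylinder events modulo null sets puts both the generators and the null sets of
  the augmented filtration into one intersection-stable class. Independence on this class extends to
  the generated sigma-algebra.\<close>

lemma BM_increment_indep:
  assumes BM: "std_BM M W" and st: "0 \<le> s" "s < t"
  shows "prob_space.indep_set M (sets (natfilt M W s))
     (sigma_sets (space M) {(\<lambda>\<omega>. W t \<omega> - W s \<omega>) -` B \<inter> space M | B. B \<in> sets borel})"
proof -
  interpret prob_space M using BM by (simp add: std_BM_def)
  have Wm[measurable]: "r \<ge> 0 \<Longrightarrow> W r \<in> borel_measurable M" for r
    using BM by (simp add: std_BM_def)
  define C where "C = {A \<in> sets M. \<exists>I B. finite I \<and> I \<subseteq> {0..s} \<and> (\<forall>i\<in>I. B i \<in> sets borel) \<and>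
      (AE \<omega> in M. \<omega> \<in> A \<longleftrightarrow> (\<forall>i\<in>I. W i \<omega> \<in> B i))}"
  let ?E = "{(\<lambda>\<omega>. W t \<omega> - W s \<omega>) -` B \<inter> space M | B. B \<in> sets borel}"
  have Em: "(\<lambda>\<omega>. W t \<omega> - W s \<omega>) -` B \<inter> space M \<in> sets M" if "B \<in> sets borel" for B
    using st that by (intro measurable_sets[of _ M borel]) auto
  have "indep_set C ?E"
  proof (rule indep_setI)
    show "C \<subseteq> sets M" by (auto simp: C_def)
    show "?E \<subseteq> sets M" using Em by auto
    fix a b assume "a \<in> C" "b \<in> ?E"
    then show "prob (a \<inter> b) = prob a * prob b"
      using BM_increment_indep_cylinder[OF BM st] unfolding C_def by blast
  qed
  moreover have "Int_stable C"
  proof (rule Int_stableI)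
    fix a b assume "a \<in> C" "b \<in> C"
    then obtain I B I' B' where *: "a \<in> sets M" "b \<in> sets M"
      "finite I" "I \<subseteq> {0..s}" "\<forall>i\<in>I. B i \<in> sets borel" "AE \<omega> in M. \<omega> \<in> a \<longleftrightarrow> (\<forall>i\<in>I. W i \<omega> \<in> B i)"
      "finite I'" "I' \<subseteq> {0..s}" "\<forall>i\<in>I'. B' i \<in> sets borel" "AE \<omega> in M. \<omega> \<in> b \<longleftrightarrow> (\<forall>i\<in>I'. W i \<omega> \<in> B' i)"
      unfolding C_def by blast
    let ?B = "\<lambda>i. (if i \<in> I then B i else UNIV) \<inter> (if i \<in> I' then B' i else UNIV)"
    have "AE \<omega> in M. \<omega> \<in> a \<inter> b \<longleftrightarrow> (\<forall>i\<in>I \<union> I'. W i \<omega> \<in> ?B i)"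
      using *(6,10) by eventually_elim auto
    then show "a \<inter> b \<in> C"
      unfolding C_def using * by (intro CollectI conjI exI[of _ "I \<union> I'"] exI[of _ ?B]) auto
  qed
  moreover have "Int_stable ?E"
  proof (rule Int_stableI)
    fix a b assume "a \<in> ?E" "b \<in> ?E"
    then obtain B B' where "a = (\<lambda>\<omega>. W t \<omega> - W s \<omega>) -` B \<inter> space M" "b = (\<lambda>\<omega>. W t \<omega> - W s \<omega>) -` B' \<inter> space M"
      "B \<in> sets borel" "B' \<in> sets borel" by auto
    then show "a \<inter> b \<in> ?E"
      by (intro CollectI exI[of _ "B \<inter> B'"]) auto
  qed
  ultimately have ind: "indep_set (sigma_sets (space M) C) (sigma_sets (space M) ?E)"
    by (rule indep_set_sigma_sets)
  have "{W r -` B \<inter> space M | r B. 0 \<le> r \<and> r \<le> s \<and> B \<in> sets borel} \<union> null_sets M \<subseteq> C"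
  proof (intro Un_least subsetI)
    fix A assume "A \<in> {W r -` B \<inter> space M | r B. 0 \<le> r \<and> r \<le> s \<and> B \<in> sets borel}"
    then obtain r B where "A = W r -` B \<inter> space M" "0 \<le> r" "r \<le> s" "B \<in> sets borel" by auto
    then show "A \<in> C"
      unfolding C_def by (intro CollectI conjI exI[of _ "{r}"] exI[of _ "\<lambda>_. B"]) auto
  next
    fix A assume A: "A \<in> null_sets M"
    then have "AE \<omega> in M. \<omega> \<notin> A" by (rule AE_not_in)
    \<comment> \<open>A null set is almost surely equal to the impossible cylinder event that
      \<open>W 0\<close> lies in the empty set.\<close>
    then show "A \<in> C"
      unfolding C_def using A st by (intro CollectI conjI exI[of _ "{0}"] exI[of _ "\<lambda>_. {}"]) auto
  qed
  then have "sets (natfilt M W s) \<subseteq> sigma_sets (space M) C"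
    unfolding sets_natfilt by (rule sigma_sets_mono')
  with ind show ?thesis
    by (auto simp: indep_sets2_eq)
qed

lemma BM_increment_square:
  assumes BM: "std_BM M W" and st: "0 \<le> s" "s < t"
  shows "integrable M (\<lambda>\<omega>. (W t \<omega> - W s \<omega>)\<^sup>2)" "(\<integral>\<omega>. (W t \<omega> - W s \<omega>)\<^sup>2 \<partial>M) = t - s"
proof -
  have d: "distributed M lborel (\<lambda>\<omega>. W t \<omega> - W s \<omega>) (\<lambda>x. ennreal (normal_density 0 (sqrt (t - s)) x))"
    using BM st by (simp add: std_BM_def)
  have hb: "has_bochner_integral lborel (\<lambda>x. normal_density 0 (sqrt (t - s)) x * x\<^sup>2) (t - s)"
    using normal_moment_even[of "sqrt (t - s)" 0 1] st
    by (simp add: power2_eq_square diff_divide_distrib)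
  show "integrable M (\<lambda>\<omega>. (W t \<omega> - W s \<omega>)\<^sup>2)"
    using distributed_integrable[OF d, of "\<lambda>x. x\<^sup>2"] has_bochner_integral_iff hb by auto
  show "(\<integral>\<omega>. (W t \<omega> - W s \<omega>)\<^sup>2 \<partial>M) = t - s"
    using distributed_integral[OF d, of "\<lambda>x. x\<^sup>2"] has_bochner_integral_integral_eq[OF hb] by simp
qed

text \<open>A random variable of the past is independent of the increment, hence of its square, and
  the expectation of the product factorises. The intended \<open>f\<close> is the square of a
  truncated conditional expectation.\<close>

lemma BM_increment_square_mult:
  assumes BM: "std_BM M W" and st: "0 \<le> s" "s < t"
    and f: "f \<in> borel_measurable (natfilt M W s)" "integrable M f"
  shows "integrable M (\<lambda>\<omega>. f \<omega> * (W t \<omega> - W s \<omega>)\<^sup>2)"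
    "(\<integral>\<omega>. f \<omega> * (W t \<omega> - W s \<omega>)\<^sup>2 \<partial>M) = (t - s) * (\<integral>\<omega>. f \<omega> \<partial>M)"
proof -
  interpret prob_space M using BM by (simp add: std_BM_def)
  have Wm[measurable]: "r \<ge> 0 \<Longrightarrow> W r \<in> borel_measurable M" for r
    using BM by (simp add: std_BM_def)
  have "indep_var borel f borel (\<lambda>\<omega>. W t \<omega> - W s \<omega>)"
    unfolding indep_var_eq
  proof (intro conjI)
    show "random_variable borel f" "random_variable borel (\<lambda>\<omega>. W t \<omega> - W s \<omega>)"
      using f(2) st by auto
    have "{f -` A \<inter> space M |A. A \<in> sets borel} \<subseteq> sets (natfilt M W s)"
      using measurable_sets[OF f(1)] by auto
    from sets.sigma_sets_subset[OF this]
    have "sigma_sets (space M) {f -` A \<inter> space M |A. A \<in> sets borel} \<subseteq> sets (natfilt M W s)"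
      by simp
    with BM_increment_indep[OF BM st]
    show "indep_set (sigma_sets (space M) {f -` A \<inter> space M |A. A \<in> sets borel})
      (sigma_sets (space M) {(\<lambda>\<omega>. W t \<omega> - W s \<omega>) -` A \<inter> space M |A. A \<in> sets borel})"
      by (auto simp: indep_sets2_eq)
  qed
  from indep_var_compose[OF this, of "\<lambda>x. x" borel "\<lambda>x. x\<^sup>2" borel]
  have ind: "indep_var borel f borel (\<lambda>\<omega>. (W t \<omega> - W s \<omega>)\<^sup>2)"
    by (simp add: comp_def)
  note sq = BM_increment_square[OF BM st]
  show "integrable M (\<lambda>\<omega>. f \<omega> * (W t \<omega> - W s \<omega>)\<^sup>2)"
    by (rule indep_var_integrable[OF ind f(2) sq(1)])
  show "(\<integral>\<omega>. f \<omega> * (W t \<omega> - W s \<omega>)\<^sup>2 \<partial>M) = (t - s) * (\<integral>\<omega>. f \<omega> \<partial>M)"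
    using indep_var_lebesgue_integral[OF ind f(2) sq(1)] sq(2) by simp
qed

text \<open>With \<open>z\<close> the conditional expectation truncated at level \<open>k\<close>,
  \<open>E z\<^sup>2 = E (z \<xi> \<Delta>W) \<le> (\<tau> E \<xi>\<^sup>2 + E (z\<^sup>2 \<Delta>W\<^sup>2) / \<tau>) / 2\<close> and independence makes the last term
  \<open>E z\<^sup>2 / 2\<close>, which can be absorbed.\<close>

lemma BM_cond_exp_increment_square_integrable:
  assumes BM: "std_BM M W" and st: "0 \<le> s" "s < t"
    and \<xi>[measurable]: "\<xi> \<in> borel_measurable M" and \<xi>2: "integrable M (\<lambda>\<omega>. (\<xi> \<omega>)\<^sup>2)"
  shows "integrable M (\<lambda>\<omega>. \<xi> \<omega> * (W t \<omega> - W s \<omega>))"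
    "integrable M (\<lambda>\<omega>. (real_cond_exp M (natfilt M W s) (\<lambda>\<omega>. \<xi> \<omega> * (W t \<omega> - W s \<omega>)) \<omega>)\<^sup>2)"
proof -
  interpret prob_space M using BM by (simp add: std_BM_def)
  let ?G = "natfilt M W s" and ?w = "\<lambda>\<omega>. W t \<omega> - W s \<omega>"
  note G = natfilt_subalgebra[OF BM, of s]
  interpret sigma_finite_subalgebra M ?G by (rule subalg_sigma_finite[OF G])
  have [measurable]: "?w \<in> borel_measurable M"
    using BM st by (intro borel_measurable_diff) (auto simp: std_BM_def)
  define \<tau> where "\<tau> = t - s"
  have \<tau>: "\<tau> > 0" using st by (simp add: \<tau>_def)
  have ab: "\<bar>x * y\<bar> \<le> x\<^sup>2 + y\<^sup>2" for x y :: real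
    using sum_squares_bound[of x y] sum_squares_bound[of "-x" y] by (auto simp: abs_if)
  show \<xi>w: "integrable M (\<lambda>\<omega>. \<xi> \<omega> * ?w \<omega>)"
    by (rule Bochner_Integration.integrable_bound[of M "\<lambda>\<omega>. (\<xi> \<omega>)\<^sup>2 + (?w \<omega>)\<^sup>2"])
       (use \<xi>2 BM_increment_square(1)[OF BM st] ab in auto)
  define z where "z = real_cond_exp M ?G (\<lambda>\<omega>. \<xi> \<omega> * ?w \<omega>)"
  have zG[measurable]: "z \<in> borel_measurable ?G" by (simp add: z_def)
  have zM[measurable]: "z \<in> borel_measurable M" by (rule measurable_from_subalg[OF G zG])
  \<comment> \<open>Truncation makes the quantity to be absorbed finite beforehand. The resulting
    bound does not involve \<open>k\<close>, so Fatou carries it over to \<open>z\<close>.\<close>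
  define zk where "zk k \<omega> = (if \<bar>z \<omega>\<bar> \<le> real k then z \<omega> else 0)" for k \<omega>
  have zkG[measurable]: "zk k \<in> borel_measurable ?G" for k unfolding zk_def by measurable
  have zkM[measurable]: "zk k \<in> borel_measurable M" for k unfolding zk_def by measurable
  have zk_bd: "\<bar>zk k \<omega>\<bar> \<le> real k" for k \<omega> by (simp add: zk_def)
  have zk2: "integrable M (\<lambda>\<omega>. (zk k \<omega>)\<^sup>2)" for k
  proof (rule integrable_const_bound)
    show "AE \<omega> in M. norm ((zk k \<omega>)\<^sup>2) \<le> (real k)\<^sup>2"
      using zk_bd by (simp add: abs_le_square_iff[symmetric])
  qed measurable
  have est: "(\<integral>\<omega>. (zk k \<omega>)\<^sup>2 \<partial>M) \<le> \<tau> * (\<integral>\<omega>. (\<xi> \<omega>)\<^sup>2 \<partial>M)" for k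
  proof -
    have i: "integrable M (\<lambda>\<omega>. zk k \<omega> * (\<xi> \<omega> * ?w \<omega>))"
    proof (rule Bochner_Integration.integrable_bound)
      show "integrable M (\<lambda>\<omega>. real k * (\<xi> \<omega> * ?w \<omega>))" using \<xi>w by simp
      show "AE \<omega> in M. norm (zk k \<omega> * (\<xi> \<omega> * ?w \<omega>)) \<le> norm (real k * (\<xi> \<omega> * ?w \<omega>))"
        using zk_bd by (auto simp: abs_mult intro!: mult_right_mono)
    qed measurable
    note sq = BM_increment_square_mult[OF BM st _ zk2[of k]]
    have sqi: "integrable M (\<lambda>\<omega>. (zk k \<omega>)\<^sup>2 * (?w \<omega>)\<^sup>2)" by (rule sq(1)) measurable
    have sqe: "(\<integral>\<omega>. (zk k \<omega>)\<^sup>2 * (?w \<omega>)\<^sup>2 \<partial>M) = \<tau> * (\<integral>\<omega>. (zk k \<omega>)\<^sup>2 \<partial>M)"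
      unfolding \<tau>_def by (rule sq(2)) measurable
    have "(\<integral>\<omega>. (zk k \<omega>)\<^sup>2 \<partial>M) = (\<integral>\<omega>. zk k \<omega> * z \<omega> \<partial>M)"
      by (intro Bochner_Integration.integral_cong) (auto simp: zk_def power2_eq_square)
    also have "\<dots> = (\<integral>\<omega>. zk k \<omega> * (\<xi> \<omega> * ?w \<omega>) \<partial>M)"
      unfolding z_def by (rule real_cond_exp_intg(2)[OF i zkG]) measurable
    also have "\<dots> \<le> (\<integral>\<omega>. \<tau> / 2 * (\<xi> \<omega>)\<^sup>2 + 1 / (2 * \<tau>) * ((zk k \<omega>)\<^sup>2 * (?w \<omega>)\<^sup>2) \<partial>M)"
    proof (rule integral_mono[OF i])
      fix \<omega>
      have "2 * \<tau> * (zk k \<omega> * (\<xi> \<omega> * ?w \<omega>)) \<le> (\<tau> * \<xi> \<omega>)\<^sup>2 + (zk k \<omega> * ?w \<omega>)\<^sup>2"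
        using sum_squares_bound[of "\<tau> * \<xi> \<omega>" "zk k \<omega> * ?w \<omega>"] by (simp add: algebra_simps)
      then show "zk k \<omega> * (\<xi> \<omega> * ?w \<omega>) \<le> \<tau> / 2 * (\<xi> \<omega>)\<^sup>2 + 1 / (2 * \<tau>) * ((zk k \<omega>)\<^sup>2 * (?w \<omega>)\<^sup>2)"
        using \<tau> by (simp add: field_simps power2_eq_square)
    qed (use \<xi>2 sqi in auto)
    also have "\<dots> = \<tau> / 2 * (\<integral>\<omega>. (\<xi> \<omega>)\<^sup>2 \<partial>M) + 1 / (2 * \<tau>) * (\<integral>\<omega>. (zk k \<omega>)\<^sup>2 * (?w \<omega>)\<^sup>2 \<partial>M)"
      using \<xi>2 sqi by simp
    also have "\<dots> = \<tau> / 2 * (\<integral>\<omega>. (\<xi> \<omega>)\<^sup>2 \<partial>M) + (\<integral>\<omega>. (zk k \<omega>)\<^sup>2 \<partial>M) / 2"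
      unfolding sqe using \<tau> by simp
    finally show ?thesis by simp
  qed
  have "(\<integral>\<^sup>+\<omega>. ennreal ((z \<omega>)\<^sup>2) \<partial>M) = (\<integral>\<^sup>+\<omega>. liminf (\<lambda>k. ennreal ((zk k \<omega>)\<^sup>2)) \<partial>M)"
  proof (rule nn_integral_cong)
    fix \<omega>
    have "\<forall>\<^sub>F k in sequentially. ennreal ((zk k \<omega>)\<^sup>2) = ennreal ((z \<omega>)\<^sup>2)"
    proof (rule eventually_mono[OF eventually_ge_at_top[of "nat \<lceil>\<bar>z \<omega>\<bar>\<rceil>"]])
      fix k assume "nat \<lceil>\<bar>z \<omega>\<bar>\<rceil> \<le> k"
      then have "\<bar>z \<omega>\<bar> \<le> real k" by linarith
      then show "ennreal ((zk k \<omega>)\<^sup>2) = ennreal ((z \<omega>)\<^sup>2)" by (simp add: zk_def)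
    qed
    then have "(\<lambda>k. ennreal ((zk k \<omega>)\<^sup>2)) \<longlonglongrightarrow> ennreal ((z \<omega>)\<^sup>2)"
      by (rule tendsto_eventually)
    from lim_imp_Liminf[OF _ this] show "ennreal ((z \<omega>)\<^sup>2) = liminf (\<lambda>k. ennreal ((zk k \<omega>)\<^sup>2))"
      by simp
  qed
  also have "\<dots> \<le> liminf (\<lambda>k. \<integral>\<^sup>+\<omega>. ennreal ((zk k \<omega>)\<^sup>2) \<partial>M)"
    by (rule nn_integral_liminf) measurable
  also have "\<dots> \<le> limsup (\<lambda>k. \<integral>\<^sup>+\<omega>. ennreal ((zk k \<omega>)\<^sup>2) \<partial>M)"
    by (rule Liminf_le_Limsup) simp
  also have "\<dots> \<le> ennreal (\<tau> * (\<integral>\<omega>. (\<xi> \<omega>)\<^sup>2 \<partial>M))"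
  proof (rule Limsup_bounded, rule always_eventually, rule allI)
    fix k
    have "(\<integral>\<^sup>+\<omega>. ennreal ((zk k \<omega>)\<^sup>2) \<partial>M) = ennreal (\<integral>\<omega>. (zk k \<omega>)\<^sup>2 \<partial>M)"
      by (rule nn_integral_eq_integral[OF zk2]) simp
    then show "(\<integral>\<^sup>+\<omega>. ennreal ((zk k \<omega>)\<^sup>2) \<partial>M) \<le> ennreal (\<tau> * (\<integral>\<omega>. (\<xi> \<omega>)\<^sup>2 \<partial>M))"
      using est[of k] by (simp add: ennreal_leI)
  qed
  also have "\<dots> < \<infinity>" by simp
  finally have "(\<integral>\<^sup>+\<omega>. ennreal ((z \<omega>)\<^sup>2) \<partial>M) < \<infinity>" .
  then show "integrable M (\<lambda>\<omega>. (real_cond_exp M ?G (\<lambda>\<omega>. \<xi> \<omega> * ?w \<omega>) \<omega>)\<^sup>2)"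
    unfolding z_def[symmetric] by (intro integrableI_bounded) auto
qed

section \<open>The discrete control problem\<close>

lemma nonneg_linear_term:
  fixes a q :: real
  assumes "\<epsilon>0 > 0" "\<And>\<epsilon>. 0 < \<epsilon> \<Longrightarrow> \<epsilon> < \<epsilon>0 \<Longrightarrow> 0 \<le> \<epsilon> * a + \<epsilon>\<^sup>2 * q"
  shows "0 \<le> a"
proof (rule ccontr)
  assume "\<not> 0 \<le> a"
  then have a: "a < 0" by simp
  \<comment> \<open>The second entry yields \<open>\<epsilon> * q \<le> - a / 2\<close>, so the
    linear term wins; the added 1 covers \<open>q = 0\<close>. Halving the first entry keeps
    \<open>\<epsilon>\<close> strictly below \<open>\<epsilon>0\<close>.\<close>
  define \<epsilon> where "\<epsilon> = min (\<epsilon>0 / 2) (- a / (2 * (\<bar>q\<bar> + 1)))"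
  have pos: "0 < \<epsilon>" "\<epsilon> < \<epsilon>0" using assms(1) a by (auto simp: \<epsilon>_def min_less_iff_disj intro!: divide_neg_pos)
  have "\<epsilon> * q \<le> \<epsilon> * \<bar>q\<bar>" using pos by (intro mult_left_mono) auto
  also have "\<dots> \<le> (- a / (2 * (\<bar>q\<bar> + 1))) * \<bar>q\<bar>"
    by (intro mult_right_mono) (auto simp: \<epsilon>_def)
  also have "\<dots> \<le> (- a / (2 * (\<bar>q\<bar> + 1))) * (\<bar>q\<bar> + 1)"
    using a by (intro mult_left_mono) (auto intro!: divide_nonpos_pos)
  also have "\<dots> = - a / 2" by (simp add: field_simps)
  finally have "a + \<epsilon> * q < 0" using a by simp
  then have "\<epsilon> * (a + \<epsilon> * q) < 0" using pos by (simp add: mult_pos_neg)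
  with assms(2)[OF pos] show False by (simp add: algebra_simps power2_eq_square)
qed

section \<open>The time grid and the spaces of discrete processes\<close>

locale stoch_fem = fem D Th + prob_space M
  for D :: "'x::euclidean_space set" and Th and M :: "'w measure" +
  fixes W :: "real \<Rightarrow> 'w \<Rightarrow> real" and T :: real and N :: nat
  assumes T_pos: "T > 0" and N_pos: "N > 0" and BM: "std_BM M W"
begin

sublocale l2_prob M D
  by unfold_locales (rule D_lmeasurable)

abbreviation "\<tau> \<equiv> T / real N"
abbreviation "tt \<equiv> tn T N"
abbreviation "F n \<equiv> natfilt M W (tt n)"

text \<open>A member of the state space is, up to null events, constant inside each interval, but
  its value there differs in general from those at both ends. The midpoint serves as the sample of
  the open interval.\<close>

definition mid :: "nat \<Rightarrow> real" where
  "mid n = tt n + \<tau> / 2"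

lemma tau_pos: "\<tau> > 0"
  using T_pos N_pos by simp

lemma tt_0 [simp]: "tt 0 = 0" and tt_N [simp]: "tt N = T"
  using N_pos by (simp_all add: tn_def)

lemma tt_Suc: "tt (Suc n) = tt n + \<tau>"
  by (simp add: tn_def algebra_simps add_divide_distrib)

lemma tt_le_iff [simp]: "tt m \<le> tt n \<longleftrightarrow> m \<le> n"
  unfolding tn_def using tau_pos by (simp del: times_divide_eq_right)

lemma tt_less_iff [simp]: "tt m < tt n \<longleftrightarrow> m < n"
  using tt_le_iff[of n m] by linarith

lemma tt_nonneg: "0 \<le> tt n"
  using tt_le_iff[of 0 n] by simp

lemma tt_mem: "n \<le> N \<Longrightarrow> tt n \<in> {0..T}"
  using tt_le_iff[of n N] tt_nonneg by simp

lemma mid_mem: "mid n \<in> {tt n<..<tt (Suc n)}"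
  using tau_pos by (simp add: mid_def tt_Suc)

lemma interval_mem: "n < N \<Longrightarrow> t \<in> {tt n<..<tt (Suc n)} \<Longrightarrow> t \<in> {0..T}"
  using tt_mem[of n] tt_mem[of "Suc n"] by auto

lemma mid_memT: "n < N \<Longrightarrow> mid n \<in> {0..T}"
  using interval_mem mid_mem by blast

lemma interval_index:
  assumes "t \<in> {tt n..<tt (Suc n)}"
  shows "nat \<lfloor>t / \<tau>\<rfloor> = n"
proof -
  have "real n \<le> t / \<tau>" "t / \<tau> < real n + 1"
    using assms T_pos N_pos by (auto simp: tn_def field_simps)
  then show ?thesis by linarith
qed

lemma in_interval:
  assumes "t \<in> {0..<T}"
  shows "\<exists>n<N. t \<in> {tt n..<tt (Suc n)}"
proof -
  define n where "n = nat \<lfloor>t / \<tau>\<rfloor>"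
  have "0 \<le> t / \<tau>" using assms tau_pos by simp
  then have *: "real n \<le> t / \<tau>" "t / \<tau> < real n + 1" unfolding n_def by linarith+
  then have t: "t \<in> {tt n..<tt (Suc n)}"
    using T_pos N_pos by (auto simp: tn_def field_simps)
  then have "tt n < tt N" using assms by simp
  then show ?thesis using t by (auto simp del: tt_N)
qed

lemma interval_unique:
  assumes "t \<in> {tt n..<tt (Suc n)}" "t \<in> {tt m..<tt (Suc m)}"
  shows "m = n"
  using interval_index[OF assms(1)] interval_index[OF assms(2)] by simp

lemma not_grid: "t \<in> {tt n<..<tt (Suc n)} \<Longrightarrow> t \<noteq> tt k"
  by (auto simp: not_less_eq[symmetric])

lemma F_sub: "subalgebra M (natfilt M W t)"
  by (rule natfilt_subalgebra[OF BM])

lemma l2rv_natfilt_mono: "l2rv M D (natfilt M W s) \<xi> \<Longrightarrow> s \<le> t \<Longrightarrow> l2rv M D (natfilt M W t) \<xi>"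
  by (rule l2rv_mono[OF _ natfilt_mono])

lemma l2rv_M: "l2rv M D (natfilt M W s) \<xi> \<Longrightarrow> l2rv M D M \<xi>"
  by (rule l2rv_mono[OF _ F_sub])

lemma XspaceD:
  assumes "Xspace M W D Th T N X"
  shows "t \<in> {0..T} \<Longrightarrow> l2rv M D (natfilt M W t) (X t)"
    "t \<in> {0..T} \<Longrightarrow> \<omega> \<in> space M \<Longrightarrow> X t \<omega> \<in> Vh Th"
    "n < N \<Longrightarrow> t \<in> {tt n<..<tt (Suc n)} \<Longrightarrow> cexpVh M D Th (F n) (X (tt (Suc n))) (X t)"
  using assms unfolding Xspace_def adapted_L2_iff by blast+

lemma UspaceD:
  assumes "Uspace M W D Th T N U"
  shows "t \<in> {0..T} \<Longrightarrow> l2rv M D (natfilt M W t) (U t)"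
    "t \<in> {0..T} \<Longrightarrow> \<omega> \<in> space M \<Longrightarrow> U t \<omega> \<in> Vh Th"
    "n < N \<Longrightarrow> t \<in> {tt n..<tt (Suc n)} \<Longrightarrow> \<omega> \<in> space M \<Longrightarrow> U t \<omega> = U (tt n) \<omega>"
  using assms unfolding Uspace_def adapted_L2_iff by blast+

lemma l2rv_lincomb:
  assumes "l2rv M D (natfilt M W t) \<xi>" "l2rv M D (natfilt M W t) \<zeta>"
  shows "l2rv M D (natfilt M W t) (\<lambda>\<omega> x. \<xi> \<omega> x + c * \<zeta> \<omega> x)"
  by (intro l2rv_add l2rv_cmult F_sub assms)

lemma Vh_lincomb: "v \<in> Vh Th \<Longrightarrow> w \<in> Vh Th \<Longrightarrow> (\<lambda>x. v x + c * w x) \<in> Vh Th"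
  by (intro Vh_add Vh_cmult)

lemma l2ip_lincomb:
  "sqint D f \<Longrightarrow> sqint D g \<Longrightarrow> sqint D h \<Longrightarrow> l2ip D (\<lambda>x. f x + c * g x) h = l2ip D f h + c * l2ip D g h"
  by (simp add: l2ip_add_left sqint_cmult l2ip_cmult_left)

lemma Uspace_lincomb:
  assumes U: "Uspace M W D Th T N U" and V: "Uspace M W D Th T N V"
  shows "Uspace M W D Th T N (\<lambda>t \<omega> x. U t \<omega> x + c * V t \<omega> x)"
  unfolding Uspace_def adapted_L2_iff
proof (intro conjI ballI allI impI)
  fix n t \<omega> assume "n < N" "t \<in> {tt n..<tt (Suc n)}" "\<omega> \<in> space M"
  from UspaceD(3)[OF U this] UspaceD(3)[OF V this]
  show "(\<lambda>x. U t \<omega> x + c * V t \<omega> x) = (\<lambda>x. U (tt n) \<omega> x + c * V (tt n) \<omega> x)"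
    by simp
qed (auto intro!: l2rv_lincomb Vh_lincomb UspaceD[OF U] UspaceD[OF V])

text \<open>Conditional expectations only see the values on the sample space, while functions are total.\<close>

lemma real_cond_exp_cong_space:
  assumes G: "subalgebra M G" and f: "integrable M f" and eq: "\<And>\<omega>. \<omega> \<in> space M \<Longrightarrow> g \<omega> = f \<omega>"
  shows "AE \<omega> in M. real_cond_exp M G g \<omega> = real_cond_exp M G f \<omega>"
proof -
  interpret sigma_finite_subalgebra M G by (rule subalg_sigma_finite[OF G])
  have "g \<in> borel_measurable M"
    using f eq by (subst measurable_cong[of _ _ f]) auto
  then show ?thesis
    using f eq by (intro real_cond_exp_cong) auto
qed

lemma Xspace_lincomb:
  assumes X: "Xspace M W D Th T N X" and Y: "Xspace M W D Th T N Y"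
  shows "Xspace M W D Th T N (\<lambda>t \<omega> x. X t \<omega> x + c * Y t \<omega> x)"
  unfolding Xspace_def adapted_L2_iff
proof (intro conjI ballI allI impI)
  fix n t assume n: "n < N" and t: "t \<in> {tt n<..<tt (Suc n)}"
  interpret sigma_finite_subalgebra M "F n" by (rule subalg_sigma_finite[OF F_sub])
  have S: "tt (Suc n) \<in> {0..T}" using n tt_mem by simp
  show "cexpVh M D Th (F n) (\<lambda>\<omega> x. X (tt (Suc n)) \<omega> x + c * Y (tt (Suc n)) \<omega> x) (\<lambda>\<omega> x. X t \<omega> x + c * Y t \<omega> x)"
    unfolding cexpVh_def
  proof
    fix \<phi> assume \<phi>: "\<phi> \<in> Vh Th"
    let ?x = "\<lambda>\<omega>. l2ip D (X (tt (Suc n)) \<omega>) \<phi>" and ?y = "\<lambda>\<omega>. l2ip D (Y (tt (Suc n)) \<omega>) \<phi>"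
    have ix: "integrable M ?x" and iy: "integrable M ?y"
      by (intro l2rv_coordinate(3) l2rv_M[OF XspaceD(1)[OF X S]] l2rv_M[OF XspaceD(1)[OF Y S]] Vh_sqint \<phi>)+
    have "AE \<omega> in M. real_cond_exp M (F n) (\<lambda>\<omega>. l2ip D (\<lambda>x. X (tt (Suc n)) \<omega> x + c * Y (tt (Suc n)) \<omega> x) \<phi>) \<omega>
        = real_cond_exp M (F n) (\<lambda>\<omega>. ?x \<omega> + c * ?y \<omega>) \<omega>"
      using ix iy XspaceD(2)[OF X S] XspaceD(2)[OF Y S] \<phi>
      by (intro real_cond_exp_cong_space F_sub) (auto simp: l2ip_lincomb Vh_sqint)
    moreover have "AE \<omega> in M. real_cond_exp M (F n) (\<lambda>\<omega>. ?x \<omega> + c * ?y \<omega>) \<omega>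
        = real_cond_exp M (F n) ?x \<omega> + real_cond_exp M (F n) (\<lambda>\<omega>. c * ?y \<omega>) \<omega>"
      using ix iy by (intro real_cond_exp_add) auto
    moreover have "AE \<omega> in M. real_cond_exp M (F n) (\<lambda>\<omega>. c * ?y \<omega>) \<omega> = c * real_cond_exp M (F n) ?y \<omega>"
      using iy by (rule real_cond_exp_cmult)
    moreover have "AE \<omega> in M. l2ip D (X t \<omega>) \<phi> = real_cond_exp M (F n) ?x \<omega>"
      "AE \<omega> in M. l2ip D (Y t \<omega>) \<phi> = real_cond_exp M (F n) ?y \<omega>"
      using XspaceD(3)[OF X n t] XspaceD(3)[OF Y n t] \<phi> by (auto simp: cexpVh_def)
    ultimately show "AE \<omega> in M. l2ip D (\<lambda>x. X t \<omega> x + c * Y t \<omega> x) \<phi>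
        = real_cond_exp M (F n) (\<lambda>\<omega>. l2ip D (\<lambda>x. X (tt (Suc n)) \<omega> x + c * Y (tt (Suc n)) \<omega> x) \<phi>) \<omega>"
      using AE_space
    proof eventually_elim
      case (elim \<omega>)
      have "l2ip D (\<lambda>x. X t \<omega> x + c * Y t \<omega> x) \<phi> = l2ip D (X t \<omega>) \<phi> + c * l2ip D (Y t \<omega>) \<phi>"
        using XspaceD(2)[OF X interval_mem[OF n t] elim(6)] XspaceD(2)[OF Y interval_mem[OF n t] elim(6)] \<phi>
        by (simp add: l2ip_lincomb Vh_sqint)
      then show ?case using elim by simp
    qed
  qed
qed (auto intro!: l2rv_lincomb Vh_lincomb XspaceD[OF X] XspaceD[OF Y])

text \<open>Both values are versions of the same conditional expectation. Testing against the finite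
  basis needs only finitely many null events, so equality holds almost surely as functions.\<close>

lemma Xspace_const_on_interval:
  assumes X: "Xspace M W D Th T N X" and n: "n < N" and t: "t \<in> {tt n<..<tt (Suc n)}"
  shows "AE \<omega> in M. X t \<omega> = X (mid n) \<omega>"
proof -
  have "AE \<omega> in M. \<forall>b\<in>Bh. l2ip D (X t \<omega>) b = l2ip D (X (mid n) \<omega>) b"
  proof (rule AE_finite_allI[OF Bh(1)])
    fix b assume "b \<in> Bh"
    then have b: "b \<in> Vh Th" by (rule Bh(2))
    have "AE \<omega> in M. l2ip D (X t \<omega>) b = real_cond_exp M (F n) (\<lambda>\<omega>. l2ip D (X (tt (Suc n)) \<omega>) b) \<omega>"
      "AE \<omega> in M. l2ip D (X (mid n) \<omega>) b = real_cond_exp M (F n) (\<lambda>\<omega>. l2ip D (X (tt (Suc n)) \<omega>) b) \<omega>"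
      using XspaceD(3)[OF X n t] XspaceD(3)[OF X n mid_mem] b by (auto simp: cexpVh_def)
    then show "AE \<omega> in M. l2ip D (X t \<omega>) b = l2ip D (X (mid n) \<omega>) b"
      by eventually_elim simp
  qed
  then show ?thesis
    using AE_space
  proof eventually_elim
    case (elim \<omega>)
    have v: "X t \<omega> \<in> Vh Th" "X (mid n) \<omega> \<in> Vh Th"
      using XspaceD(2)[OF X] interval_mem[OF n t] mid_memT[OF n] elim by auto
    have "(\<lambda>x. \<Sum>b\<in>Bh. l2ip D b (X t \<omega>) * b x) = (\<lambda>x. \<Sum>b\<in>Bh. l2ip D b (X (mid n) \<omega>) * b x)"
      using elim(1) by (intro ext sum.cong refl)
        (simp add: l2ip_commute[of D _ "X t \<omega>"] l2ip_commute[of D _ "X (mid n) \<omega>"])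
    with Bh(5)[OF v(1)] Bh(5)[OF v(2)] show ?case by metis
  qed
qed

text \<open>The grid points, about which the hypothesis is silent, form a null set; measurability of
  the integrand comes from the step function that agrees with it almost everywhere.\<close>

lemma integral_piecewise_const:
  assumes f: "\<And>n t. n < N \<Longrightarrow> t \<in> {tt n<..<tt (Suc n)} \<Longrightarrow> f t = c n"
  shows "(\<integral>t. f t \<partial>lebesgue_on {0..T}) = \<tau> * (\<Sum>n<N. c n :: real)"
proof -
  let ?g = "\<lambda>t. \<Sum>n<N. indicator {tt n<..<tt (Suc n)} t * c n"
  have gi: "integrable lebesgue (\<lambda>t. indicator {tt n<..<tt (Suc n)} t * c n)" for n
    by (intro integrable_mult_left integrable_real_indicator) auto
  have ae: "AE t in lebesgue. ?g t = indicator {0..T} t * f t"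
  proof -
    have "negligible (tt ` {..N})" by (intro negligible_finite) simp
    then have "AE t in lebesgue. t \<notin> tt ` {..N}"
      by (intro AE_not_in) (simp add: negligible_iff_null_sets)
    then show ?thesis
    proof eventually_elim
      case (elim t)
      show ?case
      proof (cases "t \<in> {0..T}")
        case False
        then have "indicator {tt n<..<tt (Suc n)} t * c n = 0" if "n < N" for n
          using interval_mem[OF that] by (auto simp: indicator_def)
        then have "?g t = 0" by (intro sum.neutral) blast
        then show ?thesis using False by simp
      next
        case True
        have "t \<noteq> T" using elim tt_N by (metis atMost_iff image_eqI order_refl)
        then obtain n where n: "n < N" "t \<in> {tt n..<tt (Suc n)}"
          using in_interval[of t] True by auto
        have "t \<noteq> tt n" using elim n by auto
        then have t: "t \<in> {tt n<..<tt (Suc n)}" using n by auto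
        have "?g t = (\<Sum>k<N. if k = n then c n else 0)"
        proof (intro sum.cong refl)
          fix k
          show "indicator {tt k<..<tt (Suc k)} t * c k = (if k = n then c n else 0)"
          proof (cases "k = n")
            case True
            then show ?thesis using t by simp
          next
            case False
            then have "t \<notin> {tt k<..<tt (Suc k)}"
              using interval_unique[OF n(2), of k] by auto
            then have "indicat_real {tt k<..<tt (Suc k)} t = 0"
              by (rule indicator_simps(2))
            then show ?thesis using False by (metis mult_zero_left)
          qed
        qed
        also have "\<dots> = f t" using n t f by simp
        finally show ?thesis using True by simp
      qed
    qed
  qed
  have gm: "?g \<in> borel_measurable lebesgue"
    by (intro borel_measurable_integrable Bochner_Integration.integrable_sum gi)
  have "(\<integral>t. f t \<partial>lebesgue_on {0..T}) = (\<integral>t. indicator {0..T} t * f t \<partial>lebesgue)"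
    by (subst integral_restrict_space) auto
  also have "\<dots> = (\<integral>t. ?g t \<partial>lebesgue)"
    using ae by (intro integral_cong_AE borel_measurable_AE[OF gm ae] gm) (auto elim: eventually_mono)
  also have "\<dots> = (\<Sum>n<N. \<integral>t. indicator {tt n<..<tt (Suc n)} t * c n \<partial>lebesgue)"
    by (rule Bochner_Integration.integral_sum[OF gi])
  also have "\<dots> = (\<Sum>n<N. \<tau> * c n)"
    using tau_pos by (intro sum.cong refl) (simp add: tt_Suc)
  finally show ?thesis by (simp add: sum_distrib_left)
qed

text \<open>The definition of the state spaces says nothing about joint measurability in outcome and
  space. The finite basis expansion separates the two variables, so that linearity takes the place
  of Fubini.\<close>

lemma double_integral_Vh:
  assumes \<xi>: "l2rv M D M \<xi>" and V: "\<And>\<omega>. \<omega> \<in> space M \<Longrightarrow> \<xi> \<omega> \<in> Vh Th"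
  shows "(\<integral>x. (\<integral>\<omega>. \<xi> \<omega> x \<partial>M) \<partial>lebesgue_on D) = (\<integral>\<omega>. l2ip D (\<xi> \<omega>) (\<lambda>x. 1) \<partial>M)"
proof -
  have i: "integrable M (\<lambda>\<omega>. l2ip D b (\<xi> \<omega>))" if "b \<in> Bh" for b
    using l2rv_coordinate(3)[OF \<xi> Bh(3)[OF that]] by (simp add: l2ip_commute)
  have 1: "(\<integral>\<omega>. \<xi> \<omega> x \<partial>M) = (\<Sum>b\<in>Bh. (\<integral>\<omega>. l2ip D b (\<xi> \<omega>) \<partial>M) * b x)" for x
  proof -
    have "(\<integral>\<omega>. \<xi> \<omega> x \<partial>M) = (\<integral>\<omega>. (\<Sum>b\<in>Bh. l2ip D b (\<xi> \<omega>) * b x) \<partial>M)"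
      using Bh(5)[OF V] by (intro Bochner_Integration.integral_cong refl) metis
    then show ?thesis using i by simp
  qed
  have "(\<integral>x. (\<integral>\<omega>. \<xi> \<omega> x \<partial>M) \<partial>lebesgue_on D) = (\<Sum>b\<in>Bh. (\<integral>\<omega>. l2ip D b (\<xi> \<omega>) \<partial>M) * l2ip D b (\<lambda>x. 1))"
    unfolding 1 l2ip_def[of D _ "\<lambda>x. 1"]
    using sqint_integrable[OF D_lmeasurable Bh(3)] by simp
  also have "\<dots> = (\<integral>\<omega>. (\<Sum>b\<in>Bh. l2ip D b (\<xi> \<omega>) * l2ip D b (\<lambda>x. 1)) \<partial>M)"
    using i by simp
  also have "\<dots> = (\<integral>\<omega>. l2ip D (\<xi> \<omega>) (\<lambda>x. 1) \<partial>M)"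
  proof (intro Bochner_Integration.integral_cong refl)
    fix \<omega> assume "\<omega> \<in> space M"
    have "l2ip D (\<lambda>x. \<Sum>b\<in>Bh. l2ip D b (\<xi> \<omega>) * b x) (\<lambda>x. 1) = (\<Sum>b\<in>Bh. l2ip D b (\<xi> \<omega>) * l2ip D b (\<lambda>x. 1))"
      by (intro l2ip_sum_cmult_left Bh(3) sqint_const D_lmeasurable)
    with Bh(5)[OF V[OF \<open>\<omega> \<in> space M\<close>]]
    show "(\<Sum>b\<in>Bh. l2ip D b (\<xi> \<omega>) * l2ip D b (\<lambda>x. 1)) = l2ip D (\<xi> \<omega>) (\<lambda>x. 1)" by metis
  qed
  finally show ?thesis .
qed

lemma mean_integral_eq:
  assumes X: "Xspace M W D Th T N X" and n: "n < N" and t: "t \<in> {tt n<..<tt (Suc n)}"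
  shows "(\<integral>x. (\<integral>\<omega>. X t \<omega> x \<partial>M) \<partial>lebesgue_on D) = (\<integral>\<omega>. l2ip D (X (mid n) \<omega>) (\<lambda>x. 1) \<partial>M)"
proof -
  have r: "l2rv M D M (X t)" "l2rv M D M (X (mid n))"
    using XspaceD(1)[OF X] interval_mem[OF n t] mid_memT[OF n] l2rv_M by blast+
  have "(\<integral>x. (\<integral>\<omega>. X t \<omega> x \<partial>M) \<partial>lebesgue_on D) = (\<integral>\<omega>. l2ip D (X t \<omega>) (\<lambda>x. 1) \<partial>M)"
    using XspaceD(2)[OF X interval_mem[OF n t]] r by (intro double_integral_Vh) auto
  also have "\<dots> = (\<integral>\<omega>. l2ip D (X (mid n) \<omega>) (\<lambda>x. 1) \<partial>M)"
  proof (rule integral_cong_AE)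
    show "AE \<omega> in M. l2ip D (X t \<omega>) (\<lambda>x. 1) = l2ip D (X (mid n) \<omega>) (\<lambda>x. 1)"
      using Xspace_const_on_interval[OF X n t] by eventually_elim simp
  qed (intro l2rv_coordinate(1) r sqint_const D_lmeasurable)+
  finally show ?thesis .
qed

lemma EXint_eq:
  assumes X: "Xspace M W D Th T N X"
  shows "EXint M D T X = \<tau> * (\<Sum>n<N. \<integral>\<omega>. l2ip D (X (mid n) \<omega>) (\<lambda>x. 1) \<partial>M)"
  unfolding EXint_def by (rule integral_piecewise_const) (rule mean_integral_eq[OF X])

lemma EXint_lincomb:
  assumes X: "Xspace M W D Th T N X" and Y: "Xspace M W D Th T N Y"
  shows "EXint M D T (\<lambda>t \<omega> x. X t \<omega> x + c * Y t \<omega> x) = EXint M D T X + c * EXint M D T Y"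
proof -
  have "(\<integral>\<omega>. l2ip D (\<lambda>x. X (mid n) \<omega> x + c * Y (mid n) \<omega> x) (\<lambda>x. 1) \<partial>M)
      = (\<integral>\<omega>. l2ip D (X (mid n) \<omega>) (\<lambda>x. 1) \<partial>M) + c * (\<integral>\<omega>. l2ip D (Y (mid n) \<omega>) (\<lambda>x. 1) \<partial>M)"
    if n: "n < N" for n
  proof -
    note r = XspaceD(1)[OF X mid_memT[OF n]] XspaceD(1)[OF Y mid_memT[OF n]]
    have "(\<integral>\<omega>. l2ip D (\<lambda>x. X (mid n) \<omega> x + c * Y (mid n) \<omega> x) (\<lambda>x. 1) \<partial>M)
        = (\<integral>\<omega>. l2ip D (X (mid n) \<omega>) (\<lambda>x. 1) + c * l2ip D (Y (mid n) \<omega>) (\<lambda>x. 1) \<partial>M)"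
      using l2rv_sqint[OF r(1)] l2rv_sqint[OF r(2)]
      by (intro Bochner_Integration.integral_cong refl l2ip_lincomb sqint_const D_lmeasurable)
    also have "\<dots> = (\<integral>\<omega>. l2ip D (X (mid n) \<omega>) (\<lambda>x. 1) \<partial>M) + c * (\<integral>\<omega>. l2ip D (Y (mid n) \<omega>) (\<lambda>x. 1) \<partial>M)"
      using l2rv_coordinate(3)[OF l2rv_M[OF r(1)] sqint_const[OF D_lmeasurable, of 1]]
        l2rv_coordinate(3)[OF l2rv_M[OF r(2)] sqint_const[OF D_lmeasurable, of 1]] by simp
    finally show ?thesis .
  qed
  then show ?thesis
    unfolding EXint_eq[OF X] EXint_eq[OF Y] EXint_eq[OF Xspace_lincomb[OF X Y]]
    by (simp add: sum.distrib sum_distrib_left algebra_simps)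
qed

section \<open>The scheme, its solutions and admissible directions\<close>

text \<open>The source is a parameter: it is the noise for states and zero for their differences,
  and linear combinations treat both at once.\<close>

definition scheme :: "(real \<Rightarrow> 'w \<Rightarrow> 'x \<Rightarrow> real) \<Rightarrow> (real \<Rightarrow> 'w \<Rightarrow> 'x \<Rightarrow> real) \<Rightarrow> (nat \<Rightarrow> 'w \<Rightarrow> 'x \<Rightarrow> real) \<Rightarrow> bool" where
  "scheme X U s \<longleftrightarrow> (\<forall>n<N. \<forall>\<omega>\<in>space M.
     (\<lambda>x. X (tt (Suc n)) \<omega> x - X (tt n) \<omega> x) =
     (\<lambda>x. \<tau> * (Laph D Th (X (tt (Suc n)) \<omega>) x + U (tt n) \<omega> x) + s n \<omega> x))"

lemma scheme_lincomb:
  assumes X: "Xspace M W D Th T N X" and Y: "Xspace M W D Th T N Y"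
    and "scheme X U s" "scheme Y V r"
  shows "scheme (\<lambda>t \<omega> x. X t \<omega> x + c * Y t \<omega> x) (\<lambda>t \<omega> x. U t \<omega> x + c * V t \<omega> x) (\<lambda>n \<omega> x. s n \<omega> x + c * r n \<omega> x)"
  unfolding scheme_def
proof (intro allI impI ballI ext)
  fix n \<omega> x assume n: "n < N" and \<omega>: "\<omega> \<in> space M"
  have S: "tt (Suc n) \<in> {0..T}" using n tt_mem by simp
  note v = XspaceD(2)[OF X S \<omega>] XspaceD(2)[OF Y S \<omega>]
  have 1: "X (tt (Suc n)) \<omega> x - X (tt n) \<omega> x = \<tau> * (Laph D Th (X (tt (Suc n)) \<omega>) x + U (tt n) \<omega> x) + s n \<omega> x"
    using assms(3) n \<omega> unfolding scheme_def by metis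
  have 2: "Y (tt (Suc n)) \<omega> x - Y (tt n) \<omega> x = \<tau> * (Laph D Th (Y (tt (Suc n)) \<omega>) x + V (tt n) \<omega> x) + r n \<omega> x"
    using assms(4) n \<omega> unfolding scheme_def by metis
  have L: "Laph D Th (\<lambda>x. X (tt (Suc n)) \<omega> x + c * Y (tt (Suc n)) \<omega> x) x
      = Laph D Th (X (tt (Suc n)) \<omega>) x + c * Laph D Th (Y (tt (Suc n)) \<omega>) x"
    by (simp add: Laph_add v Vh_cmult Laph_cmult)
  have "X (tt (Suc n)) \<omega> x + c * Y (tt (Suc n)) \<omega> x - (X (tt n) \<omega> x + c * Y (tt n) \<omega> x)
      = (X (tt (Suc n)) \<omega> x - X (tt n) \<omega> x) + c * (Y (tt (Suc n)) \<omega> x - Y (tt n) \<omega> x)"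
    by (simp add: algebra_simps)
  then show "X (tt (Suc n)) \<omega> x + c * Y (tt (Suc n)) \<omega> x - (X (tt n) \<omega> x + c * Y (tt n) \<omega> x)
      = \<tau> * (Laph D Th (\<lambda>x. X (tt (Suc n)) \<omega> x + c * Y (tt (Suc n)) \<omega> x) x + (U (tt n) \<omega> x + c * V (tt n) \<omega> x))
        + (s n \<omega> x + c * r n \<omega> x)"
    unfolding 1 2 L by (simp add: algebra_simps)
qed

abbreviation noise :: "(real \<Rightarrow> 'w \<Rightarrow> 'x \<Rightarrow> real) \<Rightarrow> nat \<Rightarrow> 'w \<Rightarrow> 'x \<Rightarrow> real" where
  "noise \<sigma> \<equiv> (\<lambda>n \<omega> x. Pih D Th (\<sigma> (tt n) \<omega>) x * (W (tt (Suc n)) \<omega> - W (tt n) \<omega>))"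

lemma state_iff: "state M W D Th T N X0 \<sigma> U X \<longleftrightarrow>
    Xspace M W D Th T N X \<and> (\<forall>\<omega>\<in>space M. X 0 \<omega> = Pih D Th X0) \<and> scheme X U (noise \<sigma>)"
  by (simp add: state_def scheme_def)

text \<open>The linear space of differences of admissible pairs. A direction carries its state
  perturbation along with the control, so the solution operator of the scheme never has to be
  formed.\<close>

definition direction :: "(real \<Rightarrow> 'w \<Rightarrow> 'x \<Rightarrow> real) \<Rightarrow> (real \<Rightarrow> 'w \<Rightarrow> 'x \<Rightarrow> real) \<Rightarrow> bool" where
  "direction E V \<longleftrightarrow> Xspace M W D Th T N E \<and> Uspace M W D Th T N V \<and>
     (\<forall>\<omega>\<in>space M. E 0 \<omega> = (\<lambda>x. 0)) \<and> scheme E V (\<lambda>n \<omega> x. 0)"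

lemma direction_state_diff:
  assumes "Uspace M W D Th T N U" "state M W D Th T N X0 \<sigma> U X"
    and "Uspace M W D Th T N U'" "state M W D Th T N X0 \<sigma> U' X'"
  shows "direction (\<lambda>t \<omega> x. X' t \<omega> x + (-1) * X t \<omega> x) (\<lambda>t \<omega> x. U' t \<omega> x + (-1) * U t \<omega> x)"
  using assms scheme_lincomb[of X' X U' "noise \<sigma>" U "noise \<sigma>" "-1"]
  unfolding direction_def state_iff
  by (intro conjI Xspace_lincomb Uspace_lincomb) auto

lemma direction_lincomb:
  assumes "direction E V" "direction E' V'"
  shows "direction (\<lambda>t \<omega> x. E t \<omega> x + c * E' t \<omega> x) (\<lambda>t \<omega> x. V t \<omega> x + c * V' t \<omega> x)"
  using assms scheme_lincomb[of E E' V "\<lambda>n \<omega> x. 0" V' "\<lambda>n \<omega> x. 0" c]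
  unfolding direction_def by (intro conjI Xspace_lincomb Uspace_lincomb) auto

lemma state_add_direction:
  assumes "state M W D Th T N X0 \<sigma> U X" "direction E V"
  shows "state M W D Th T N X0 \<sigma> (\<lambda>t \<omega> x. U t \<omega> x + c * V t \<omega> x) (\<lambda>t \<omega> x. X t \<omega> x + c * E t \<omega> x)"
  using assms scheme_lincomb[of X E U "noise \<sigma>" V "\<lambda>n \<omega> x. 0" c]
  unfolding direction_def state_iff by (intro conjI Xspace_lincomb) auto

section \<open>Expansion of the cost functional\<close>

text \<open>Throughout one open interval the choice in \<open>Xdtil\<close> is made from the same
  predicate, so the chosen target does not depend on the time within it.\<close>

definition Xdc :: "(real \<Rightarrow> 'w \<Rightarrow> 'x \<Rightarrow> real) \<Rightarrow> nat \<Rightarrow> 'w \<Rightarrow> 'x \<Rightarrow> real" where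
  "Xdc Xd n = (SOME \<eta>. cexpL2 M D (F n) (Xd (tt (Suc n))) \<eta>)"

lemma Xdtil_eq: "t \<in> {tt n<..<tt (Suc n)} \<Longrightarrow> Xdtil M W D T N Xd t = Xdc Xd n"
  unfolding Xdtil_def Xdc_def Let_def using interval_index[of t n] not_grid[of t n] by auto

lemma Xdc:
  assumes Xd: "adapted_L2 M W D T Xd" and n: "n < N"
  shows "cexpL2 M D (F n) (Xd (tt (Suc n))) (Xdc Xd n)" "l2rv M D (F n) (Xdc Xd n)"
proof -
  have "tt (Suc n) \<in> {0..T}" using n by (intro tt_mem) simp
  with Xd have r: "l2rv M D M (Xd (tt (Suc n)))"
    unfolding adapted_L2_iff by (blast intro: l2rv_M)
  show c: "cexpL2 M D (F n) (Xd (tt (Suc n))) (Xdc Xd n)"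
    unfolding Xdc_def by (rule someI_ex[OF cexpL2_exists[OF F_sub r]])
  show "l2rv M D (F n) (Xdc Xd n)"
    by (rule cexpL2_l2rv[OF F_sub r c])
qed

definition resid :: "(real \<Rightarrow> 'w \<Rightarrow> 'x \<Rightarrow> real) \<Rightarrow> (real \<Rightarrow> 'w \<Rightarrow> 'x \<Rightarrow> real) \<Rightarrow> nat \<Rightarrow> 'w \<Rightarrow> 'x \<Rightarrow> real" where
  "resid Xd X n = (\<lambda>\<omega> x. X (mid n) \<omega> x - Xdc Xd n \<omega> x)"

lemma resid_l2rv:
  assumes "adapted_L2 M W D T Xd" "Xspace M W D Th T N X" "n < N"
  shows "l2rv M D M (resid Xd X n)"
  unfolding resid_def
  using l2rv_M[OF XspaceD(1)[OF assms(2) mid_memT[OF assms(3)]]] l2rv_M[OF Xdc(2)[OF assms(1,3)]]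
  by (intro l2rv_diff subalgebra_refl)

lemma Uspace_l2rv: "Uspace M W D Th T N U \<Longrightarrow> n \<le> N \<Longrightarrow> l2rv M D M (U (tt n))"
  using UspaceD(1)[OF _ tt_mem] l2rv_M by blast

lemma Xspace_l2rv: "Xspace M W D Th T N X \<Longrightarrow> n < N \<Longrightarrow> l2rv M D M (X (mid n))"
  using XspaceD(1)[OF _ mid_memT] l2rv_M by blast

lemma normsq_integrable: "l2rv M D M \<xi> \<Longrightarrow> integrable M (\<lambda>\<omega>. normsq D (\<xi> \<omega>))"
  by (simp add: l2rv_def)

lemma Jcost_eq:
  assumes Xd: "adapted_L2 M W D T Xd" and X: "Xspace M W D Th T N X" and U: "Uspace M W D Th T N U"
  shows "Jcost M W D T N \<alpha> Xd X U = 1 / 2 * (\<tau> * (\<Sum>n<N.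
     (\<integral>\<omega>. normsq D (resid Xd X n \<omega>) \<partial>M) + \<alpha> * (\<integral>\<omega>. normsq D (U (tt n) \<omega>) \<partial>M)))"
  unfolding Jcost_def
proof (rule arg_cong[where f="\<lambda>x. 1/2 * x"], rule integral_piecewise_const)
  fix n t assume n: "n < N" and t: "t \<in> {tt n<..<tt (Suc n)}"
  note tT = interval_mem[OF n t]
  have t': "t \<in> {tt n..<tt (Suc n)}" using t by auto
  have r1: "l2rv M D M (\<lambda>\<omega> x. X t \<omega> x - Xdc Xd n \<omega> x)"
    using l2rv_M[OF XspaceD(1)[OF X tT]] l2rv_M[OF Xdc(2)[OF Xd n]] by (intro l2rv_diff subalgebra_refl)
  have r2: "l2rv M D M (U t)" by (rule l2rv_M[OF UspaceD(1)[OF U tT]])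
  have r3: "l2rv M D M (resid Xd X n)" by (rule resid_l2rv[OF Xd X n])
  have r4: "l2rv M D M (U (tt n))" using n by (intro Uspace_l2rv[OF U]) simp
  have "(\<integral>\<omega>. normsq D (\<lambda>x. X t \<omega> x - Xdtil M W D T N Xd t \<omega> x) + \<alpha> * normsq D (U t \<omega>) \<partial>M)
      = (\<integral>\<omega>. normsq D (\<lambda>x. X t \<omega> x - Xdc Xd n \<omega> x) + \<alpha> * normsq D (U t \<omega>) \<partial>M)"
    by (simp add: Xdtil_eq[OF t])
  also have "\<dots> = (\<integral>\<omega>. normsq D (resid Xd X n \<omega>) + \<alpha> * normsq D (U (tt n) \<omega>) \<partial>M)"
  proof (rule integral_cong_AE)
    show "AE \<omega> in M. normsq D (\<lambda>x. X t \<omega> x - Xdc Xd n \<omega> x) + \<alpha> * normsq D (U t \<omega>)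
        = normsq D (resid Xd X n \<omega>) + \<alpha> * normsq D (U (tt n) \<omega>)"
      using Xspace_const_on_interval[OF X n t] AE_space
    proof eventually_elim
      case (elim \<omega>)
      then show ?case using UspaceD(3)[OF U n t' elim(2)] by (simp add: resid_def)
    qed
  qed (intro borel_measurable_add borel_measurable_times borel_measurable_const
        borel_measurable_integrable normsq_integrable r1 r2 r3 r4)+
  also have "\<dots> = (\<integral>\<omega>. normsq D (resid Xd X n \<omega>) \<partial>M) + \<alpha> * (\<integral>\<omega>. normsq D (U (tt n) \<omega>) \<partial>M)"
    using normsq_integrable[OF r3] normsq_integrable[OF r4] by simp
  finally show "(\<integral>\<omega>. normsq D (\<lambda>x. X t \<omega> x - Xdtil M W D T N Xd t \<omega> x) + \<alpha> * normsq D (U t \<omega>) \<partial>M)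
      = (\<integral>\<omega>. normsq D (resid Xd X n \<omega>) \<partial>M) + \<alpha> * (\<integral>\<omega>. normsq D (U (tt n) \<omega>) \<partial>M)" .
qed

text \<open>The Gateaux derivative of the cost at \<open>(X, U)\<close> along \<open>(E, V)\<close>:
  the factor 1/2 of the cost cancels the 2 of the cross terms.\<close>

definition dJ where
  "dJ \<alpha> Xd X U E V = \<tau> * (\<Sum>n<N. (\<integral>\<omega>. l2ip D (E (mid n) \<omega>) (resid Xd X n \<omega>) \<partial>M)
      + \<alpha> * (\<integral>\<omega>. l2ip D (V (tt n) \<omega>) (U (tt n) \<omega>) \<partial>M))"

lemma integral_normsq_lincomb:
  assumes \<xi>: "l2rv M D M \<xi>" and \<zeta>: "l2rv M D M \<zeta>"
  shows "(\<integral>\<omega>. normsq D (\<lambda>x. \<xi> \<omega> x + c * \<zeta> \<omega> x) \<partial>M) = (\<integral>\<omega>. normsq D (\<xi> \<omega>) \<partial>M)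
     + 2 * c * (\<integral>\<omega>. l2ip D (\<zeta> \<omega>) (\<xi> \<omega>) \<partial>M) + c\<^sup>2 * (\<integral>\<omega>. normsq D (\<zeta> \<omega>) \<partial>M)"
proof -
  have "(\<integral>\<omega>. normsq D (\<lambda>x. \<xi> \<omega> x + c * \<zeta> \<omega> x) \<partial>M)
      = (\<integral>\<omega>. normsq D (\<xi> \<omega>) + 2 * c * l2ip D (\<zeta> \<omega>) (\<xi> \<omega>) + c\<^sup>2 * normsq D (\<zeta> \<omega>) \<partial>M)"
  proof (intro Bochner_Integration.integral_cong refl)
    fix \<omega> assume "\<omega> \<in> space M"
    note s = l2rv_sqint[OF \<xi> this] l2rv_sqint[OF \<zeta> this]
    have "l2ip D (\<xi> \<omega>) (\<lambda>x. c * \<zeta> \<omega> x) = c * l2ip D (\<zeta> \<omega>) (\<xi> \<omega>)"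
      by (subst l2ip_commute) (rule l2ip_cmult_left)
    then show "normsq D (\<lambda>x. \<xi> \<omega> x + c * \<zeta> \<omega> x)
        = normsq D (\<xi> \<omega>) + 2 * c * l2ip D (\<zeta> \<omega>) (\<xi> \<omega>) + c\<^sup>2 * normsq D (\<zeta> \<omega>)"
      by (simp add: normsq_add[OF s(1) sqint_cmult[OF s(2)]] normsq_cmult)
  qed
  then show ?thesis
    using normsq_integrable[OF \<xi>] normsq_integrable[OF \<zeta>] l2rv_l2ip_integrable[OF \<zeta> \<xi>] by simp
qed

lemma Jcost_expansion:
  assumes Xd: "adapted_L2 M W D T Xd" and X: "Xspace M W D Th T N X" and U: "Uspace M W D Th T N U"
    and E: "Xspace M W D Th T N E" and V: "Uspace M W D Th T N V"
  obtains q where "\<And>c. Jcost M W D T N \<alpha> Xd (\<lambda>t \<omega> x. X t \<omega> x + c * E t \<omega> x) (\<lambda>t \<omega> x. U t \<omega> x + c * V t \<omega> x)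
    = Jcost M W D T N \<alpha> Xd X U + c * dJ \<alpha> Xd X U E V + c\<^sup>2 * q"
proof
  fix c
  have 1: "(\<integral>\<omega>. normsq D (resid Xd (\<lambda>t \<omega> x. X t \<omega> x + c * E t \<omega> x) n \<omega>) \<partial>M)
     = (\<integral>\<omega>. normsq D (resid Xd X n \<omega>) \<partial>M)
       + 2 * c * (\<integral>\<omega>. l2ip D (E (mid n) \<omega>) (resid Xd X n \<omega>) \<partial>M) + c\<^sup>2 * (\<integral>\<omega>. normsq D (E (mid n) \<omega>) \<partial>M)"
    if n: "n < N" for n
  proof -
    have "resid Xd (\<lambda>t \<omega> x. X t \<omega> x + c * E t \<omega> x) n = (\<lambda>\<omega> x. resid Xd X n \<omega> x + c * E (mid n) \<omega> x)"
      by (simp add: resid_def algebra_simps)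
    then show ?thesis
      using integral_normsq_lincomb[OF resid_l2rv[OF Xd X n] Xspace_l2rv[OF E n], of c] by simp
  qed
  have 2: "(\<integral>\<omega>. normsq D (\<lambda>x. U (tt n) \<omega> x + c * V (tt n) \<omega> x) \<partial>M) = (\<integral>\<omega>. normsq D (U (tt n) \<omega>) \<partial>M)
     + 2 * c * (\<integral>\<omega>. l2ip D (V (tt n) \<omega>) (U (tt n) \<omega>) \<partial>M) + c\<^sup>2 * (\<integral>\<omega>. normsq D (V (tt n) \<omega>) \<partial>M)" if n: "n < N" for n
    using n by (intro integral_normsq_lincomb Uspace_l2rv[OF U] Uspace_l2rv[OF V]) auto
  define a b d where
    "a n = (\<integral>\<omega>. normsq D (resid Xd X n \<omega>) \<partial>M) + \<alpha> * (\<integral>\<omega>. normsq D (U (tt n) \<omega>) \<partial>M)" and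
    "b n = (\<integral>\<omega>. l2ip D (E (mid n) \<omega>) (resid Xd X n \<omega>) \<partial>M) + \<alpha> * (\<integral>\<omega>. l2ip D (V (tt n) \<omega>) (U (tt n) \<omega>) \<partial>M)" and
    "d n = (\<integral>\<omega>. normsq D (E (mid n) \<omega>) \<partial>M) + \<alpha> * (\<integral>\<omega>. normsq D (V (tt n) \<omega>) \<partial>M)" for n
  have "(\<Sum>n<N. (\<integral>\<omega>. normsq D (resid Xd (\<lambda>t \<omega> x. X t \<omega> x + c * E t \<omega> x) n \<omega>) \<partial>M)
      + \<alpha> * (\<integral>\<omega>. normsq D (\<lambda>x. U (tt n) \<omega> x + c * V (tt n) \<omega> x) \<partial>M))
    = (\<Sum>n<N. a n + 2 * c * b n + c\<^sup>2 * d n)"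
    by (intro sum.cong refl) (simp add: 1 2 a_def b_def d_def algebra_simps)
  also have "\<dots> = (\<Sum>n<N. a n) + 2 * c * (\<Sum>n<N. b n) + c\<^sup>2 * (\<Sum>n<N. d n)"
    by (simp add: sum.distrib sum_distrib_left)
  finally show "Jcost M W D T N \<alpha> Xd (\<lambda>t \<omega> x. X t \<omega> x + c * E t \<omega> x) (\<lambda>t \<omega> x. U t \<omega> x + c * V t \<omega> x)
    = Jcost M W D T N \<alpha> Xd X U + c * dJ \<alpha> Xd X U E V
      + c\<^sup>2 * (\<tau> / 2 * (\<Sum>n<N. (\<integral>\<omega>. normsq D (E (mid n) \<omega>) \<partial>M) + \<alpha> * (\<integral>\<omega>. normsq D (V (tt n) \<omega>) \<partial>M)))"
    unfolding Jcost_eq[OF Xd X U] Jcost_eq[OF Xd Xspace_lincomb[OF X E] Uspace_lincomb[OF U V]] dJ_def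
      a_def[symmetric] b_def[symmetric] d_def[symmetric]
    by (simp add: algebra_simps)
qed

lemma integral_l2ip_lincomb:
  assumes \<xi>: "l2rv M D M \<xi>" and \<zeta>: "l2rv M D M \<zeta>" and \<theta>: "l2rv M D M \<theta>"
  shows "(\<integral>\<omega>. l2ip D (\<lambda>x. \<xi> \<omega> x + c * \<zeta> \<omega> x) (\<theta> \<omega>) \<partial>M)
     = (\<integral>\<omega>. l2ip D (\<xi> \<omega>) (\<theta> \<omega>) \<partial>M) + c * (\<integral>\<omega>. l2ip D (\<zeta> \<omega>) (\<theta> \<omega>) \<partial>M)"
proof -
  have "(\<integral>\<omega>. l2ip D (\<lambda>x. \<xi> \<omega> x + c * \<zeta> \<omega> x) (\<theta> \<omega>) \<partial>M)
      = (\<integral>\<omega>. l2ip D (\<xi> \<omega>) (\<theta> \<omega>) + c * l2ip D (\<zeta> \<omega>) (\<theta> \<omega>) \<partial>M)"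
    using l2rv_sqint[OF \<xi>] l2rv_sqint[OF \<zeta>] l2rv_sqint[OF \<theta>]
    by (intro Bochner_Integration.integral_cong refl l2ip_lincomb)
  then show ?thesis
    using l2rv_l2ip_integrable[OF \<xi> \<theta>] l2rv_l2ip_integrable[OF \<zeta> \<theta>] by simp
qed

lemma dJ_lincomb:
  assumes Xd: "adapted_L2 M W D T Xd" and X: "Xspace M W D Th T N X" and U: "Uspace M W D Th T N U"
    and E: "Xspace M W D Th T N E" and V: "Uspace M W D Th T N V"
    and E': "Xspace M W D Th T N E'" and V': "Uspace M W D Th T N V'"
  shows "dJ \<alpha> Xd X U (\<lambda>t \<omega> x. E t \<omega> x + c * E' t \<omega> x) (\<lambda>t \<omega> x. V t \<omega> x + c * V' t \<omega> x)
    = dJ \<alpha> Xd X U E V + c * dJ \<alpha> Xd X U E' V'"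
proof -
  have "(\<integral>\<omega>. l2ip D (\<lambda>x. E (mid n) \<omega> x + c * E' (mid n) \<omega> x) (resid Xd X n \<omega>) \<partial>M)
     = (\<integral>\<omega>. l2ip D (E (mid n) \<omega>) (resid Xd X n \<omega>) \<partial>M) + c * (\<integral>\<omega>. l2ip D (E' (mid n) \<omega>) (resid Xd X n \<omega>) \<partial>M)"
    "(\<integral>\<omega>. l2ip D (\<lambda>x. V (tt n) \<omega> x + c * V' (tt n) \<omega> x) (U (tt n) \<omega>) \<partial>M)
     = (\<integral>\<omega>. l2ip D (V (tt n) \<omega>) (U (tt n) \<omega>) \<partial>M) + c * (\<integral>\<omega>. l2ip D (V' (tt n) \<omega>) (U (tt n) \<omega>) \<partial>M)"
    if n: "n < N" for n
    using n by (intro integral_l2ip_lincomb resid_l2rv[OF Xd X n] Xspace_l2rv[OF E n] Xspace_l2rv[OF E' n]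
      Uspace_l2rv[OF U] Uspace_l2rv[OF V] Uspace_l2rv[OF V']; simp)+
  note L = this
  define b b' where
    "b n = (\<integral>\<omega>. l2ip D (E (mid n) \<omega>) (resid Xd X n \<omega>) \<partial>M) + \<alpha> * (\<integral>\<omega>. l2ip D (V (tt n) \<omega>) (U (tt n) \<omega>) \<partial>M)" and
    "b' n = (\<integral>\<omega>. l2ip D (E' (mid n) \<omega>) (resid Xd X n \<omega>) \<partial>M) + \<alpha> * (\<integral>\<omega>. l2ip D (V' (tt n) \<omega>) (U (tt n) \<omega>) \<partial>M)" for n
  have "(\<Sum>n<N. (\<integral>\<omega>. l2ip D (\<lambda>x. E (mid n) \<omega> x + c * E' (mid n) \<omega> x) (resid Xd X n \<omega>) \<partial>M)
      + \<alpha> * (\<integral>\<omega>. l2ip D (\<lambda>x. V (tt n) \<omega> x + c * V' (tt n) \<omega> x) (U (tt n) \<omega>) \<partial>M)) = (\<Sum>n<N. b n + c * b' n)"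
    by (intro sum.cong refl) (simp add: L b_def b'_def algebra_simps)
  then show ?thesis
    unfolding dJ_def b_def[symmetric] b'_def[symmetric]
    by (simp add: sum.distrib sum_distrib_left[symmetric] algebra_simps)
qed

section \<open>Elementary directions\<close>

text \<open>The state perturbation is prescribed, \<open>1\<^sub>A \<phi>\<close> on one time interval, and the control is read off
  the scheme; it is adapted because \<open>A\<close> belongs to the past of the left endpoint.\<close>

definition elemX :: "nat \<Rightarrow> 'w set \<Rightarrow> ('x \<Rightarrow> real) \<Rightarrow> real \<Rightarrow> 'w \<Rightarrow> 'x \<Rightarrow> real" where
  "elemX n A \<phi> t = (if t \<in> {tt n<..tt (Suc n)} then (\<lambda>\<omega> x. indicator A \<omega> * \<phi> x) else (\<lambda>\<omega> x. 0))"

text \<open>On the first interval the state jumps from 0 to \<open>1\<^sub>A \<phi>\<close>, on the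
  next it returns to 0; solving the scheme for the control gives the two values. The Laplacian is
  evaluated at the new state, so it appears only in the first. For \<open>n = N - 1\<close> the
  second value occurs at time \<open>T\<close> alone and affects neither scheme nor cost.\<close>

definition elemU :: "nat \<Rightarrow> 'w set \<Rightarrow> ('x \<Rightarrow> real) \<Rightarrow> real \<Rightarrow> 'w \<Rightarrow> 'x \<Rightarrow> real" where
  "elemU n A \<phi> t = (if t \<in> {tt n..<tt (Suc n)} then (\<lambda>\<omega> x. indicator A \<omega> * (1 / \<tau> * \<phi> x - Laph D Th \<phi> x))
     else if t \<in> {tt (Suc n)..<tt (Suc (Suc n))} then (\<lambda>\<omega> x. indicator A \<omega> * (- 1 / \<tau> * \<phi> x))
     else (\<lambda>\<omega> x. 0))"

lemma elemX_interval: "t \<in> {tt k<..<tt (Suc k)} \<Longrightarrow> elemX n A \<phi> t = elemX n A \<phi> (tt (Suc k))"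
proof -
  assume t: "t \<in> {tt k<..<tt (Suc k)}"
  have "t \<in> {tt n<..tt (Suc n)} \<longleftrightarrow> tt (Suc k) \<in> {tt n<..tt (Suc n)}"
  proof
    assume *: "t \<in> {tt n<..tt (Suc n)}"
    have "tt n < t" "t \<le> tt (Suc n)" "tt k < t" "t < tt (Suc k)" using * t by auto
    then have "tt n < tt (Suc k)" "tt k < tt (Suc n)" by linarith+
    then have "k = n" by simp
    then show "tt (Suc k) \<in> {tt n<..tt (Suc n)}" by simp
  next
    assume "tt (Suc k) \<in> {tt n<..tt (Suc n)}"
    then have "k = n" by simp
    then show "t \<in> {tt n<..tt (Suc n)}" using t by auto
  qed
  then show ?thesis by (simp only: elemX_def)
qed

lemma elemX_grid: "elemX n A \<phi> (tt (Suc k)) = (if k = n then (\<lambda>\<omega> x. indicator A \<omega> * \<phi> x) else (\<lambda>\<omega> x. 0))"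
proof -
  have "tt (Suc k) \<in> {tt n<..tt (Suc n)} \<longleftrightarrow> k = n" by auto
  then show ?thesis by (simp only: elemX_def)
qed

lemma elemX_0: "elemX n A \<phi> 0 = (\<lambda>\<omega> x. 0)"
  using tt_nonneg[of n] by (simp add: elemX_def)

lemma elemU_grid: "elemU n A \<phi> (tt k) = (if k = n then (\<lambda>\<omega> x. indicator A \<omega> * (1 / \<tau> * \<phi> x - Laph D Th \<phi> x))
     else if k = Suc n then (\<lambda>\<omega> x. indicator A \<omega> * (- 1 / \<tau> * \<phi> x)) else (\<lambda>\<omega> x. 0))"
proof -
  have "tt k \<in> {tt n..<tt (Suc n)} \<longleftrightarrow> k = n" "tt k \<in> {tt (Suc n)..<tt (Suc (Suc n))} \<longleftrightarrow> k = Suc n" by auto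
  then show ?thesis by (simp only: elemU_def)
qed

lemma elemU_interval:
  assumes "t \<in> {tt k..<tt (Suc k)}"
  shows "elemU n A \<phi> t = elemU n A \<phi> (tt k)"
proof -
  have "t \<in> {tt m..<tt (Suc m)} \<longleftrightarrow> tt k \<in> {tt m..<tt (Suc m)}" for m
  proof
    assume "t \<in> {tt m..<tt (Suc m)}"
    then have "m = k" by (rule interval_unique[OF assms])
    then show "tt k \<in> {tt m..<tt (Suc m)}" by simp
  next
    assume "tt k \<in> {tt m..<tt (Suc m)}"
    then have "m = k" by auto
    then show "t \<in> {tt m..<tt (Suc m)}" using assms by simp
  qed
  then show ?thesis by (simp only: elemU_def)
qed

lemma l2rv_indicator_const:
  assumes "A \<in> sets (F n)" "tt n \<le> t" "\<phi> \<in> Vh Th"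
  shows "l2rv M D (natfilt M W t) (\<lambda>\<omega> x. indicator A \<omega> * \<phi> x)"
proof (rule l2rv_indicator[OF F_sub])
  show "A \<in> sets (natfilt M W t)"
    using natfilt_mono[OF assms(2)] assms(1) by (auto simp: subalgebra_def)
qed (intro l2rv_const Vh_sqint assms)

text \<open>The perturbation has the same value inside the interval and at its right end, and is
  known at the left end. It is thus its own conditional expectation, as membership in the state
  space requires.\<close>

lemma direction_elem:
  assumes n: "n < N" and A: "A \<in> sets (F n)" and \<phi>: "\<phi> \<in> Vh Th"
  shows "direction (elemX n A \<phi>) (elemU n A \<phi>)"
  unfolding direction_def
proof (intro conjI)
  have L: "Laph D Th \<phi> \<in> Vh Th" by (rule Laph(1)[OF \<phi>])
  have \<psi>: "(\<lambda>x. 1 / \<tau> * \<phi> x - Laph D Th \<phi> x) \<in> Vh Th" "(\<lambda>x. - 1 / \<tau> * \<phi> x) \<in> Vh Th"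
    by (intro Vh_diff Vh_cmult \<phi> L)+
  show "Xspace M W D Th T N (elemX n A \<phi>)"
    unfolding Xspace_def adapted_L2_iff
  proof (intro conjI ballI allI impI)
    fix t assume "t \<in> {0..T}"
    show "l2rv M D (natfilt M W t) (elemX n A \<phi> t)"
      unfolding elemX_def by (auto intro!: l2rv_indicator_const[OF A _ \<phi>] l2rv_zero)
    fix \<omega>
    show "elemX n A \<phi> t \<omega> \<in> Vh Th"
      unfolding elemX_def by (auto intro!: Vh_cmult \<phi> Vh_zero)
  next
    fix k t assume k: "k < N" and t: "t \<in> {tt k<..<tt (Suc k)}"
    interpret sigma_finite_subalgebra M "F k" by (rule subalg_sigma_finite[OF F_sub])
    have r: "l2rv M D (F k) (elemX n A \<phi> (tt (Suc k)))"
      unfolding elemX_grid using l2rv_indicator_const[OF A order_refl \<phi>] l2rv_zero by auto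
    show "cexpVh M D Th (F k) (elemX n A \<phi> (tt (Suc k))) (elemX n A \<phi> t)"
      unfolding cexpVh_def elemX_interval[OF t]
    proof
      fix \<theta> assume "\<theta> \<in> Vh Th"
      then have \<theta>: "sqint D \<theta>" by (rule Vh_sqint)
      have "AE \<omega> in M. real_cond_exp M (F k) (\<lambda>\<omega>. l2ip D (elemX n A \<phi> (tt (Suc k)) \<omega>) \<theta>) \<omega>
          = l2ip D (elemX n A \<phi> (tt (Suc k)) \<omega>) \<theta>"
        using r \<theta> l2rv_coordinate(3)[OF l2rv_M[OF r] \<theta>]
        by (intro real_cond_exp_F_meas) (auto simp: l2rv_def wmeas_def)
      then show "AE \<omega> in M. l2ip D (elemX n A \<phi> (tt (Suc k)) \<omega>) \<theta>
          = real_cond_exp M (F k) (\<lambda>\<omega>. l2ip D (elemX n A \<phi> (tt (Suc k)) \<omega>) \<theta>) \<omega>"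
        by eventually_elim simp
    qed
  qed
  show "Uspace M W D Th T N (elemU n A \<phi>)"
    unfolding Uspace_def adapted_L2_iff
  proof (intro conjI ballI allI impI)
    fix t assume "t \<in> {0..T}"
    have le: "tt n \<le> t" if "tt (Suc n) \<le> t" using that tt_le_iff[of n "Suc n"] by linarith
    consider "t \<in> {tt n..<tt (Suc n)}" | "t \<notin> {tt n..<tt (Suc n)}" "t \<in> {tt (Suc n)..<tt (Suc (Suc n))}"
      | "t \<notin> {tt n..<tt (Suc n)}" "t \<notin> {tt (Suc n)..<tt (Suc (Suc n))}" by blast
    then have "l2rv M D (natfilt M W t) (elemU n A \<phi> t) \<and> (\<forall>\<omega>. elemU n A \<phi> t \<omega> \<in> Vh Th)"
    proof cases
      case 1
      show ?thesis
        unfolding elemU_def if_P[OF 1] using 1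
        by (intro conjI allI l2rv_indicator_const[OF A _ \<psi>(1)] Vh_cmult[OF \<psi>(1)]) simp
    next
      case 2
      show ?thesis
        unfolding elemU_def if_not_P[OF 2(1)] if_P[OF 2(2)] using 2(2) le
        by (intro conjI allI l2rv_indicator_const[OF A _ \<psi>(2)] Vh_cmult[OF \<psi>(2)]) simp
    next
      case 3
      show ?thesis
        unfolding elemU_def if_not_P[OF 3(1)] if_not_P[OF 3(2)] by (intro conjI allI l2rv_zero Vh_zero)
    qed
    then show "l2rv M D (natfilt M W t) (elemU n A \<phi> t)" "elemU n A \<phi> t \<omega> \<in> Vh Th" for \<omega>
      by auto
  next
    fix k t \<omega> assume "t \<in> {tt k..<tt (Suc k)}"
    then show "elemU n A \<phi> t \<omega> = elemU n A \<phi> (tt k) \<omega>" by (simp only: elemU_interval)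
  qed
  show "\<forall>\<omega>\<in>space M. elemX n A \<phi> 0 \<omega> = (\<lambda>x. 0)" by (simp add: elemX_0)
  show "scheme (elemX n A \<phi>) (elemU n A \<phi>) (\<lambda>n \<omega> x. 0)"
    unfolding scheme_def
  proof (intro allI impI ballI ext)
    fix k \<omega> x
    have L0: "Laph D Th (\<lambda>x. 0) = (\<lambda>x. 0)" using Laph_cmult[OF \<phi>, of 0] by simp
    have L1: "Laph D Th (\<lambda>x. indicator A \<omega> * \<phi> x) = (\<lambda>x. indicator A \<omega> * Laph D Th \<phi> x)"
      by (rule Laph_cmult[OF \<phi>])
    have X: "elemX n A \<phi> (tt k) \<omega> x = (if k = Suc n then indicator A \<omega> * \<phi> x else 0)" for k
      by (cases k) (simp_all add: elemX_0 elemX_grid)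
    consider "k = n" | "k = Suc n" | "k \<noteq> n" "k \<noteq> Suc n" by blast
    then show "elemX n A \<phi> (tt (Suc k)) \<omega> x - elemX n A \<phi> (tt k) \<omega> x
        = \<tau> * (Laph D Th (elemX n A \<phi> (tt (Suc k)) \<omega>) x + elemU n A \<phi> (tt k) \<omega> x) + 0"
    proof cases
      case 1
      then show ?thesis
        using T_pos N_pos by (simp add: X elemX_grid elemU_grid L1) (simp add: field_simps)
    next
      case 2
      then show ?thesis
        using T_pos N_pos by (simp add: X elemX_grid elemU_grid L0)
    next
      case 3
      then show ?thesis
        by (simp add: X elemX_grid elemU_grid L0)
    qed
  qed
qed

lemma EXint_elem:
  assumes n: "n < N" and A: "A \<in> sets (F n)" and \<phi>: "\<phi> \<in> Vh Th"
  shows "EXint M D T (elemX n A \<phi>) = \<tau> * (\<integral>\<omega>\<in>A. l2ip D \<phi> (\<lambda>x. 1) \<partial>M)"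
proof -
  have X: "Xspace M W D Th T N (elemX n A \<phi>)"
    using direction_elem[OF assms] by (simp add: direction_def)
  have "(\<Sum>k<N. \<integral>\<omega>. l2ip D (elemX n A \<phi> (mid k) \<omega>) (\<lambda>x. 1) \<partial>M)
      = (\<Sum>k<N. if k = n then (\<integral>\<omega>\<in>A. l2ip D \<phi> (\<lambda>x. 1) \<partial>M) else 0)"
    by (intro sum.cong refl)
       (simp add: elemX_interval[OF mid_mem] elemX_grid l2ip_cmult_left set_lebesgue_integral_def)
  then show ?thesis unfolding EXint_eq[OF X] using n by simp
qed

text \<open>Only one sampled state and two sampled controls are nonzero; the second control is
  missing from the cost on the last interval.\<close>

lemma dJ_elem:
  assumes n: "n < N" and A: "A \<in> sets (F n)" and \<phi>: "\<phi> \<in> Vh Th"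
  shows "dJ \<alpha> Xd X U (elemX n A \<phi>) (elemU n A \<phi>) = \<tau> * ((\<integral>\<omega>\<in>A. l2ip D \<phi> (resid Xd X n \<omega>) \<partial>M)
      + \<alpha> * (\<integral>\<omega>\<in>A. l2ip D (\<lambda>x. 1 / \<tau> * \<phi> x - Laph D Th \<phi> x) (U (tt n) \<omega>) \<partial>M)
      + (if Suc n < N then \<alpha> * (\<integral>\<omega>\<in>A. l2ip D (\<lambda>x. - 1 / \<tau> * \<phi> x) (U (tt (Suc n)) \<omega>) \<partial>M) else 0))"
proof -
  have 1: "(\<integral>\<omega>. l2ip D (elemX n A \<phi> (mid k) \<omega>) (resid Xd X k \<omega>) \<partial>M)
      = (if k = n then (\<integral>\<omega>\<in>A. l2ip D \<phi> (resid Xd X n \<omega>) \<partial>M) else 0)" for k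
    by (simp add: elemX_interval[OF mid_mem] elemX_grid l2ip_cmult_left set_lebesgue_integral_def)
  have 2: "(\<integral>\<omega>. l2ip D (elemU n A \<phi> (tt k) \<omega>) (U (tt k) \<omega>) \<partial>M)
      = (if k = n then (\<integral>\<omega>\<in>A. l2ip D (\<lambda>x. 1 / \<tau> * \<phi> x - Laph D Th \<phi> x) (U (tt n) \<omega>) \<partial>M) else 0)
       + (if k = Suc n then (\<integral>\<omega>\<in>A. l2ip D (\<lambda>x. - 1 / \<tau> * \<phi> x) (U (tt (Suc n)) \<omega>) \<partial>M) else 0)" for k
    unfolding elemU_grid set_lebesgue_integral_def
    by (cases "k = n"; cases "k = Suc n") (simp_all only: if_True if_False l2ip_cmult_left[of _ "indicator A _"]
        real_scaleR_def l2ip_zero_left integral_zero add_0_right add_0_left n_not_Suc_n refl)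
  show ?thesis
    unfolding dJ_def 1 2 using n by (simp add: sum.distrib distrib_left if_distrib[of "\<lambda>x. \<alpha> * x"] cong: if_cong)
qed

section \<open>The multiplier\<close>

lemma multiplier_exists:
  assumes Xd: "adapted_L2 M W D T Xd"
    and slater: "Uspace M W D Th T N U'" "state M W D Th T N X0 \<sigma> U' X'" "EXint M D T X' < \<delta>"
    and U: "Uspace M W D Th T N U" and S: "state M W D Th T N X0 \<sigma> U X"
    and K: "EXint M D T X \<le> \<delta>"
    and optimal: "\<And>U' X'. Uspace M W D Th T N U' \<Longrightarrow> state M W D Th T N X0 \<sigma> U' X' \<Longrightarrow>
                    EXint M D T X' \<le> \<delta> \<Longrightarrow> Jcost M W D T N \<alpha> Xd X U \<le> Jcost M W D T N \<alpha> Xd X' U'"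
  obtains \<mu> where "\<mu> \<ge> 0" "EXint M D T X < \<delta> \<longrightarrow> \<mu> = 0"
    "\<And>E V. direction E V \<Longrightarrow> dJ \<alpha> Xd X U E V + \<mu> * EXint M D T E = 0"
proof -
  have X: "Xspace M W D Th T N X" using S by (simp add: state_iff)
  \<comment> \<open>The sign \<open>s\<close> allows moves along a direction and against it,
    whichever keeps the constraint; only small positive steps have to be feasible.\<close>
  have first: "0 \<le> s * dJ \<alpha> Xd X U E V"
    if EV: "direction E V" and \<epsilon>0: "\<epsilon>0 > 0"
      and feas: "\<And>\<epsilon>. 0 < \<epsilon> \<Longrightarrow> \<epsilon> < \<epsilon>0 \<Longrightarrow> EXint M D T X + \<epsilon> * (s * EXint M D T E) \<le> \<delta>" for E V s \<epsilon>0
  proof -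
    have E: "Xspace M W D Th T N E" and V: "Uspace M W D Th T N V"
      using EV by (auto simp: direction_def)
    obtain q where q: "\<And>c. Jcost M W D T N \<alpha> Xd (\<lambda>t \<omega> x. X t \<omega> x + c * E t \<omega> x) (\<lambda>t \<omega> x. U t \<omega> x + c * V t \<omega> x)
        = Jcost M W D T N \<alpha> Xd X U + c * dJ \<alpha> Xd X U E V + c\<^sup>2 * q"
      using Jcost_expansion[OF Xd X U E V, where \<alpha>=\<alpha>] by blast
    show ?thesis
    proof (rule nonneg_linear_term[OF \<epsilon>0])
      fix \<epsilon> :: real assume "0 < \<epsilon>" "\<epsilon> < \<epsilon>0"
      have "Jcost M W D T N \<alpha> Xd X U \<le> Jcost M W D T N \<alpha> Xd (\<lambda>t \<omega> x. X t \<omega> x + (\<epsilon> * s) * E t \<omega> x) (\<lambda>t \<omega> x. U t \<omega> x + (\<epsilon> * s) * V t \<omega> x)"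
      proof (intro optimal Uspace_lincomb U V state_add_direction[OF S EV])
        show "EXint M D T (\<lambda>t \<omega> x. X t \<omega> x + (\<epsilon> * s) * E t \<omega> x) \<le> \<delta>"
          unfolding EXint_lincomb[OF X E] using feas[OF \<open>0 < \<epsilon>\<close> \<open>\<epsilon> < \<epsilon>0\<close>] by (simp only: mult.assoc)
      qed
      then show "0 \<le> \<epsilon> * (s * dJ \<alpha> Xd X U E V) + \<epsilon>\<^sup>2 * (s\<^sup>2 * q)"
        unfolding q by (simp add: power_mult_distrib algebra_simps)
    qed
  qed
  show thesis
  proof (cases "EXint M D T X < \<delta>")
    case True
    have "dJ \<alpha> Xd X U E V = 0" if EV: "direction E V" for E V
    proof -
      \<comment> \<open>The slack divided by the size of the constraint derivative: shorter steps
        keep an inactive constraint satisfied in both senses. The added 1 avoids division by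
        zero.\<close>
      define \<epsilon>0 where "\<epsilon>0 = (\<delta> - EXint M D T X) / (\<bar>EXint M D T E\<bar> + 1)"
      have \<epsilon>0: "\<epsilon>0 > 0" using True by (simp add: \<epsilon>0_def divide_pos_pos)
      have "EXint M D T X + \<epsilon> * (s * EXint M D T E) \<le> \<delta>" if "0 < \<epsilon>" "\<epsilon> < \<epsilon>0" "\<bar>s\<bar> = 1" for \<epsilon> s
      proof -
        have "\<epsilon> * (s * EXint M D T E) \<le> \<epsilon> * \<bar>s * EXint M D T E\<bar>" using that by (intro mult_left_mono) auto
        also have "\<dots> \<le> \<epsilon> * (\<bar>EXint M D T E\<bar> + 1)" using that by (intro mult_left_mono) (auto simp: abs_mult)
        also have "\<dots> \<le> \<epsilon>0 * (\<bar>EXint M D T E\<bar> + 1)" using that by (intro mult_right_mono) auto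
        also have "\<dots> = \<delta> - EXint M D T X" by (simp add: \<epsilon>0_def)
        finally show ?thesis by simp
      qed
      from first[OF EV \<epsilon>0 this, of 1] first[OF EV \<epsilon>0 this, of "-1"] show ?thesis by simp
    qed
    then show thesis by (intro that[of 0]) auto
  next
    case False
    with K have eq: "EXint M D T X = \<delta>" by simp
    let ?E = "\<lambda>t \<omega> x. X' t \<omega> x + (-1) * X t \<omega> x" and ?V = "\<lambda>t \<omega> x. U' t \<omega> x + (-1) * U t \<omega> x"
    have X': "Xspace M W D Th T N X'" using slater by (simp add: state_iff)
    have d0: "direction ?E ?V" by (rule direction_state_diff[OF U S slater(1,2)])
    define g0 where "g0 = EXint M D T ?E"
    have g0: "g0 < 0" unfolding g0_def EXint_lincomb[OF X' X] using slater(3) eq by simp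
    define L0 where "L0 = dJ \<alpha> Xd X U ?E ?V"
    \<comment> \<open>The direction to the Slater point decreases the constraint and so is feasible,
      which makes the derivative of the cost nonnegative along it; as \<open>g0\<close> is negative,
      this fixes the sign of the multiplier.\<close>
    have "0 \<le> 1 * L0"
      unfolding L0_def
    proof (rule first[OF d0 zero_less_one])
      fix \<epsilon> :: real assume "0 < \<epsilon>"
      then have "\<epsilon> * g0 \<le> 0" using g0 by (simp add: mult_le_0_iff)
      then show "EXint M D T X + \<epsilon> * (1 * EXint M D T ?E) \<le> \<delta>" by (simp add: eq g0_def)
    qed
    then have L0: "0 \<le> L0" by simp
    have "dJ \<alpha> Xd X U E V + (- L0 / g0) * EXint M D T E = 0" if EV: "direction E V" for E V
    proof -
      define c where "c = - EXint M D T E / g0"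
      let ?E' = "\<lambda>t \<omega> x. E t \<omega> x + c * ?E t \<omega> x" and ?V' = "\<lambda>t \<omega> x. V t \<omega> x + c * ?V t \<omega> x"
      have d: "direction ?E' ?V'" by (rule direction_lincomb[OF EV d0])
      have sp: "Xspace M W D Th T N E" "Uspace M W D Th T N V" "Xspace M W D Th T N ?E" "Uspace M W D Th T N ?V"
        using EV d0 by (auto simp: direction_def)
      have "EXint M D T ?E' = EXint M D T E + c * g0"
        unfolding g0_def by (rule EXint_lincomb[OF sp(1,3)])
      then have z: "EXint M D T ?E' = 0" using g0 by (simp add: c_def)
      have "0 \<le> s * dJ \<alpha> Xd X U ?E' ?V'" for s
        by (rule first[OF d zero_less_one]) (simp only: z eq mult_zero_right add_0_right order_refl)
      from this[of 1] this[of "-1"] have "dJ \<alpha> Xd X U ?E' ?V' = 0" by simp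
      moreover have "dJ \<alpha> Xd X U ?E' ?V' = dJ \<alpha> Xd X U E V + c * L0"
        unfolding L0_def by (rule dJ_lincomb[OF Xd X U sp])
      ultimately show ?thesis using g0 by (simp add: c_def field_simps)
    qed
    moreover have "- L0 / g0 \<ge> 0" using L0 g0 by (simp add: divide_nonneg_neg)
    ultimately show thesis using False by (intro that[of "- L0 / g0"]) auto
  qed
qed

section \<open>The adjoint equation\<close>

text \<open>\<open>A\<close> lies in the past of the interval, so conditional expectations can be
  undone under the integral over \<open>A\<close>. This replaces the averaged state and target in
  the cost by the grid values of the adjoint equation.\<close>

lemma set_integral_resid:
  assumes Xd: "adapted_L2 M W D T Xd" and X: "Xspace M W D Th T N X" and n: "n < N"
    and A: "A \<in> sets (F n)" and \<phi>: "\<phi> \<in> Vh Th"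
  shows "(\<integral>\<omega>\<in>A. l2ip D \<phi> (resid Xd X n \<omega>) \<partial>M)
     = (\<integral>\<omega>\<in>A. l2ip D (\<lambda>x. X (tt (Suc n)) \<omega> x - Xd (tt (Suc n)) \<omega> x) \<phi> \<partial>M)"
proof -
  interpret sigma_finite_subalgebra M "F n" by (rule subalg_sigma_finite[OF F_sub])
  have S: "tt (Suc n) \<in> {0..T}" using n by (intro tt_mem) simp
  have \<phi>s: "sqint D \<phi>" by (rule Vh_sqint[OF \<phi>])
  have AM: "A \<in> sets M" using A F_sub[of "tt n"] by (auto simp: subalgebra_def)
  have r: "l2rv M D M (X (tt (Suc n)))" "l2rv M D M (Xd (tt (Suc n)))" "l2rv M D M (resid Xd X n)"
    "l2rv M D M (X (mid n))" "l2rv M D M (Xdc Xd n)"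
    using XspaceD(1)[OF X S] Xd S l2rv_M resid_l2rv[OF Xd X n] Xspace_l2rv[OF X n] Xdc(2)[OF Xd n]
    unfolding adapted_L2_iff by blast+
  note i1 = l2rv_coordinate(3)[OF r(1) \<phi>s] and i2 = l2rv_coordinate(3)[OF r(2) \<phi>s]
  let ?f = "\<lambda>\<omega>. l2ip D (X (tt (Suc n)) \<omega>) \<phi> - l2ip D (Xd (tt (Suc n)) \<omega>) \<phi>"
  have c1: "AE \<omega> in M. l2ip D (X (mid n) \<omega>) \<phi> = real_cond_exp M (F n) (\<lambda>\<omega>. l2ip D (X (tt (Suc n)) \<omega>) \<phi>) \<omega>"
    using XspaceD(3)[OF X n mid_mem] \<phi> by (simp add: cexpVh_def)
  have c2: "AE \<omega> in M. l2ip D (Xdc Xd n \<omega>) \<phi> = real_cond_exp M (F n) (\<lambda>\<omega>. l2ip D (Xd (tt (Suc n)) \<omega>) \<phi>) \<omega>"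
    using Xdc(1)[OF Xd n] \<phi>s by (simp add: cexpL2_def)
  have c3: "AE \<omega> in M. real_cond_exp M (F n) ?f \<omega> = real_cond_exp M (F n) (\<lambda>\<omega>. l2ip D (X (tt (Suc n)) \<omega>) \<phi>) \<omega>
      - real_cond_exp M (F n) (\<lambda>\<omega>. l2ip D (Xd (tt (Suc n)) \<omega>) \<phi>) \<omega>"
    by (rule real_cond_exp_diff[OF i1 i2])
  have ae: "AE \<omega> in M. l2ip D \<phi> (resid Xd X n \<omega>) = real_cond_exp M (F n) ?f \<omega>"
    using c1 c2 c3 AE_space
  proof eventually_elim
    case (elim \<omega>)
    have "l2ip D (resid Xd X n \<omega>) \<phi> = l2ip D (X (mid n) \<omega>) \<phi> - l2ip D (Xdc Xd n \<omega>) \<phi>"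
      unfolding resid_def by (intro l2ip_diff_left \<phi>s l2rv_sqint[OF r(4) elim(4)] l2rv_sqint[OF r(5) elim(4)])
    then show ?case using elim by (simp add: l2ip_commute)
  qed
  have "(\<integral>\<omega>\<in>A. l2ip D \<phi> (resid Xd X n \<omega>) \<partial>M) = (\<integral>\<omega>\<in>A. real_cond_exp M (F n) ?f \<omega> \<partial>M)"
  proof (rule set_lebesgue_integral_cong_AE[OF AM])
    show "(\<lambda>\<omega>. l2ip D \<phi> (resid Xd X n \<omega>)) \<in> borel_measurable M"
      using l2rv_coordinate(1)[OF r(3) \<phi>s] by (simp add: l2ip_commute)
    show "real_cond_exp M (F n) ?f \<in> borel_measurable M" by simp
    show "AE \<omega>\<in>A in M. l2ip D \<phi> (resid Xd X n \<omega>) = real_cond_exp M (F n) ?f \<omega>"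
      using ae by eventually_elim simp
  qed
  also have "\<dots> = (\<integral>\<omega>\<in>A. ?f \<omega> \<partial>M)"
    using i1 i2 A by (intro real_cond_exp_intA[symmetric]) auto
  also have "\<dots> = (\<integral>\<omega>\<in>A. l2ip D (\<lambda>x. X (tt (Suc n)) \<omega> x - Xd (tt (Suc n)) \<omega> x) \<phi> \<partial>M)"
    using l2rv_sqint[OF r(1)] l2rv_sqint[OF r(2)] \<phi>s unfolding set_lebesgue_integral_def
    by (intro Bochner_Integration.integral_cong refl) (simp add: l2ip_diff_left)
  finally show ?thesis .
qed

text \<open>The value at \<open>T\<close> is set separately to meet the terminal condition; the
  control at \<open>T\<close> itself is not determined by the problem.\<close>

definition adjoint :: "real \<Rightarrow> (real \<Rightarrow> 'w \<Rightarrow> 'x \<Rightarrow> real) \<Rightarrow> real \<Rightarrow> 'w \<Rightarrow> 'x \<Rightarrow> real" where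
  "adjoint \<alpha> U t \<omega> = (if t < T then (\<lambda>x. - \<alpha> * U t \<omega> x) else (\<lambda>x. 0))"

lemma adjoint_Uspace:
  assumes U: "Uspace M W D Th T N U"
  shows "Uspace M W D Th T N (adjoint \<alpha> U)"
  unfolding Uspace_def adapted_L2_iff
proof (intro conjI ballI allI impI)
  fix t assume t: "t \<in> {0..T}"
  show "l2rv M D (natfilt M W t) (adjoint \<alpha> U t)"
  proof (cases "t < T")
    case True
    then have "adjoint \<alpha> U t = (\<lambda>\<omega> x. - \<alpha> * U t \<omega> x)" by (simp add: adjoint_def fun_eq_iff)
    then show ?thesis using l2rv_cmult[OF UspaceD(1)[OF U t], of "- \<alpha>"] by simp
  next
    case False
    then have "adjoint \<alpha> U t = (\<lambda>\<omega> x. 0)" by (simp add: adjoint_def fun_eq_iff)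
    then show ?thesis using l2rv_zero by simp
  qed
  fix \<omega> assume "\<omega> \<in> space M"
  then show "adjoint \<alpha> U t \<omega> \<in> Vh Th"
    unfolding adjoint_def using Vh_cmult[OF UspaceD(2)[OF U t], of \<omega> "- \<alpha>"] Vh_zero by simp
next
  fix n t \<omega> assume *: "n < N" "t \<in> {tt n..<tt (Suc n)}" "\<omega> \<in> space M"
  have "t < T" "tt n < T" using * tt_mem[of "Suc n"] tt_less_iff[of n N] by auto
  then show "adjoint \<alpha> U t \<omega> = adjoint \<alpha> U (tt n) \<omega>"
    unfolding adjoint_def UspaceD(3)[OF U *] by simp
qed

text \<open>Paired with \<open>\<phi>\<close>, the claim identifies a real conditional expectation,
  which is characterised by its integrals over events \<open>A\<close> of \<open>F n\<close>. These
  are supplied by the stationarity condition along the elementary direction of \<open>A\<close> and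
  \<open>\<phi>\<close>; symmetry of the discrete Laplacian and the defining property of the
  projection remove both operators from the random terms.\<close>

lemma adjoint_equation:
  assumes Xd: "adapted_L2 M W D T Xd" and X: "Xspace M W D Th T N X" and U: "Uspace M W D Th T N U"
    and KKT: "\<And>E V. direction E V \<Longrightarrow> dJ \<alpha> Xd X U E V + \<mu> * EXint M D T E = 0"
    and n: "n < N"
  shows "cexpVh M D Th (F n)
        (\<lambda>\<omega> x. adjoint \<alpha> U (tt (Suc n)) \<omega> x + \<tau> * Laph D Th (adjoint \<alpha> U (tt n) \<omega>) x
               + \<tau> * Pih D Th (\<lambda>y. X (tt (Suc n)) \<omega> y - Xd (tt (Suc n)) \<omega> y + \<mu>) x)
        (adjoint \<alpha> U (tt n))"
  unfolding cexpVh_def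
proof
  fix \<phi> assume \<phi>: "\<phi> \<in> Vh Th"
  interpret sigma_finite_subalgebra M "F n" by (rule subalg_sigma_finite[OF F_sub])
  let ?Y = "adjoint \<alpha> U"
  note Y = adjoint_Uspace[OF U, of \<alpha>]
  have L: "Laph D Th \<phi> \<in> Vh Th" by (rule Laph(1)[OF \<phi>])
  have \<phi>s: "sqint D \<phi>" and Ls: "sqint D (Laph D Th \<phi>)" and 1: "sqint D (\<lambda>x. c)" for c
    using Vh_sqint[OF \<phi>] Vh_sqint[OF L] sqint_const[OF D_lmeasurable] by auto
  have S: "tt (Suc n) \<in> {0..T}" "tt n \<in> {0..T}" using n by (auto intro!: tt_mem simp del: atLeastAtMost_iff)
  have rX: "l2rv M D M (X (tt (Suc n)))" "l2rv M D M (Xd (tt (Suc n)))"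
    using XspaceD(1)[OF X S(1)] Xd S l2rv_M unfolding adapted_L2_iff by blast+
  have rD: "l2rv M D M (\<lambda>\<omega> x. X (tt (Suc n)) \<omega> x - Xd (tt (Suc n)) \<omega> x)"
    by (rule l2rv_diff[OF subalgebra_refl rX])
  have rY: "l2rv M D M (?Y (tt (Suc n)))" "l2rv M D M (?Y (tt n))"
    using UspaceD(1)[OF Y S(1)] UspaceD(1)[OF Y S(2)] l2rv_M by blast+
  define h1 h2 h3 g where "h1 \<omega> = l2ip D (?Y (tt (Suc n)) \<omega>) \<phi>"
    and "h2 \<omega> = l2ip D (?Y (tt n) \<omega>) (Laph D Th \<phi>)"
    and "h3 \<omega> = l2ip D (\<lambda>x. X (tt (Suc n)) \<omega> x - Xd (tt (Suc n)) \<omega> x) \<phi>"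
    and "g \<omega> = l2ip D (?Y (tt n) \<omega>) \<phi>" for \<omega>
  define h4 where "h4 = l2ip D \<phi> (\<lambda>x. 1)"
  have i: "integrable M h1" "integrable M h2" "integrable M h3" "integrable M g"
    unfolding h1_def h2_def h3_def g_def
    by (rule l2rv_coordinate(3); intro rY rD \<phi>s Ls)+
  have si: "set_integrable M A f" if "integrable M f" "A \<in> sets (F n)" for f :: "'w \<Rightarrow> real" and A
    unfolding set_integrable_def using that F_sub[of "tt n"]
    by (intro integrable_mult_indicator) (auto simp: subalgebra_def)
  define f where "f \<omega> = h1 \<omega> + \<tau> * h2 \<omega> + \<tau> * h3 \<omega> + \<tau> * \<mu> * h4" for \<omega>
  have fi: "integrable M f" unfolding f_def using i by simp
  have f_eq: "l2ip D (\<lambda>x. ?Y (tt (Suc n)) \<omega> x + \<tau> * Laph D Th (?Y (tt n) \<omega>) x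
               + \<tau> * Pih D Th (\<lambda>y. X (tt (Suc n)) \<omega> y - Xd (tt (Suc n)) \<omega> y + \<mu>) x) \<phi> = f \<omega>"
    if \<omega>: "\<omega> \<in> space M" for \<omega>
  proof -
    let ?d = "\<lambda>y. X (tt (Suc n)) \<omega> y - Xd (tt (Suc n)) \<omega> y"
    have v: "?Y (tt (Suc n)) \<omega> \<in> Vh Th" "?Y (tt n) \<omega> \<in> Vh Th"
      using UspaceD(2)[OF Y S(1) \<omega>] UspaceD(2)[OF Y S(2) \<omega>] by auto
    have d: "sqint D ?d" by (rule l2rv_sqint[OF rD \<omega>])
    have d\<mu>: "sqint D (\<lambda>y. ?d y + \<mu>)" by (intro sqint_add d 1)
    note P = Pih(1)[OF d\<mu>] and LY = Laph(1)[OF v(2)]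
    have "l2ip D (\<lambda>x. ?Y (tt (Suc n)) \<omega> x + \<tau> * Laph D Th (?Y (tt n) \<omega>) x + \<tau> * Pih D Th (\<lambda>y. ?d y + \<mu>) x) \<phi>
        = l2ip D (?Y (tt (Suc n)) \<omega>) \<phi> + \<tau> * l2ip D (Laph D Th (?Y (tt n) \<omega>)) \<phi> + \<tau> * l2ip D (Pih D Th (\<lambda>y. ?d y + \<mu>)) \<phi>"
      unfolding l2ip_lincomb[OF sqint_add[OF Vh_sqint[OF v(1)] sqint_cmult[OF Vh_sqint[OF LY]]] Vh_sqint[OF P] \<phi>s]
        l2ip_lincomb[OF Vh_sqint[OF v(1)] Vh_sqint[OF LY] \<phi>s] ..
    also have "l2ip D (Laph D Th (?Y (tt n) \<omega>)) \<phi> = h2 \<omega>"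
      unfolding h2_def by (rule Laph_symmetric[OF v(2) \<phi>])
    also have "l2ip D (Pih D Th (\<lambda>y. ?d y + \<mu>)) \<phi> = l2ip D (\<lambda>y. ?d y + \<mu> * 1) \<phi>"
      using Pih(2)[OF d\<mu> \<phi>] by simp
    also have "\<dots> = h3 \<omega> + \<mu> * h4"
      unfolding h3_def h4_def l2ip_lincomb[OF d 1 \<phi>s] by (simp add: l2ip_commute)
    finally show ?thesis unfolding f_def h1_def by (simp add: algebra_simps)
  qed
  have "AE \<omega> in M. real_cond_exp M (F n) f \<omega> = g \<omega>"
  proof (rule real_cond_exp_charact[OF _ fi i(4)])
    show "g \<in> borel_measurable (F n)"
      unfolding g_def using UspaceD(1)[OF Y S(2)] \<phi>s by (simp add: l2rv_def wmeas_def)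
    fix A assume A: "A \<in> sets (F n)"
    have AM: "A \<in> sets M" using A F_sub[of "tt n"] by (auto simp: subalgebra_def)
    have Yn: "?Y (tt n) \<omega> = (\<lambda>x. - \<alpha> * U (tt n) \<omega> x)" for \<omega>
      using n tt_less_iff[of n N] by (simp add: adjoint_def)
    \<comment> \<open>Since \<open>Y = - \<alpha> U\<close> at grid points before \<open>T\<close>,
      the control terms of the derivative become pairings of \<open>Y\<close> with
      \<open>\<phi>\<close> and its discrete Laplacian.\<close>
    have k1: "\<alpha> * (\<integral>\<omega>\<in>A. l2ip D (\<lambda>x. 1 / \<tau> * \<phi> x - Laph D Th \<phi> x) (U (tt n) \<omega>) \<partial>M)
        = (\<integral>\<omega>\<in>A. h2 \<omega> - 1 / \<tau> * g \<omega> \<partial>M)"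
      unfolding set_lebesgue_integral_def integral_mult_right_zero[symmetric]
    proof (intro Bochner_Integration.integral_cong refl)
      fix \<omega> assume \<omega>: "\<omega> \<in> space M"
      have u: "sqint D (U (tt n) \<omega>)" by (rule Vh_sqint[OF UspaceD(2)[OF U S(2) \<omega>]])
      have e1: "l2ip D (\<lambda>x. 1 / \<tau> * \<phi> x - Laph D Th \<phi> x) (U (tt n) \<omega>)
          = 1 / \<tau> * l2ip D \<phi> (U (tt n) \<omega>) - l2ip D (Laph D Th \<phi>) (U (tt n) \<omega>)"
        unfolding l2ip_diff_left[OF sqint_cmult[OF \<phi>s] Ls u] l2ip_cmult_left ..
      have e2: "h2 \<omega> = - \<alpha> * l2ip D (Laph D Th \<phi>) (U (tt n) \<omega>)" "g \<omega> = - \<alpha> * l2ip D \<phi> (U (tt n) \<omega>)"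
        unfolding h2_def g_def Yn l2ip_cmult_left by (simp_all add: l2ip_commute)
      show "\<alpha> * (indicator A \<omega> *\<^sub>R l2ip D (\<lambda>x. 1 / \<tau> * \<phi> x - Laph D Th \<phi> x) (U (tt n) \<omega>))
          = indicator A \<omega> *\<^sub>R (h2 \<omega> - 1 / \<tau> * g \<omega>)"
        unfolding e1 e2 by (simp add: algebra_simps)
    qed
    have k2: "(if Suc n < N then \<alpha> * (\<integral>\<omega>\<in>A. l2ip D (\<lambda>x. - 1 / \<tau> * \<phi> x) (U (tt (Suc n)) \<omega>) \<partial>M) else 0)
        = (\<integral>\<omega>\<in>A. 1 / \<tau> * h1 \<omega> \<partial>M)"
    proof (cases "Suc n < N")
      case True
      then have "tt (Suc n) < T" using tt_less_iff[of "Suc n" N] by simp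
      then have "h1 \<omega> = - \<alpha> * l2ip D \<phi> (U (tt (Suc n)) \<omega>)" for \<omega>
        unfolding h1_def adjoint_def by (simp only: if_True l2ip_cmult_left l2ip_commute)
      then have "1 / \<tau> * h1 \<omega> = \<alpha> * l2ip D (\<lambda>x. - 1 / \<tau> * \<phi> x) (U (tt (Suc n)) \<omega>)" for \<omega>
        unfolding l2ip_cmult_left by simp
      then show ?thesis using True by (simp only: if_True set_integral_mult_right)
    next
      \<comment> \<open>Here \<open>Suc n = N\<close>: the absent control term corresponds to
        \<open>Y = 0\<close> at time \<open>T\<close>.\<close>
      case False
      then have "tt (Suc n) = T" using n by (metis Suc_lessI tt_N)
      then have "h1 \<omega> = 0" for \<omega> by (simp add: h1_def adjoint_def)
      then show ?thesis using False by (simp add: set_lebesgue_integral_def)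
    qed
    have split: "(\<integral>\<omega>\<in>A. h2 \<omega> - 1 / \<tau> * g \<omega> \<partial>M) = (\<integral>\<omega>\<in>A. h2 \<omega> \<partial>M) - 1 / \<tau> * (\<integral>\<omega>\<in>A. g \<omega> \<partial>M)"
      using si[OF i(2) A] si[OF integrable_mult_right[OF i(4)] A, of "1 / \<tau>"]
      by (simp only: set_integral_diff set_integral_mult_right)
    have 1: "\<tau> * ((\<integral>\<omega>\<in>A. h3 \<omega> \<partial>M) + ((\<integral>\<omega>\<in>A. h2 \<omega> \<partial>M) - 1 / \<tau> * (\<integral>\<omega>\<in>A. g \<omega> \<partial>M)) + 1 / \<tau> * (\<integral>\<omega>\<in>A. h1 \<omega> \<partial>M))
        + \<mu> * (\<tau> * (\<integral>\<omega>\<in>A. h4 \<partial>M)) = 0"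
      using KKT[OF direction_elem[OF n A \<phi>]]
      unfolding dJ_elem[OF n A \<phi>] EXint_elem[OF n A \<phi>] k1 k2 set_integral_resid[OF Xd X n A \<phi>] split
        set_integral_mult_right h3_def h4_def .
    note s1 = si[OF i(1) A] and s2 = si[OF integrable_mult_right[OF i(2)] A, of \<tau>]
      and s3 = si[OF integrable_mult_right[OF i(3)] A, of \<tau>] and s4 = si[OF integrable_const A, of "\<tau> * \<mu> * h4"]
    have 2: "(\<integral>\<omega>\<in>A. f \<omega> \<partial>M) = (\<integral>\<omega>\<in>A. h1 \<omega> \<partial>M) + \<tau> * (\<integral>\<omega>\<in>A. h2 \<omega> \<partial>M)
        + \<tau> * (\<integral>\<omega>\<in>A. h3 \<omega> \<partial>M) + \<tau> * \<mu> * (\<integral>\<omega>\<in>A. h4 \<partial>M)"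
      unfolding f_def set_integral_add(2)[OF set_integral_add(1)[OF set_integral_add(1)[OF s1 s2] s3] s4]
        set_integral_add(2)[OF set_integral_add(1)[OF s1 s2] s3] set_integral_add(2)[OF s1 s2] set_integral_mult_right ..
    \<comment> \<open>The stationarity condition solved for the integral of \<open>g\<close>: the
      outer factor \<open>t\<close>, which is the step size, cancels the inner factors
      \<open>1 / t\<close>.\<close>
    have alg: "f' = g'" if "t > 0" "t * (c + (b - 1 / t * g') + 1 / t * a) + \<mu> * (t * d) = 0"
      "f' = a + t * b + t * c + t * \<mu> * d" for f' g' t a b c d :: real
      using that by (simp add: algebra_simps)
    show "(\<integral>\<omega>\<in>A. f \<omega> \<partial>M) = (\<integral>\<omega>\<in>A. g \<omega> \<partial>M)"
      by (rule alg[OF tau_pos 1 2])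
  qed
  moreover have "AE \<omega> in M. real_cond_exp M (F n) (\<lambda>\<omega>. l2ip D (\<lambda>x. ?Y (tt (Suc n)) \<omega> x
      + \<tau> * Laph D Th (?Y (tt n) \<omega>) x
      + \<tau> * Pih D Th (\<lambda>y. X (tt (Suc n)) \<omega> y - Xd (tt (Suc n)) \<omega> y + \<mu>) x) \<phi>) \<omega> = real_cond_exp M (F n) f \<omega>"
    by (rule real_cond_exp_cong_space[OF F_sub fi f_eq])
  ultimately show "AE \<omega> in M. l2ip D (?Y (tt n) \<omega>) \<phi> = real_cond_exp M (F n) (\<lambda>\<omega>. l2ip D (\<lambda>x. ?Y (tt (Suc n)) \<omega> x
      + \<tau> * Laph D Th (?Y (tt n) \<omega>) x
      + \<tau> * Pih D Th (\<lambda>y. X (tt (Suc n)) \<omega> y - Xd (tt (Suc n)) \<omega> y + \<mu>) x) \<phi>) \<omega>"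
    by eventually_elim (simp add: g_def)
qed

section \<open>The process \<open>Z\<close> and the variational inequality\<close>

lemma l2rv_sum_Bh:
  assumes G: "subalgebra M G" and c: "\<And>b. b \<in> Bh \<Longrightarrow> c b \<in> borel_measurable G"
    and c2: "\<And>b. b \<in> Bh \<Longrightarrow> integrable M (\<lambda>\<omega>. (c b \<omega>)\<^sup>2)"
  shows "l2rv M D G (\<lambda>\<omega> x. \<Sum>b\<in>Bh. c b \<omega> * b x)"
proof -
  have "l2rv M D G (\<lambda>\<omega> x. \<Sum>b\<in>B. c b \<omega> * b x)" if "B \<subseteq> Bh" for B
    using finite_subset[OF that Bh(1)] that
  proof (induction B rule: finite_induct)
    case empty
    then show ?case by (simp add: l2rv_zero)
  next
    case (insert b B)
    have b: "b \<in> Bh" using insert by simp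
    have "l2rv M D G (\<lambda>\<omega> x. c b \<omega> * b x)"
      using Bh(3)[OF b] c[OF b] c2[OF b]
      by (auto simp: l2rv_def wmeas_def l2ip_cmult_left normsq_cmult sqint_cmult)
    from l2rv_add[OF G this insert.IH] insert show ?case by simp
  qed
  then show ?thesis by simp
qed

text \<open>\<open>Z\<close> is assembled from its basis coordinates. Each is the conditional
  expectation of a square integrable variable times a Brownian increment, hence again square
  integrable although the product itself may not be.\<close>

lemma martingale_part_exists:
  assumes Xd: "adapted_L2 M W D T Xd" and X: "Xspace M W D Th T N X" and Y: "Uspace M W D Th T N Y"
  shows "\<exists>Z. Uspace M W D Th T N Z \<and> (\<forall>n<N. cexpVh M D Th (F n)
        (\<lambda>\<omega> x. (Y (tt (Suc n)) \<omega> x / \<tau> + Pih D Th (\<lambda>y. X (tt (Suc n)) \<omega> y - Xd (tt (Suc n)) \<omega> y) x)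
               * (W (tt (Suc n)) \<omega> - W (tt n) \<omega>)) (Z (tt n)))"
proof -
  \<comment> \<open>The projection is left out: pairing with a basis function does not see it, and
    so the measurability of \<open>v\<close> needs no argument about projecting a random
    element.\<close>
  define v where "v n \<omega> = (\<lambda>x. (X (tt (Suc n)) \<omega> x - Xd (tt (Suc n)) \<omega> x) + 1 / \<tau> * Y (tt (Suc n)) \<omega> x)" for n \<omega>
  let ?w = "\<lambda>n \<omega>. W (tt (Suc n)) \<omega> - W (tt n) \<omega>"
  define z where "z n b = real_cond_exp M (F n) (\<lambda>\<omega>. l2ip D (v n \<omega>) b * ?w n \<omega>)" for n b
  have rd: "l2rv M D M (\<lambda>\<omega> x. X (tt (Suc n)) \<omega> x - Xd (tt (Suc n)) \<omega> x)"
    and rY: "l2rv M D M (Y (tt (Suc n)))" if n: "n < N" for n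
  proof -
    have S: "tt (Suc n) \<in> {0..T}" using n by (intro tt_mem) simp
    have "l2rv M D M (X (tt (Suc n)))" "l2rv M D M (Xd (tt (Suc n)))"
      using XspaceD(1)[OF X S] Xd S l2rv_M unfolding adapted_L2_iff by blast+
    then show "l2rv M D M (\<lambda>\<omega> x. X (tt (Suc n)) \<omega> x - Xd (tt (Suc n)) \<omega> x)"
      by (rule l2rv_diff[OF subalgebra_refl])
    show "l2rv M D M (Y (tt (Suc n)))" by (rule l2rv_M[OF UspaceD(1)[OF Y S]])
  qed
  have rv: "l2rv M D M (v n)" if n: "n < N" for n
    unfolding v_def by (intro l2rv_add[OF subalgebra_refl] l2rv_cmult rd[OF n] rY[OF n])
  have step: "tt n < tt (Suc n)" for n by simp
  have wi: "integrable M (\<lambda>\<omega>. l2ip D (v n \<omega>) b * ?w n \<omega>)" and z2: "integrable M (\<lambda>\<omega>. (z n b \<omega>)\<^sup>2)"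
    if n: "n < N" and b: "b \<in> Bh" for n b
  proof -
    note c = l2rv_coordinate(1,2)[OF rv[OF n] Bh(3)[OF b]]
    note * = BM_cond_exp_increment_square_integrable[OF BM tt_nonneg[of n] step[of n] c]
    show "integrable M (\<lambda>\<omega>. l2ip D (v n \<omega>) b * ?w n \<omega>)" by (rule *(1))
    show "integrable M (\<lambda>\<omega>. (z n b \<omega>)\<^sup>2)" unfolding z_def by (rule *(2))
  qed
  \<comment> \<open>The floor returns the index of the interval containing \<open>t\<close>; at
    \<open>T\<close>, which belongs to none of the half-open intervals, the value 0 is an adapted
    choice.\<close>
  define Z where "Z t = (if t < T then (\<lambda>\<omega> x. \<Sum>b\<in>Bh. z (nat \<lfloor>t / \<tau>\<rfloor>) b \<omega> * b x) else (\<lambda>\<omega> x. 0))" for t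
  have Zn: "Z t = (\<lambda>\<omega> x. \<Sum>b\<in>Bh. z n b \<omega> * b x)" if "n < N" "t \<in> {tt n..<tt (Suc n)}" for n t
  proof -
    have "t < T" using that tt_mem[of "Suc n"] by auto
    then show ?thesis unfolding Z_def interval_index[OF that(2)] by simp
  qed
  have Ztt: "Z (tt n) = (\<lambda>\<omega> x. \<Sum>b\<in>Bh. z n b \<omega> * b x)" if "n < N" for n
    by (rule Zn[OF that]) simp
  show ?thesis
  proof (intro exI[of _ Z] conjI allI impI)
    show "Uspace M W D Th T N Z"
      unfolding Uspace_def adapted_L2_iff
    proof (intro conjI ballI allI impI)
      fix t assume t: "t \<in> {0..T}"
      show "l2rv M D (natfilt M W t) (Z t)"
      proof (cases "t < T")
        case True
        then obtain n where n: "n < N" "t \<in> {tt n..<tt (Suc n)}" using in_interval[of t] t by auto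
        have "l2rv M D (F n) (Z t)"
          unfolding Zn[OF n] by (rule l2rv_sum_Bh[OF F_sub]) (simp_all add: z_def z2[OF n(1), unfolded z_def])
        moreover have "tt n \<le> t" using n(2) by simp
        ultimately show ?thesis by (rule l2rv_natfilt_mono)
      qed (simp add: Z_def l2rv_zero)
      fix \<omega>
      show "Z t \<omega> \<in> Vh Th" unfolding Z_def using sum_Bh_in_Vh Vh_zero by simp
    next
      fix n t \<omega> assume n: "n < N" "t \<in> {tt n..<tt (Suc n)}"
      show "Z t \<omega> = Z (tt n) \<omega>" unfolding Zn[OF n] Ztt[OF n(1)] ..
    qed
    fix n assume n: "n < N"
    interpret sigma_finite_subalgebra M "F n" by (rule subalg_sigma_finite[OF F_sub])
    have S: "tt (Suc n) \<in> {0..T}" using n by (intro tt_mem) simp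
    show "cexpVh M D Th (F n)
        (\<lambda>\<omega> x. (Y (tt (Suc n)) \<omega> x / \<tau> + Pih D Th (\<lambda>y. X (tt (Suc n)) \<omega> y - Xd (tt (Suc n)) \<omega> y) x)
               * ?w n \<omega>) (Z (tt n))"
      unfolding cexpVh_def
    proof
      fix \<phi> assume \<phi>: "\<phi> \<in> Vh Th"
      let ?f = "\<lambda>\<omega>. \<Sum>b\<in>Bh. l2ip D b \<phi> * (l2ip D (v n \<omega>) b * ?w n \<omega>)"
      have fi: "integrable M ?f"
        using wi[OF n] by (intro Bochner_Integration.integrable_sum integrable_mult_right) auto
      have f_eq: "l2ip D (\<lambda>x. (Y (tt (Suc n)) \<omega> x / \<tau> + Pih D Th (\<lambda>y. X (tt (Suc n)) \<omega> y - Xd (tt (Suc n)) \<omega> y) x)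
               * ?w n \<omega>) \<phi> = ?f \<omega>" if \<omega>: "\<omega> \<in> space M" for \<omega>
      proof -
        let ?d = "\<lambda>y. X (tt (Suc n)) \<omega> y - Xd (tt (Suc n)) \<omega> y"
        have d: "sqint D ?d" by (rule l2rv_sqint[OF rd[OF n] \<omega>])
        have y: "Y (tt (Suc n)) \<omega> \<in> Vh Th" by (rule UspaceD(2)[OF Y S \<omega>])
        let ?u = "\<lambda>x. Pih D Th ?d x + 1 / \<tau> * Y (tt (Suc n)) \<omega> x"
        have u: "?u \<in> Vh Th" by (intro Vh_lincomb Pih(1)[OF d] y)
        have ub: "l2ip D ?u b = l2ip D (v n \<omega>) b" if b: "b \<in> Bh" for b
          unfolding v_def l2ip_lincomb[OF Vh_sqint[OF Pih(1)[OF d]] Vh_sqint[OF y] Bh(3)[OF b]]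
            l2ip_lincomb[OF d Vh_sqint[OF y] Bh(3)[OF b]] Pih(2)[OF d Bh(2)[OF b]] ..
        have "(\<lambda>x. (Y (tt (Suc n)) \<omega> x / \<tau> + Pih D Th ?d x) * ?w n \<omega>) = (\<lambda>x. ?w n \<omega> * ?u x)"
          by (rule ext) (simp add: algebra_simps)
        then have "l2ip D (\<lambda>x. (Y (tt (Suc n)) \<omega> x / \<tau> + Pih D Th ?d x) * ?w n \<omega>) \<phi> = ?w n \<omega> * l2ip D ?u \<phi>"
          by (simp only: l2ip_cmult_left)
        also have "l2ip D ?u \<phi> = (\<Sum>b\<in>Bh. l2ip D b ?u * l2ip D b \<phi>)"
          by (subst Bh(5)[OF u]) (rule l2ip_sum_Bh[OF \<phi>])
        also have "?w n \<omega> * \<dots> = ?f \<omega>"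
          unfolding sum_distrib_left
        proof (intro sum.cong refl)
          fix b assume b: "b \<in> Bh"
          show "?w n \<omega> * (l2ip D b ?u * l2ip D b \<phi>) = l2ip D b \<phi> * (l2ip D (v n \<omega>) b * ?w n \<omega>)"
            unfolding l2ip_commute[of D b ?u] ub[OF b] by (simp only: mult_ac)
        qed
        finally show ?thesis .
      qed
      have "AE \<omega> in M. real_cond_exp M (F n) ?f \<omega> = (\<Sum>b\<in>Bh. real_cond_exp M (F n) (\<lambda>\<omega>. l2ip D b \<phi> * (l2ip D (v n \<omega>) b * ?w n \<omega>)) \<omega>)"
      proof -
        \<comment> \<open>Extension by zero outside the basis, because linearity of the conditional
          expectation over finite sums is invoked with integrability for every index.\<close>
        let ?g = "\<lambda>b \<omega>. if b \<in> Bh then l2ip D b \<phi> * (l2ip D (v n \<omega>) b * ?w n \<omega>) else 0"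
        have gi: "integrable M (?g b)" for b
          using wi[OF n, of b] by (cases "b \<in> Bh") auto
        show ?thesis
          using real_cond_exp_sum[where f="?g" and I=Bh, OF gi] by (simp cong: sum.cong)
      qed
      moreover have "AE \<omega> in M. \<forall>b\<in>Bh. real_cond_exp M (F n) (\<lambda>\<omega>. l2ip D b \<phi> * (l2ip D (v n \<omega>) b * ?w n \<omega>)) \<omega> = l2ip D b \<phi> * z n b \<omega>"
        unfolding z_def using wi[OF n] by (intro AE_finite_allI Bh(1) real_cond_exp_cmult)
      moreover have "AE \<omega> in M. real_cond_exp M (F n) (\<lambda>\<omega>. l2ip D (\<lambda>x. (Y (tt (Suc n)) \<omega> x / \<tau>
          + Pih D Th (\<lambda>y. X (tt (Suc n)) \<omega> y - Xd (tt (Suc n)) \<omega> y) x) * ?w n \<omega>) \<phi>) \<omega> = real_cond_exp M (F n) ?f \<omega>"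
        by (rule real_cond_exp_cong_space[OF F_sub fi f_eq])
      ultimately show "AE \<omega> in M. l2ip D (Z (tt n) \<omega>) \<phi> = real_cond_exp M (F n) (\<lambda>\<omega>. l2ip D (\<lambda>x. (Y (tt (Suc n)) \<omega> x / \<tau>
          + Pih D Th (\<lambda>y. X (tt (Suc n)) \<omega> y - Xd (tt (Suc n)) \<omega> y) x) * ?w n \<omega>) \<phi>) \<omega>"
      proof eventually_elim
        case (elim \<omega>)
        have "l2ip D (Z (tt n) \<omega>) \<phi> = (\<Sum>b\<in>Bh. z n b \<omega> * l2ip D b \<phi>)"
          unfolding Ztt[OF n] by (rule l2ip_sum_Bh[OF \<phi>])
        also have "\<dots> = (\<Sum>b\<in>Bh. l2ip D b \<phi> * z n b \<omega>)"
          by (simp only: mult.commute)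
        finally show ?case
          unfolding elim(3) elim(1) using elim(2) by simp
      qed
    qed
  qed
qed

text \<open>A nonzero multiplier forces \<open>X\<close> to attain the bound
  \<open>\<delta>\<close>, which no competitor exceeds; otherwise the integral vanishes.\<close>

lemma multiplier_variational:
  assumes X: "Xspace M W D Th T N X" and K: "EXint M D T X \<le> \<delta>" and \<mu>: "\<mu> \<ge> 0" "EXint M D T X < \<delta> \<longrightarrow> \<mu> = 0"
    and V: "Xspace M W D Th T N V" "EXint M D T V \<le> \<delta>"
  shows "(\<integral>t. (\<integral>x. (\<integral>\<omega>. \<mu> * (V t \<omega> x - X t \<omega> x) \<partial>M) \<partial>lebesgue_on D) \<partial>lebesgue_on {0..T}) \<le> 0"
proof -
  have "(\<integral>t. (\<integral>x. (\<integral>\<omega>. \<mu> * (V t \<omega> x - X t \<omega> x) \<partial>M) \<partial>lebesgue_on D) \<partial>lebesgue_on {0..T})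
      = \<mu> * EXint M D T (\<lambda>t \<omega> x. V t \<omega> x + (-1) * X t \<omega> x)"
    unfolding EXint_def by simp
  also have "\<dots> = \<mu> * (EXint M D T V - EXint M D T X)"
    unfolding EXint_lincomb[OF V(1) X] by simp
  also have "\<dots> \<le> 0"
  proof (cases "\<mu> = 0")
    case False
    then have "EXint M D T X = \<delta>" using \<mu> K by force
    then show ?thesis using V(2) \<mu> by (simp add: mult_nonneg_nonpos)
  qed simp
  finally show ?thesis .
qed

end

section \<open>The discrete optimality system\<close>

theorem mainTheorem3:
  fixes M :: "'w measure" and W :: "real \<Rightarrow> 'w \<Rightarrow> real"
    and D :: "'x::euclidean_space set" and Th :: "'x set set"
    and T \<alpha> \<delta> :: real and N :: nat
    and X0 :: "'x \<Rightarrow> real"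
    and Xd \<sigma> X U :: "real \<Rightarrow> 'w \<Rightarrow> 'x \<Rightarrow> real"
  assumes dim: "DIM('x) \<in> {1, 2, 3}"
    and D_open: "open D" and D_bdd: "bounded D" and D_smooth: "smooth_boundary D"
    and Th: "regular_triangulation Th" and Th_D: "\<Union>Th \<subseteq> closure D"
    and T_pos: "T > 0" and N_pos: "N > 0" and tau_le: "T / real N \<le> 1"
    and M_prob: "prob_space M" and M_complete: "complete_measure M"
    and BM: "std_BM M W"
    and alpha: "\<alpha> > 0"
    and X0: "sqint D X0"
    and Xd: "adapted_L2 M W D T Xd" and sigma: "adapted_L2 M W D T \<sigma>"
    and slater: "\<exists>U' X'. Uspace M W D Th T N U' \<and> state M W D Th T N X0 \<sigma> U' X'
                        \<and> Gh M D T \<delta> X' < 0"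
    and U_adm: "Uspace M W D Th T N U"
    and X_state: "state M W D Th T N X0 \<sigma> U X"
    and X_K: "EXint M D T X \<le> \<delta>"
    and optimal: "\<And>U' X'. Uspace M W D Th T N U' \<Longrightarrow> state M W D Th T N X0 \<sigma> U' X' \<Longrightarrow>
                    EXint M D T X' \<le> \<delta> \<Longrightarrow>
                    Jcost M W D T N \<alpha> Xd X U \<le> Jcost M W D T N \<alpha> Xd X' U'"
  shows "\<exists>\<mu>::real. \<exists>Y Z :: real \<Rightarrow> 'w \<Rightarrow> 'x \<Rightarrow> real.
     \<mu> \<ge> 0 \<and> Uspace M W D Th T N Y \<and> Uspace M W D Th T N Z \<and>
     \<comment> \<open>state equation\<close>
     (\<forall>n<N. \<forall>\<omega>\<in>space M.
        (\<lambda>x. X (tn T N (Suc n)) \<omega> x - X (tn T N n) \<omega> x) =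
        (\<lambda>x. (T / real N) * (Laph D Th (X (tn T N (Suc n)) \<omega>) x + U (tn T N n) \<omega> x)
             + Pih D Th (\<sigma> (tn T N n) \<omega>) x * (W (tn T N (Suc n)) \<omega> - W (tn T N n) \<omega>))) \<and>
     (\<forall>\<omega>\<in>space M. X 0 \<omega> = Pih D Th X0) \<and>
     \<comment> \<open>Z equation\<close>
     (\<forall>n<N. cexpVh M D Th (natfilt M W (tn T N n))
        (\<lambda>\<omega> x. (Y (tn T N (Suc n)) \<omega> x / (T / real N)
                 + Pih D Th (\<lambda>y. X (tn T N (Suc n)) \<omega> y - Xd (tn T N (Suc n)) \<omega> y) x)
               * (W (tn T N (Suc n)) \<omega> - W (tn T N n) \<omega>))
        (Z (tn T N n))) \<and>
     \<comment> \<open>backward (adjoint) equation\<close>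
     (\<forall>n<N. cexpVh M D Th (natfilt M W (tn T N n))
        (\<lambda>\<omega> x. Y (tn T N (Suc n)) \<omega> x + (T / real N) * Laph D Th (Y (tn T N n) \<omega>) x
               + (T / real N) * Pih D Th (\<lambda>y. X (tn T N (Suc n)) \<omega> y - Xd (tn T N (Suc n)) \<omega> y + \<mu>) x)
        (Y (tn T N n))) \<and>
     (\<forall>\<omega>\<in>space M. Y T \<omega> = (\<lambda>x. 0)) \<and>
     \<comment> \<open>variational inequality for the multiplier\<close>
     (\<forall>V. Xspace M W D Th T N V \<and> EXint M D T V \<le> \<delta> \<longrightarrow>
        (\<integral>t. (\<integral>x. (\<integral>\<omega>. \<mu> * (V t \<omega> x - X t \<omega> x) \<partial>M) \<partial>lebesgue_on D) \<partial>lebesgue_on {0..T}) \<le> 0) \<and>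
     \<comment> \<open>optimality condition\<close>
     (\<forall>t\<in>{0..<T}. \<forall>\<omega>\<in>space M. \<forall>x. Y t \<omega> x + \<alpha> * U t \<omega> x = 0) \<and>
     \<comment> \<open>complementarity\<close>
     (EXint M D T X < \<delta> \<longrightarrow> \<mu> = 0)"
proof -
  interpret stoch_fem D Th M W T N
    using D_open D_bdd Th Th_D T_pos N_pos M_prob BM
    by (simp add: stoch_fem_def fem_def stoch_fem_axioms_def)
  have X: "Xspace M W D Th T N X" using X_state by (simp add: state_iff)
  obtain U' X' where sl: "Uspace M W D Th T N U'" "state M W D Th T N X0 \<sigma> U' X'" "EXint M D T X' < \<delta>"
    using slater by (auto simp: Gh_def)
  obtain \<mu> where \<mu>: "\<mu> \<ge> 0" "EXint M D T X < \<delta> \<longrightarrow> \<mu> = 0"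
    "\<And>E V. direction E V \<Longrightarrow> dJ \<alpha> Xd X U E V + \<mu> * EXint M D T E = 0"
    using multiplier_exists[OF Xd sl U_adm X_state X_K optimal] by blast
  let ?Y = "adjoint \<alpha> U"
  have Y: "Uspace M W D Th T N ?Y" by (rule adjoint_Uspace[OF U_adm])
  obtain Z where Z: "Uspace M W D Th T N Z"
    "\<forall>n<N. cexpVh M D Th (F n)
        (\<lambda>\<omega> x. (?Y (tt (Suc n)) \<omega> x / \<tau> + Pih D Th (\<lambda>y. X (tt (Suc n)) \<omega> y - Xd (tt (Suc n)) \<omega> y) x)
               * (W (tt (Suc n)) \<omega> - W (tt n) \<omega>)) (Z (tt n))"
    using martingale_part_exists[OF Xd X Y] by blast
  show ?thesis
  proof (rule exI[of _ \<mu>], rule exI[of _ ?Y], rule exI[of _ Z], intro conjI)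
    show "\<forall>n<N. \<forall>\<omega>\<in>space M.
        (\<lambda>x. X (tn T N (Suc n)) \<omega> x - X (tn T N n) \<omega> x) =
        (\<lambda>x. (T / real N) * (Laph D Th (X (tn T N (Suc n)) \<omega>) x + U (tn T N n) \<omega> x)
             + Pih D Th (\<sigma> (tn T N n) \<omega>) x * (W (tn T N (Suc n)) \<omega> - W (tn T N n) \<omega>))"
      using X_state by (simp add: state_def)
    show "\<forall>\<omega>\<in>space M. X 0 \<omega> = Pih D Th X0"
      using X_state by (simp add: state_def)
    show "\<forall>V. Xspace M W D Th T N V \<and> EXint M D T V \<le> \<delta> \<longrightarrow>
        (\<integral>t. (\<integral>x. (\<integral>\<omega>. \<mu> * (V t \<omega> x - X t \<omega> x) \<partial>M) \<partial>lebesgue_on D) \<partial>lebesgue_on {0..T}) \<le> 0"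
      using multiplier_variational[OF X X_K \<mu>(1,2)] by blast
  qed (use \<mu> Y Z adjoint_equation[OF Xd X U_adm \<mu>(3)] in \<open>auto simp: adjoint_def\<close>)
qed

end
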